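(* Let $p>2$ and let $\mathcal{G}$ be a single-knot metric graph with $H\ge 1$ half-lines. Suppose that $\mathcal{G}$ admits a bound-state and that \[ \sum_{\kappa\ \text{pendant}} \tanh(\ell_\kappa)+2\sum_{\kappa\ \text{loop}}\tanh\Big(\frac{\ell_\kappa}{2}\Big)\neq H-2n\qquad\text{for every } n=0,1,\dots,\lfloor H/2\rfloor, \] where $\ell_\kappa$ denotes the length of the bounded edge $\kappa$ and $\lfloor\cdot\rfloor$ is the integer part. Then there exists an action ground-state on $\mathcal{G}$.
   Context: A single-knot metric graph consists of $H\ge1$ half-lines, $P\ge0$ pendants (bounded edges joining the vertex $\mathbf 0$ to a terminal vertex) and $L\ge0$ loops (bounded edges with both endpoints at $\mathbf 0$), all attached at one vertex $\mathbf 0$. Each bounded edge of length $\ell_\kappa$ is identified with $[0,\ell_\kappa]$ and each half-line with $[0,\infty)$, with $\mathbf 0$ corresponding to $x=0$. $H^1(\mathcal G)$ is the set of continuous functions on $\mathcal G$ whose restriction to each edge is in $H^1$. Fix $p>2$. A bound-state is a nontrivial $u\in H^1(\mathcal G)$ such that $\int_{\mathcal G}u'\eta'+u\eta-|u|^{p-2}u\eta\,dx=0$ for all $\eta\in H^1(\mathcal G)$ (equivalently: $u$ solves $-u''+u=|u|^{p-2}u$ on each edge and at each vertex the sum of the derivatives of $u$ taken in the inward direction of the incident edges vanishes). The action is $S(u)=\frac12\int_{\mathcal G}(|u'|^2+|u|^2)\,dx-\frac1p\int_{\mathcal G}|u|^p\,dx$, the least action level is $\mathcal S_{\mathcal G}=\inf\{S(u):u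 \text{ bound-state}\}$, and an action ground-state is a bound-state $u$ with $S(u)=\mathcal S_{\mathcal G}$. *)

theory Defs
  imports "HOL-Analysis.Analysis"
begin

text \<open>A single-knot metric graph is given by the number H of half-lines, the list
  lp of pendant lengths and the list ll of loop lengths. Edges are tagged.\<close>

datatype edge = Half nat | Pend nat | Loop nat

definition edges :: "nat \<Rightarrow> real list \<Rightarrow> real list \<Rightarrow> edge set" where
  "edges H lp ll = Half ` {..<H} \<union> Pend ` {..<length lp} \<union> Loop ` {..<length ll}"

text \<open>Each edge is identified with an interval; the vertex 0 corresponds to x = 0.\<close>
fun edom :: "real list \<Rightarrow> real list \<Rightarrow> edge \<Rightarrow> real set" where
  "edom lp ll (Half i) = {0..}"
| "edom lp ll (Pend i) = {0..lp ! i}"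
| "edom lp ll (Loop i) = {0..ll ! i}"

text \<open>H^1 on an interval I starting at 0 (continuous representative):
  f is an indefinite Lebesgue integral of g, and both f and g are square integrable on I.
  g is then the weak derivative of f.\<close>
definition H1_edge :: "real set \<Rightarrow> (real \<Rightarrow> real) \<Rightarrow> (real \<Rightarrow> real) \<Rightarrow> bool" where
  "H1_edge I f g \<longleftrightarrow>
     (\<forall>x\<in>I. set_integrable lborel {0..x} g \<and> f x = f 0 + (LINT t:{0..x}|lborel. g t)) \<and>
     set_integrable lborel I (\<lambda>x. (f x)\<^sup>2) \<and> set_integrable lborel I (\<lambda>x. (g x)\<^sup>2)"

text \<open>u belongs to H^1 of the graph, with (weak) derivative u' on each edge:
  H^1 on every edge and continuity at the vertex 0 (for loops both endpoints are 0).\<close>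
definition H1_graph :: "nat \<Rightarrow> real list \<Rightarrow> real list \<Rightarrow> (edge \<Rightarrow> real \<Rightarrow> real)
    \<Rightarrow> (edge \<Rightarrow> real \<Rightarrow> real) \<Rightarrow> bool" where
  "H1_graph H lp ll u u' \<longleftrightarrow>
     (\<forall>e\<in>edges H lp ll. H1_edge (edom lp ll e) (u e) (u' e)) \<and>
     (\<forall>e1\<in>edges H lp ll. \<forall>e2\<in>edges H lp ll. u e1 0 = u e2 0) \<and>
     (\<forall>i<length ll. u (Loop i) (ll ! i) = u (Loop i) 0)"

definition graph_int :: "nat \<Rightarrow> real list \<Rightarrow> real list \<Rightarrow> (edge \<Rightarrow> real \<Rightarrow> real) \<Rightarrow> real" where
  "graph_int H lp ll f = (\<Sum>e\<in>edges H lp ll. LINT x:edom lp ll e|lborel. f e x)"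

definition bound_state :: "nat \<Rightarrow> real list \<Rightarrow> real list \<Rightarrow> real \<Rightarrow> (edge \<Rightarrow> real \<Rightarrow> real) \<Rightarrow> bool" where
  "bound_state H lp ll p u \<longleftrightarrow>
     (\<exists>u'. H1_graph H lp ll u u' \<and>
        (\<exists>e\<in>edges H lp ll. \<exists>x\<in>edom lp ll e. u e x \<noteq> 0) \<and>
        (\<forall>\<eta> \<eta>'. H1_graph H lp ll \<eta> \<eta>' \<longrightarrow>
            graph_int H lp ll (\<lambda>e x. u' e x * \<eta>' e x + u e x * \<eta> e x
                                   - \<bar>u e x\<bar> powr (p - 2) * u e x * \<eta> e x) = 0))"

definition action :: "nat \<Rightarrow> real list \<Rightarrow> real list \<Rightarrow> real \<Rightarrow> (edge \<Rightarrow> real \<Rightarrow> real)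
    \<Rightarrow> (edge \<Rightarrow> real \<Rightarrow> real) \<Rightarrow> real" where
  "action H lp ll p u u' =
     1/2 * graph_int H lp ll (\<lambda>e x. (u' e x)\<^sup>2 + (u e x)\<^sup>2)
     - 1/p * graph_int H lp ll (\<lambda>e x. \<bar>u e x\<bar> powr p)"

definition action_ground_state :: "nat \<Rightarrow> real list \<Rightarrow> real list \<Rightarrow> real \<Rightarrow> (edge \<Rightarrow> real \<Rightarrow> real) \<Rightarrow> bool" where
  "action_ground_state H lp ll p u \<longleftrightarrow>
     bound_state H lp ll p u \<and>
     (\<exists>u'. H1_graph H lp ll u u' \<and>
        (\<forall>v v'. bound_state H lp ll p v \<and> H1_graph H lp ll v v' \<longrightarrow>
           action H lp ll p u u' \<le> action H lp ll p v v'))"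

end

theory Submission
  imports Defs
begin

text \<open>Write $f(s) = |s|^{p-2}s$. A bound state is a classical solution of $u'' = u - f(u)$ on each
  edge, and square integrability forces $u'^2 = u^2 - \frac2p |u|^p$ on the half-lines; its action is
  $(\frac12 - \frac1p)\|u\|_{H^1}^2$. Along a minimizing sequence the initial data at the vertex are
  bounded, so a subsequence converges pointwise by Gronwall's inequality, and the bound in $H^1$ turns
  this into weak convergence: the limit solves the equation and its action does not exceed the infimum.
  It remains to exclude the limit 0. If $u$ is small on the bounded edges and $a = u(\mathbf 0)$, testing
  with $u$ itself, cut off on the half-lines, shows that $u = O(a)$ there (so $a \neq 0$), and testing
  with the solution of $\phi'' = \phi$ that is 1 at $\mathbf 0$, with a Neumann condition at the end of
  each pendant, shows that the outgoing derivatives on the half-lines, which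
  are $\pm a(1+o(1))$, add up to $a\tau(1+o(1))$, where
  $\tau = \sum\tanh\ell_\kappa + 2\sum\tanh(\ell_\kappa/2)$.
  So $\tau$ would be an integer $H - 2m$, which is excluded.\<close>

section \<open>Integration\<close>

text \<open>The obstacle is loss of compactness along the half-lines. There every nonzero solution
  is, up to sign, a piece of a translated soliton, and along a minimizing sequence the peak may
  slide to infinity, so that the limit may vanish. Such a sequence leaves near the vertex a small
  multiple of a solution of the linear equation, which on each half-line is exp(-x) or exp(x)
  according as the peak has been passed or is still ahead. The energy identity fixes only the square
  of the slope, so every choice of signs is conceivable; m negative slopes out of H give the sum H -
  2m, in units of the vertex value. The number \<tau> is what the bounded edges demand of this sum,
  by the Kirchhoff condition of the linear problem. For m > H/2 the sum is negative while \<tau> >=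
  0, which is why the hypothesis stops at floor(H/2). As only finitely many values are to be
  avoided, \<tau> keeps a positive distance from them, and this distance fixes the smallness
  threshold. The Kirchhoff condition for u is never derived: a cutoff on the half-lines extracts the
  flux from the weak equation.\<close>

lemma AE_eq_0_of_integral_greaterThan:
  fixes g :: "real \<Rightarrow> real"
  assumes g: "integrable lborel g"
    and zero: "\<And>x. (LINT t:{x<..}|lborel. g t) = 0"
  shows "AE x in lborel. g x = 0"
proof -
  have [measurable]: "g \<in> borel_measurable borel" using g by auto
  define gp where "gp x = ennreal (max 0 (g x))" for x
  define gm where "gm x = ennreal (max 0 (- g x))" for x
  have gpi: "integrable lborel (\<lambda>x. max 0 (g x))" using g by simp
  have gmi: "integrable lborel (\<lambda>x. max 0 (- g x))" using g by simp
  have [measurable]: "gp \<in> borel_measurable borel" "gm \<in> borel_measurable borel"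
    unfolding gp_def gm_def by measurable
  have p: "emeasure (density lborel gp) {x<..} = ennreal (LINT t:{x<..}|lborel. max 0 (g t))" for x
  proof -
    have "emeasure (density lborel gp) {x<..} = (\<integral>\<^sup>+ t. ennreal (indicator {x<..} t *\<^sub>R max 0 (g t)) \<partial>lborel)"
      by (subst emeasure_density)
        (auto simp: gp_def indicator_def intro!: nn_integral_cong)
    also have "\<dots> = ennreal (LINT t|lborel. indicator {x<..} t *\<^sub>R max 0 (g t))"
      by (rule nn_integral_eq_integral[OF integrable_mult_indicator]) (use gpi in simp_all)
    finally show ?thesis unfolding set_lebesgue_integral_def by simp
  qed
  have m: "emeasure (density lborel gm) {x<..} = ennreal (LINT t:{x<..}|lborel. max 0 (- g t))" for x
  proof -
    have "emeasure (density lborel gm) {x<..} = (\<integral>\<^sup>+ t. ennreal (indicator {x<..} t *\<^sub>R max 0 (- g t)) \<partial>lborel)"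
      by (subst emeasure_density)
        (auto simp: gm_def indicator_def intro!: nn_integral_cong)
    also have "\<dots> = ennreal (LINT t|lborel. indicator {x<..} t *\<^sub>R max 0 (- g t))"
      by (rule nn_integral_eq_integral[OF integrable_mult_indicator]) (use gmi in simp_all)
    finally show ?thesis unfolding set_lebesgue_integral_def by simp
  qed
  have eq: "(LINT t:{x<..}|lborel. max 0 (g t)) = (LINT t:{x<..}|lborel. max 0 (- g t))" for x
  proof -
    have "(LINT t:{x<..}|lborel. max 0 (g t)) - (LINT t:{x<..}|lborel. max 0 (- g t))
      = (LINT t:{x<..}|lborel. max 0 (g t) - max 0 (- g t))"
      by (rule set_integral_diff(2)[symmetric])
        (unfold set_integrable_def, (rule integrable_mult_indicator, simp, rule gpi gmi)+)
    also have "(\<lambda>t. max 0 (g t) - max 0 (- g t)) = g" by (auto simp: max_def)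
    finally show ?thesis using zero by simp
  qed
  \<comment> \<open>Open right half-lines determine a measure that is finite on them. Finite total
    mass then makes the densities agree almost everywhere.\<close>
  have "density lborel gp = density lborel gm"
    by (rule measure_eqI_lessThan) (auto simp: p m eq)
  moreover have "integral\<^sup>N lborel gp \<noteq> \<infinity>"
    unfolding gp_def by (subst nn_integral_eq_integral[OF gpi]) auto
  ultimately have "AE x in lborel. gp x = gm x"
    by (subst (asm) finite_density_unique) (auto simp: gp_def gm_def)
  then show ?thesis
    by eventually_elim (auto simp: gp_def gm_def max_def split: if_splits)
qed

text \<open>This yields uniqueness of weak derivatives. After extension of \<open>g\<close> by zero,
  the integral over a tail starting in [a, b] is the difference of two vanishing integrals, so the
  criterion for tails applies.\<close>

lemma AE_eq_0_of_indefinite_integral: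
  fixes g :: "real \<Rightarrow> real"
  assumes g: "set_integrable lborel {a..b} g"
    and zero: "\<And>x. x \<in> {a..b} \<Longrightarrow> (LINT t:{a..x}|lborel. g t) = 0"
  shows "AE x in lborel. x \<in> {a..b} \<longrightarrow> g x = 0"
proof (cases "a \<le> b")
  case True
  let ?h = "\<lambda>t. indicator {a..b} t *\<^sub>R g t"
  have h: "integrable lborel ?h" using g unfolding set_integrable_def .
  have "(LINT t:{x<..}|lborel. ?h t) = 0" for x
  proof -
    have eq: "(LINT t:{x<..}|lborel. ?h t) = (LINT t:({a..b} \<inter> {x<..})|lborel. g t)"
      unfolding set_lebesgue_integral_def
      by (intro Bochner_Integration.integral_cong) (auto simp: indicator_def)
    show ?thesis
    proof (cases "x \<in> {a..b}")
      case xin: True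
      have "(LINT t:{a..b}|lborel. g t) = (LINT t:{a..x} \<union> ({a..b} \<inter> {x<..})|lborel. g t)"
        using xin by (intro arg_cong2[where f="set_lebesgue_integral lborel"]) auto
      also have "\<dots> = (LINT t:{a..x}|lborel. g t) + (LINT t:({a..b} \<inter> {x<..})|lborel. g t)"
        by (rule set_integral_Un) (use xin in \<open>auto intro!: set_integrable_subset[OF g]\<close>)
      finally show ?thesis using zero[OF xin] zero[of b] True eq by simp
    next
      case False
      then consider "x < a" | "x > b" by force
      then show ?thesis
      proof cases
        case 1
        then have "{a..b} \<inter> {x<..} = {a..b}" by auto
        then show ?thesis using zero[of b] True eq by simp
      next
        case 2
        then have "{a..b} \<inter> {x<..} = {}" by auto
        then show ?thesis using eq by (simp add: set_lebesgue_integral_def)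
      qed
    qed
  qed
  from AE_eq_0_of_integral_greaterThan[OF h this] show ?thesis
    by eventually_elim (auto simp: indicator_def)
qed auto

lemma set_integral_FTC:
  fixes F f :: "real \<Rightarrow> real"
  assumes "a \<le> b" "\<And>x. x \<in> {a..b} \<Longrightarrow> (F has_real_derivative f x) (at x within {a..b})"
    "continuous_on {a..b} f"
  shows "(LINT x:{a..b}|lborel. f x) = F b - F a"
proof -
  have "(f has_integral F b - F a) {a..b}"
    using assms by (intro fundamental_theorem_of_calculus)
      (auto simp: has_real_derivative_iff_has_vector_derivative[symmetric])
  moreover have "(LINT x:{a..b}|lborel. f x) = integral {a..b} f"
    using borel_integrable_atLeastAtMost'[OF assms(3)] by (rule set_borel_integral_eq_integral)
  ultimately show ?thesis by (simp add: integral_unique)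
qed

text \<open>Fatou's lemma for the squares; no dominating function is at hand.\<close>

lemma integral_square_tendsto_bounded:
  fixes g :: "'a \<Rightarrow> real"
  assumes lim: "\<And>x. (\<lambda>n. G n x) \<longlonglongrightarrow> g x"
    and Gm[measurable]: "\<And>n. G n \<in> borel_measurable M"
    and Gi: "\<And>n. integrable M (\<lambda>x. (G n x)\<^sup>2)"
    and B: "\<And>n. (LINT x|M. (G n x)\<^sup>2) \<le> B"
  shows "g \<in> borel_measurable M" "integrable M (\<lambda>x. (g x)\<^sup>2)" "(LINT x|M. (g x)\<^sup>2) \<le> B"
proof -
  show gm[measurable]: "g \<in> borel_measurable M"
    by (rule borel_measurable_LIMSEQ_real[OF lim Gm])
  have B0: "0 \<le> B" by (rule order_trans[OF _ B[of 0]]) simp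
  have "(\<integral>\<^sup>+x. ennreal ((g x)\<^sup>2) \<partial>M) = (\<integral>\<^sup>+x. liminf (\<lambda>n. ennreal ((G n x)\<^sup>2)) \<partial>M)"
  proof (rule nn_integral_cong)
    fix x
    have "(\<lambda>n. ennreal ((G n x)\<^sup>2)) \<longlonglongrightarrow> ennreal ((g x)\<^sup>2)"
      by (intro tendsto_ennrealI tendsto_power lim)
    then show "ennreal ((g x)\<^sup>2) = liminf (\<lambda>n. ennreal ((G n x)\<^sup>2))"
      using lim_imp_Liminf trivial_limit_sequentially by metis
  qed
  also have "\<dots> \<le> liminf (\<lambda>n. \<integral>\<^sup>+x. ennreal ((G n x)\<^sup>2) \<partial>M)"
    by (rule nn_integral_liminf) simp
  also have "\<dots> = liminf (\<lambda>n. ennreal (LINT x|M. (G n x)\<^sup>2))"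
    using nn_integral_eq_integral[OF Gi] by simp
  also have "\<dots> \<le> liminf (\<lambda>n. ennreal B)"
    by (rule Liminf_mono) (rule always_eventually, intro allI ennreal_leI B)
  also have "\<dots> = ennreal B" by (simp add: Liminf_const)
  finally have le: "(\<integral>\<^sup>+x. ennreal ((g x)\<^sup>2) \<partial>M) \<le> ennreal B" .
  show gi: "integrable M (\<lambda>x. (g x)\<^sup>2)"
  proof (rule integrableI_bounded)
    show "(\<integral>\<^sup>+ x. ennreal (norm ((g x)\<^sup>2)) \<partial>M) < \<infinity>"
      using le by (simp add: order_le_less_trans)
  qed measurable
  show "(LINT x|M. (g x)\<^sup>2) \<le> B"
    using le by (subst (asm) nn_integral_eq_integral[OF gi]) (auto simp: B0)
qed

text \<open>Only integrability is wanted, so the pointwise bound |f g| <= f^2 + g^2 takes the place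
  of the Cauchy-Schwarz inequality.\<close>

lemma integrable_mult_of_squares:
  fixes f g :: "'a \<Rightarrow> real"
  assumes [measurable]: "f \<in> borel_measurable M" "g \<in> borel_measurable M"
    and f: "integrable M (\<lambda>x. (f x)\<^sup>2)" and g: "integrable M (\<lambda>x. (g x)\<^sup>2)"
  shows "integrable M (\<lambda>x. f x * g x)"
proof (rule Bochner_Integration.integrable_bound[OF Bochner_Integration.integrable_add[OF f g]])
  have "norm (f x * g x) \<le> norm ((f x)\<^sup>2 + (g x)\<^sup>2)" for x
  proof -
    have "2 * (\<bar>f x\<bar> * \<bar>g x\<bar>) \<le> (f x)\<^sup>2 + (g x)\<^sup>2"
      using sum_squares_bound[of "\<bar>f x\<bar>" "\<bar>g x\<bar>"] by simp
    moreover have "0 \<le> \<bar>f x\<bar> * \<bar>g x\<bar>" by simp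
    ultimately have "\<bar>f x\<bar> * \<bar>g x\<bar> \<le> (f x)\<^sup>2 + (g x)\<^sup>2" by linarith
    then show ?thesis by (simp add: abs_mult)
  qed
  then show "AE x in M. norm (f x * g x) \<le> norm ((f x)\<^sup>2 + (g x)\<^sup>2)" by simp
qed measurable

text \<open>A sequence bounded in $L^2$ and converging pointwise converges weakly in $L^2$. Tails need no
  separate treatment: with $D$ the distance to the limit, the positive part of
  $D|h| - \delta D^2$ is dominated by $h^2/(4\delta)$, while the remainder $\delta\int D^2$ is
  uniformly small.\<close>
lemma weak_L2_convergence:
  fixes g h :: "'a \<Rightarrow> real"
  assumes lim: "\<And>x. (\<lambda>n. G n x) \<longlonglongrightarrow> g x"
    and Gm[measurable]: "\<And>n. G n \<in> borel_measurable M"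
    and Gi: "\<And>n. integrable M (\<lambda>x. (G n x)\<^sup>2)"
    and B: "\<And>n. (LINT x|M. (G n x)\<^sup>2) \<le> B"
    and hm[measurable]: "h \<in> borel_measurable M" and hi: "integrable M (\<lambda>x. (h x)\<^sup>2)"
  shows "(\<lambda>n. LINT x|M. G n x * h x) \<longlonglongrightarrow> (LINT x|M. g x * h x)"
proof -
  note g = integral_square_tendsto_bounded[OF lim Gm Gi B]
  note gm[measurable] = g(1)
  have B0: "0 \<le> B" by (rule order_trans[OF _ B[of 0]]) simp
  define D where "D n x = \<bar>G n x - g x\<bar>" for n x
  have Dm[measurable]: "D n \<in> borel_measurable M" for n unfolding D_def by measurable
  have D2i: "integrable M (\<lambda>x. (D n x)\<^sup>2)" for n
  proof -
    have "integrable M (\<lambda>x. (G n x)\<^sup>2 + (g x)\<^sup>2 - 2 * (G n x * g x))"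
      by (intro Bochner_Integration.integrable_diff Bochner_Integration.integrable_add
          integrable_mult_right integrable_mult_of_squares Gi g Gm)
    also have "(\<lambda>x. (G n x)\<^sup>2 + (g x)\<^sup>2 - 2 * (G n x * g x)) = (\<lambda>x. (D n x)\<^sup>2)"
      by (auto simp: D_def power2_diff)
    finally show ?thesis .
  qed
  have D2: "(LINT x|M. (D n x)\<^sup>2) \<le> 4 * B" for n
  proof -
    have "(D n x)\<^sup>2 \<le> 2 * (G n x)\<^sup>2 + 2 * (g x)\<^sup>2" for x
      unfolding D_def power2_abs using sum_squares_bound[of "G n x" "- g x"]
      by (simp add: power2_diff)
    then have "(LINT x|M. (D n x)\<^sup>2) \<le> (LINT x|M. 2 * (G n x)\<^sup>2 + 2 * (g x)\<^sup>2)"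
      by (intro integral_mono D2i Bochner_Integration.integrable_add integrable_mult_right Gi g)
    also have "\<dots> = 2 * (LINT x|M. (G n x)\<^sup>2) + 2 * (LINT x|M. (g x)\<^sup>2)"
      by (subst Bochner_Integration.integral_add) (auto intro!: integrable_mult_right Gi g)
    also have "\<dots> \<le> 4 * B" using B[of n] g(3) by simp
    finally show ?thesis .
  qed
  have DhI: "integrable M (\<lambda>x. D n x * \<bar>h x\<bar>)" for n
    by (rule integrable_mult_of_squares[OF _ _ D2i]) (use hi in simp_all)
  show ?thesis
  proof (rule LIMSEQ_I)
    fix r :: real assume r: "0 < r"
    \<comment> \<open>Since the integral of D^2 is at most 4B, the remainder d times 4B is at most
      r/2. The summand 8 keeps the denominator positive when B = 0.\<close>
    define d where "d = r / (8 * B + 8)"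
    have d: "d > 0" unfolding d_def using r B0 by simp
    let ?P = "\<lambda>n x. max 0 (D n x * \<bar>h x\<bar> - d * (D n x)\<^sup>2)"
    have Pb: "?P n x \<le> (h x)\<^sup>2 / (4 * d)" for n x
    proof -
      have "0 \<le> (2 * d * D n x - \<bar>h x\<bar>)\<^sup>2" by simp
      then have "4 * d * (D n x * \<bar>h x\<bar> - d * (D n x)\<^sup>2) \<le> (h x)\<^sup>2"
        by (simp add: power2_diff algebra_simps power2_eq_square)
      then show ?thesis using d by (simp add: field_simps)
    qed
    have "(\<lambda>n. LINT x|M. ?P n x) \<longlonglongrightarrow> (LINT x|M. 0)"
    proof (rule integral_dominated_convergence[where w="\<lambda>x. (h x)\<^sup>2 / (4 * d)"])
      show "AE x in M. (\<lambda>n. ?P n x) \<longlonglongrightarrow> 0"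
      proof (rule AE_I2)
        fix x
        have "(\<lambda>n. D n x) \<longlonglongrightarrow> \<bar>g x - g x\<bar>"
          unfolding D_def by (intro tendsto_intros lim)
        then have "(\<lambda>n. ?P n x) \<longlonglongrightarrow> max 0 (0 * \<bar>h x\<bar> - d * 0\<^sup>2)"
          by (intro tendsto_intros) simp_all
        then show "(\<lambda>n. ?P n x) \<longlonglongrightarrow> 0" by simp
      qed
      show "AE x in M. norm (?P n x) \<le> (h x)\<^sup>2 / (4 * d)" for n
        using Pb[of n] by (intro AE_I2) (simp add: abs_of_nonneg)
    qed (use hi in \<open>auto intro!: borel_measurable_max\<close>)
    then have "\<forall>\<^sub>F n in sequentially. (LINT x|M. ?P n x) < r / 2"
      using r by (intro order_tendstoD(2)) auto
    then obtain N where N: "\<And>n. n \<ge> N \<Longrightarrow> (LINT x|M. ?P n x) < r / 2"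
      unfolding eventually_sequentially by auto
    have "norm ((LINT x|M. G n x * h x) - (LINT x|M. g x * h x)) < r" if n: "n \<ge> N" for n
    proof -
      have Pi: "integrable M (?P n)"
        by (rule Bochner_Integration.integrable_bound[where f="\<lambda>x. (h x)\<^sup>2 / (4 * d)"])
          (use hi order_trans[OF Pb[of n] abs_ge_self] in \<open>simp_all del: abs_divide\<close>)
      have "(LINT x|M. G n x * h x) - (LINT x|M. g x * h x) = (LINT x|M. G n x * h x - g x * h x)"
        by (intro Bochner_Integration.integral_diff[symmetric] integrable_mult_of_squares Gi g hi Gm hm)
      then have "norm ((LINT x|M. G n x * h x) - (LINT x|M. g x * h x)) \<le> (LINT x|M. norm (G n x * h x - g x * h x))"
        by simp
      also have "\<dots> = (LINT x|M. D n x * \<bar>h x\<bar>)"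
        by (intro Bochner_Integration.integral_cong) (auto simp: D_def abs_mult[symmetric] left_diff_distrib)
      also have "\<dots> \<le> (LINT x|M. ?P n x + d * (D n x)\<^sup>2)"
        by (intro integral_mono DhI Bochner_Integration.integrable_add Pi integrable_mult_right D2i) auto
      also have "\<dots> = (LINT x|M. ?P n x) + d * (LINT x|M. (D n x)\<^sup>2)"
        by (subst Bochner_Integration.integral_add[OF Pi]) (auto intro!: integrable_mult_right D2i)
      also have "\<dots> < r / 2 + d * (4 * B)"
        by (intro add_less_le_mono N n mult_left_mono D2) (use d in auto)
      also have "d * (4 * B) \<le> r / 2"
        unfolding d_def using r B0 by (simp add: field_simps)
      finally show ?thesis by simp
    qed
    then show "\<exists>no. \<forall>n\<ge>no. norm ((LINT x|M. G n x * h x) - (LINT x|M. g x * h x)) < r"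
      by (intro exI[of _ N]) simp
  qed
qed

section \<open>The nonlinearity and the equation on an edge\<close>

definition nl :: "real \<Rightarrow> real \<Rightarrow> real" where
  "nl p s = \<bar>s\<bar> powr (p - 2) * s"

lemma nl_0 [simp]: "nl p 0 = 0"
  by (simp add: nl_def)

lemma nl_mult_self: "nl p s * s = \<bar>s\<bar> powr p"
proof (cases "s = 0")
  case False
  have "\<bar>s\<bar> powr p = \<bar>s\<bar> powr ((p - 2) + 2)" by simp
  also have "\<dots> = \<bar>s\<bar> powr (p - 2) * \<bar>s\<bar> powr 2" by (rule powr_add)
  also have "\<bar>s\<bar> powr 2 = s * s" using False by (simp add: power2_eq_square)
  finally show ?thesis by (simp add: nl_def)
qed simp

text \<open>Because p > 2, the factor |s|^(p-2) is increasing in |s|. Bounding it by M^(p-2) leaves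
  a quadratic term whose coefficient tends to 0 with M; this is how smallness of a solution makes
  the nonlinear term negligible.\<close>

lemma abs_powr_le:
  fixes p :: real
  assumes "2 < p" "\<bar>s\<bar> \<le> M"
  shows "\<bar>s\<bar> powr p \<le> M powr (p - 2) * s\<^sup>2"
proof -
  have "\<bar>s\<bar> powr p = \<bar>s\<bar> powr (p - 2) * s\<^sup>2"
    using nl_mult_self[of p s] by (simp add: nl_def power2_eq_square)
  also have "\<dots> \<le> M powr (p - 2) * s\<^sup>2"
    using assms by (intro mult_right_mono powr_mono2) auto
  finally show ?thesis .
qed

lemma abs_nl_le:
  assumes "2 < p" "\<bar>s\<bar> \<le> M"
  shows "\<bar>nl p s\<bar> \<le> M powr (p - 2) * \<bar>s\<bar>"
proof -
  have "\<bar>s\<bar> powr (p - 2) \<le> M powr (p - 2)"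
    using assms by (intro powr_mono2) auto
  then show ?thesis unfolding nl_def abs_mult by (intro mult_right_mono) auto
qed

lemma DERIV_at_0_iff_tendsto:
  fixes f :: "real \<Rightarrow> real"
  assumes "f 0 = 0"
  shows "(f has_real_derivative D) (at 0) \<longleftrightarrow> ((\<lambda>h. f h / h) \<longlongrightarrow> D) (at 0)"
  using assms by (simp add: DERIV_def)

lemma tendsto_abs_powr_0:
  fixes a :: real
  assumes "0 < a"
  shows "((\<lambda>h::real. \<bar>h\<bar> powr a) \<longlongrightarrow> 0) (at 0)"
proof -
  have "((\<lambda>h::real. \<bar>h\<bar>) \<longlongrightarrow> \<bar>0\<bar>) (at 0)" by (intro tendsto_intros)
  then have "((\<lambda>h::real. \<bar>h\<bar> powr a) \<longlongrightarrow> 0 powr a) (at 0)"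
    using assms by (intro tendsto_powr') auto
  then show ?thesis by simp
qed

lemma has_real_derivative_nl:
  assumes p: "2 < p"
  shows "(nl p has_real_derivative (p - 1) * \<bar>s\<bar> powr (p - 2)) (at s)"
proof -
  consider "s = 0" | "0 < s" | "s < 0" by linarith
  then show ?thesis
  proof cases
    case 1
    \<comment> \<open>The difference quotient at 0 is |h|^(p-2), which tends to 0 since p > 2. The
      claimed value agrees because \<open>0 powr (p - 2)\<close> is 0.\<close>
    have "((\<lambda>h. nl p h / h) \<longlongrightarrow> 0) (at 0)"
    proof (rule Lim_transform_eventually)
      show "((\<lambda>h::real. \<bar>h\<bar> powr (p - 2)) \<longlongrightarrow> 0) (at 0)"
        using p by (intro tendsto_abs_powr_0) simp
      show "\<forall>\<^sub>F h in at 0. \<bar>h\<bar> powr (p - 2) = nl p h / h"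
        by (auto simp: eventually_at_filter nl_def)
    qed
    then show ?thesis using 1 by (simp add: DERIV_at_0_iff_tendsto)
  next
    case 2
    have "((\<lambda>t. t powr (p - 1)) has_real_derivative (p - 1) * s powr (p - 1 - 1)) (at s)"
      by (rule has_real_derivative_powr[OF 2])
    moreover have "\<forall>\<^sub>F t in nhds s. t powr (p - 1) = nl p t"
    proof (rule eventually_mono[OF eventually_nhds_in_open[OF open_greaterThan[of 0]]])
      fix t :: real assume "t \<in> {0<..}"
      then show "t powr (p - 1) = nl p t"
        using powr_mult_base[of t "p - 2"] by (simp add: nl_def mult.commute)
    qed (use 2 in auto)
    ultimately show ?thesis using 2 by (subst (asm) DERIV_cong_ev[OF refl _ refl]) auto
  next
    case 3
    have "((\<lambda>t. - ((- t) powr (p - 1))) has_real_derivative (p - 1) * (- s) powr (p - 1 - 1)) (at s)"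
      using 3 by (auto intro!: derivative_eq_intros)
    moreover have "\<forall>\<^sub>F t in nhds s. - ((- t) powr (p - 1)) = nl p t"
    proof (rule eventually_mono[OF eventually_nhds_in_open[OF open_lessThan[of 0]]])
      fix t :: real assume "t \<in> {..<0}"
      then show "- ((- t) powr (p - 1)) = nl p t"
        using powr_mult_base[of "- t" "p - 2"] by (simp add: nl_def mult.commute)
    qed (use 3 in auto)
    ultimately show ?thesis using 3 by (subst (asm) DERIV_cong_ev[OF refl _ refl]) auto
  qed
qed

text \<open>Reading |s|^p as \<open>nl p s * s\<close> lets the product rule cover s = 0 as
  well.\<close>

lemma has_real_derivative_abs_powr:
  assumes p: "2 < p"
  shows "((\<lambda>s. \<bar>s\<bar> powr p) has_real_derivative p * nl p s) (at s)"
proof -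
  have "((\<lambda>s. nl p s * s) has_real_derivative (p - 1) * \<bar>s\<bar> powr (p - 2) * s + nl p s * 1) (at s)"
    by (rule derivative_eq_intros has_real_derivative_nl[OF p] | simp)+
  moreover have "(p - 1) * \<bar>s\<bar> powr (p - 2) * s + nl p s * 1 = p * nl p s"
    by (simp add: nl_def algebra_simps)
  ultimately show ?thesis by (simp add: nl_mult_self)
qed

lemma continuous_on_nl: "2 < p \<Longrightarrow> continuous_on S f \<Longrightarrow> continuous_on S (\<lambda>x. nl p (f x))"
  using has_real_derivative_nl[THEN DERIV_isCont, of p]
  by (intro continuous_on_compose2[of UNIV "nl p" S f]) (auto simp: continuous_on_eq_continuous_at)

lemma borel_measurable_nl [measurable]: "nl p \<in> borel_measurable borel"
  unfolding nl_def[abs_def] by measurable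

lemma nl_Lipschitz:
  assumes p: "2 < p" and s: "\<bar>s\<bar> \<le> M" and t: "\<bar>t\<bar> \<le> M"
  shows "\<bar>nl p s - nl p t\<bar> \<le> (p - 1) * M powr (p - 2) * \<bar>s - t\<bar>"
proof -
  have "norm (nl p s - nl p t) \<le> (p - 1) * M powr (p - 2) * norm (s - t)"
  proof (rule field_differentiable_bound[where S="{-M..M}"])
    fix x assume x: "x \<in> {-M..M}"
    show "(nl p has_field_derivative (p - 1) * \<bar>x\<bar> powr (p - 2)) (at x within {-M..M})"
      by (rule has_field_derivative_at_within[OF has_real_derivative_nl[OF p]])
    show "norm ((p - 1) * \<bar>x\<bar> powr (p - 2)) \<le> (p - 1) * M powr (p - 2)"
      using p x by (auto simp: abs_mult intro!: mult_left_mono powr_mono2)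
  qed (use s t in auto)
  then show ?thesis by simp
qed

text \<open>The second-order equation as a first-order system in the phase plane. Derivatives within
  \<open>I\<close> are one-sided at the end points, so nothing is prescribed beyond the
  edge.\<close>

definition edge_sol :: "real \<Rightarrow> real set \<Rightarrow> (real \<Rightarrow> real) \<Rightarrow> (real \<Rightarrow> real) \<Rightarrow> bool" where
  "edge_sol p I u w \<longleftrightarrow> (\<forall>x\<in>I. (u has_real_derivative w x) (at x within I) \<and>
      (w has_real_derivative u x - nl p (u x)) (at x within I))"

lemma edge_sol_subset: "edge_sol p I u w \<Longrightarrow> J \<subseteq> I \<Longrightarrow> edge_sol p J u w"
  unfolding edge_sol_def by (meson DERIV_subset subsetD)

lemma edge_sol_continuous:
  assumes "edge_sol p I u w" shows "continuous_on I u" "continuous_on I w"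
proof -
  show "continuous_on I u"
    using assms unfolding edge_sol_def by (intro DERIV_continuous_on[where D=w]) auto
  show "continuous_on I w"
    using assms unfolding edge_sol_def
    by (intro DERIV_continuous_on[where D="\<lambda>x. u x - nl p (u x)"]) auto
qed

lemma edge_sol_zero: "edge_sol p I (\<lambda>_. 0) (\<lambda>_. 0)"
  by (simp add: edge_sol_def)

text \<open>Gronwall's argument: $e^{-Cx}$ times the squared distance in the phase plane is
  nonincreasing.\<close>
lemma edge_sol_stable:
  assumes p: "2 < p" and s1: "edge_sol p {0..R} u1 w1" and s2: "edge_sol p {0..R} u2 w2"
    and M1: "\<And>x. x \<in> {0..R} \<Longrightarrow> \<bar>u1 x\<bar> \<le> M" and M2: "\<And>x. x \<in> {0..R} \<Longrightarrow> \<bar>u2 x\<bar> \<le> M"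
    and x: "x \<in> {0..R}"
  shows "(u1 x - u2 x)\<^sup>2 + (w1 x - w2 x)\<^sup>2
    \<le> exp ((2 + (p - 1) * M powr (p - 2)) * x) * ((u1 0 - u2 0)\<^sup>2 + (w1 0 - w2 0)\<^sup>2)"
proof -
  \<comment> \<open>\<open>K\<close> is a Lipschitz constant of \<open>nl p\<close> on [-M, M]. If d
    and e are the differences of the values and of the slopes, then the derivative of d^2 + e^2 is
    at most (4 + 2K)|d||e|, hence at most (2 + K)(d^2 + e^2).\<close>
  define K where "K = (p - 1) * M powr (p - 2)"
  define C where "C = 2 + K"
  have K: "0 \<le> K" unfolding K_def using p by simp
  let ?y = "\<lambda>x. exp (- C * x) * ((u1 x - u2 x)\<^sup>2 + (w1 x - w2 x)\<^sup>2)"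
  let ?z = "\<lambda>x. (u1 x - u2 x)\<^sup>2 + (w1 x - w2 x)\<^sup>2"
  let ?z' = "\<lambda>x. 2 * (u1 x - u2 x) * (w1 x - w2 x)
    + 2 * (w1 x - w2 x) * ((u1 x - u2 x) - (nl p (u1 x) - nl p (u2 x)))"
  have dz: "(?z has_real_derivative ?z' t) (at t within {0..R})" if "t \<in> {0..R}" for t
  proof -
    have u: "((\<lambda>x. u1 x - u2 x) has_real_derivative w1 t - w2 t) (at t within {0..R})"
      using s1 s2 that unfolding edge_sol_def by (intro DERIV_diff) auto
    have w: "((\<lambda>x. w1 x - w2 x) has_real_derivative (u1 t - nl p (u1 t)) - (u2 t - nl p (u2 t)))
        (at t within {0..R})"
      using s1 s2 that unfolding edge_sol_def by (intro DERIV_diff) auto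
    from DERIV_add[OF DERIV_mult[OF u u] DERIV_mult[OF w w]] show ?thesis
      unfolding power2_eq_square by (rule DERIV_cong) (simp add: algebra_simps)
  qed
  have z': "?z' t \<le> C * ?z t" if t: "t \<in> {0..R}" for t
  proof -
    define d e f where "d = u1 t - u2 t" and "e = w1 t - w2 t" and "f = nl p (u1 t) - nl p (u2 t)"
    have f: "\<bar>f\<bar> \<le> K * \<bar>d\<bar>" unfolding f_def d_def K_def
      by (rule nl_Lipschitz[OF p M1[OF t] M2[OF t]])
    have "2 * d * e + 2 * e * (d - f) \<le> \<bar>2 * d * e + 2 * e * (d - f)\<bar>" by simp
    also have "\<dots> \<le> 4 * (\<bar>e\<bar> * \<bar>d\<bar>) + 2 * (\<bar>e\<bar> * \<bar>f\<bar>)"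
    proof -
      have "2 * d * e + 2 * e * (d - f) = 4 * (e * d) - 2 * (e * f)" by (simp add: algebra_simps)
      then show ?thesis using abs_triangle_ineq4[of "4 * (e * d)" "2 * (e * f)"]
        by (simp only: abs_mult abs_numeral)
    qed
    also have "\<dots> \<le> 4 * (\<bar>e\<bar> * \<bar>d\<bar>) + 2 * (\<bar>e\<bar> * (K * \<bar>d\<bar>))"
      using f by (intro add_left_mono mult_left_mono) auto
    also have "\<dots> = C * (2 * \<bar>d\<bar> * \<bar>e\<bar>)" by (simp add: C_def algebra_simps)
    also have "\<dots> \<le> C * (d\<^sup>2 + e\<^sup>2)"
      using sum_squares_bound[of "\<bar>d\<bar>" "\<bar>e\<bar>"] K by (intro mult_left_mono) (auto simp: C_def)
    finally show ?thesis by (simp add: d_def e_def f_def)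
  qed
  have dy: "(?y has_real_derivative exp (- C * t) * (?z' t - C * ?z t)) (at t within {0..R})"
    if "t \<in> {0..R}" for t
  proof -
    have "((\<lambda>t. exp (- C * t)) has_real_derivative - C * exp (- C * t)) (at t within {0..R})"
      by (auto intro!: derivative_eq_intros)
    from DERIV_mult[OF this dz[OF that]] show ?thesis
      by (rule DERIV_cong) algebra
  qed
  have "?y x \<le> ?y 0"
  proof (rule DERIV_nonpos_imp_decreasing_open[where f="?y"])
    show "0 \<le> x" using x by simp
    show "\<exists>y. DERIV ?y t :> y \<and> y \<le> 0" if "0 < t" "t < x" for t
    proof -
      have "t \<in> {0..R}" using that x by auto
      have "(?y has_real_derivative exp (- C * t) * (?z' t - C * ?z t)) (at t)"
        using dy[OF \<open>t \<in> {0..R}\<close>] at_within_Icc_at[of 0 t R] that x by simp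
      moreover have "exp (- C * t) * (?z' t - C * ?z t) \<le> 0"
        using z'[OF \<open>t \<in> {0..R}\<close>] by (intro mult_nonneg_nonpos) auto
      ultimately show ?thesis by blast
    qed
    show "continuous_on {0..x} ?y"
      using edge_sol_continuous[OF edge_sol_subset[OF s1]] edge_sol_continuous[OF edge_sol_subset[OF s2]] x
      by (intro continuous_intros) auto
  qed
  then have "exp (- C * x) * ?z x \<le> ?z 0" by simp
  then have "exp (C * x) * (exp (- C * x) * ?z x) \<le> exp (C * x) * ?z 0"
    by (intro mult_left_mono) auto
  then have "?z x \<le> exp (C * x) * ?z 0"
    by (simp add: mult.assoc[symmetric] exp_add[symmetric])
  then show ?thesis unfolding C_def K_def .
qed

lemma set_integrable_atLeast_const:
  assumes "set_integrable lborel {0::real..} (\<lambda>_. c::real)"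
  shows "c = 0"
proof (rule ccontr)
  assume "c \<noteq> 0"
  have "integrable lborel (\<lambda>x. indicator {0::real..} x * c)"
    using assms unfolding set_integrable_def by simp
  then have "integrable lborel (indicator {0::real..} :: real \<Rightarrow> real)"
    using \<open>c \<noteq> 0\<close> by simp
  then have "emeasure lborel {0::real..} < \<infinity>"
    by (simp add: integrable_indicator_iff)
  then obtain n where "emeasure lborel {0::real..} < of_nat n"
    using ennreal_Ex_less_of_nat by (auto simp: less_top)
  moreover have "of_nat n \<le> emeasure lborel {0::real..}"
    using emeasure_mono[of "{0..real n}" "{0::real..}" lborel]
    by (simp add: ennreal_of_nat_eq_real_of_nat)
  ultimately show False by simp
qed

text \<open>The energy is constant; being dominated by an integrable function, it is zero.\<close>
lemma half_line_energy:
  assumes p: "2 < p" and s: "edge_sol p {0..} u w"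
    and u2: "set_integrable lborel {0..} (\<lambda>x. (u x)\<^sup>2)"
    and w2: "set_integrable lborel {0..} (\<lambda>x. (w x)\<^sup>2)"
    and x: "0 \<le> x"
  shows "(w x)\<^sup>2 = (u x)\<^sup>2 - 2 / p * \<bar>u x\<bar> powr p"
proof -
  let ?E = "\<lambda>x. (w x)\<^sup>2 - (u x)\<^sup>2 + 2 / p * \<bar>u x\<bar> powr p"
  have "(?E has_real_derivative 0) (at t within {0..})" if "t \<in> {0..}" for t
  proof -
    have u: "(u has_real_derivative w t) (at t within {0..})"
      and w: "(w has_real_derivative u t - nl p (u t)) (at t within {0..})"
      using s that unfolding edge_sol_def by auto
    have "((\<lambda>x. \<bar>u x\<bar> powr p) has_real_derivative p * nl p (u t) * w t) (at t within {0..})"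
      by (rule DERIV_chain2[OF has_real_derivative_abs_powr[OF p] u])
    from DERIV_add[OF DERIV_diff[OF DERIV_mult[OF w w] DERIV_mult[OF u u]] DERIV_cmult[OF this, of "2 / p"]]
    show ?thesis unfolding power2_eq_square
      by (rule DERIV_cong) (use p in \<open>simp add: algebra_simps\<close>)
  qed
  then obtain c where c: "\<And>x. x \<in> {0..} \<Longrightarrow> ?E x = c"
    using has_field_derivative_zero_constant[of "{0::real..}" ?E] by (auto simp: convex_real_interval)
  \<comment> \<open>Where |u| >= 1, already |c| <= |c| u^2. Elsewhere (2/p)|u|^p <= u^2, and the
    energy then lies between -u^2 and w^2. So no decay of u or w at infinity has to be established
    first.\<close>
  have c_le: "\<bar>c\<bar> \<le> (w t)\<^sup>2 + (1 + \<bar>c\<bar>) * (u t)\<^sup>2" if t: "0 \<le> t" for t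
  proof -
    have E: "(w t)\<^sup>2 - (u t)\<^sup>2 + 2 / p * \<bar>u t\<bar> powr p = c" using c[of t] t by simp
    have nn: "0 \<le> 2 / p * \<bar>u t\<bar> powr p" using p by simp
    have nn2: "0 \<le> \<bar>c\<bar> * (u t)\<^sup>2" by simp
    show ?thesis
    proof (cases "1 \<le> \<bar>u t\<bar>")
      case True
      then have "1 \<le> (u t)\<^sup>2" using one_le_power[of "\<bar>u t\<bar>" 2] by simp
      then have "\<bar>c\<bar> * 1 \<le> \<bar>c\<bar> * (u t)\<^sup>2" by (intro mult_left_mono) auto
      moreover have "0 \<le> (w t)\<^sup>2 + (u t)\<^sup>2" by simp
      ultimately show ?thesis unfolding distrib_right by linarith
    next
      case False
      then have "\<bar>u t\<bar> powr p \<le> 1 powr (p - 2) * (u t)\<^sup>2" using p by (intro abs_powr_le) auto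
      moreover have "2 / p * \<bar>u t\<bar> powr p \<le> 1 * \<bar>u t\<bar> powr p"
        using p by (intro mult_right_mono) auto
      ultimately have "2 / p * \<bar>u t\<bar> powr p \<le> (u t)\<^sup>2" by simp
      moreover have "0 \<le> (w t)\<^sup>2" "0 \<le> (u t)\<^sup>2" by simp_all
      ultimately show ?thesis using E nn nn2 unfolding distrib_right by linarith
    qed
  qed
  have dom: "set_integrable lborel {0..} (\<lambda>t. (w t)\<^sup>2 + (1 + \<bar>c\<bar>) * (u t)\<^sup>2)"
    using u2 w2 by (intro set_integral_add(1) set_integrable_mult_right) auto
  have "norm c \<le> norm ((w t)\<^sup>2 + (1 + \<bar>c\<bar>) * (u t)\<^sup>2)" if "t \<in> {0..}" for t
    using c_le[of t] that by simp
  then have "set_integrable lborel {0::real..} (\<lambda>_. c)"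
    by (intro set_integrable_bound[OF dom]) (auto simp: set_borel_measurable_def)
  then have "c = 0" by (rule set_integrable_atLeast_const)
  then show ?thesis using c[of x] x by simp
qed

text \<open>The bound is the positive zero of s^2 - (2/p)|s|^p, that is, the peak height of the
  soliton on the line.\<close>

lemma abs_le_of_energy:
  fixes p :: real
  assumes p: "2 < p" and s: "2 / p * \<bar>s\<bar> powr p \<le> s\<^sup>2"
  shows "\<bar>s\<bar> \<le> (p / 2) powr (1 / (p - 2))"
proof (cases "s = 0")
  case False
  have "2 / p * (\<bar>s\<bar> powr (p - 2) * s\<^sup>2) \<le> s\<^sup>2"
    using s nl_mult_self[of p s] by (simp add: nl_def power2_eq_square mult.assoc)
  then have "2 / p * \<bar>s\<bar> powr (p - 2) * s\<^sup>2 \<le> 1 * s\<^sup>2" by (simp add: mult.assoc)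
  then have "2 / p * \<bar>s\<bar> powr (p - 2) \<le> 1"
    by (rule mult_right_le_imp_le) (use False in simp)
  then have "\<bar>s\<bar> powr (p - 2) \<le> p / 2" using p by (simp add: field_simps)
  then have "(\<bar>s\<bar> powr (p - 2)) powr (1 / (p - 2)) \<le> (p / 2) powr (1 / (p - 2))"
    using p by (intro powr_mono2) auto
  then show ?thesis using p False by (simp add: powr_powr)
qed simp

section \<open>Sobolev functions on an edge\<close>

definition edge_dom :: "real set \<Rightarrow> bool" where
  "edge_dom I \<longleftrightarrow> I = {0..} \<or> (\<exists>l>0. I = {0..l})"

lemma edge_dom_borel [measurable]: "edge_dom I \<Longrightarrow> I \<in> sets borel"
  by (auto simp: edge_dom_def)

lemma edge_dom_nonneg: "edge_dom I \<Longrightarrow> x \<in> I \<Longrightarrow> 0 \<le> x"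
  by (auto simp: edge_dom_def)

lemma edge_dom_subset: "edge_dom I \<Longrightarrow> x \<in> I \<Longrightarrow> {0..x} \<subseteq> I"
  by (auto simp: edge_dom_def)

lemma edge_dom_0: "edge_dom I \<Longrightarrow> 0 \<in> I"
  by (auto simp: edge_dom_def)

text \<open>Arguments by the fundamental theorem of calculus live on compact intervals. On a
  half-line the end R = x + 1 lies strictly beyond x, so the two neighbourhood filters coincide; on
  a bounded edge R is its full length.\<close>

lemma edge_dom_obtain:
  assumes "edge_dom I" "x \<in> I"
  obtains R where "R \<in> I" "0 < R" "x \<le> R" "at x within {0..R} = at x within I"
proof -
  from assms(1) consider "I = {0..}" | l where "l > 0" "I = {0..l}" by (auto simp: edge_dom_def)
  then show ?thesis
  proof cases
    case 1
    have "at x within {0..x+1} = at x within I"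
      by (rule at_within_nhd[of _ "{..<x+1}"]) (auto simp: 1)
    then show ?thesis using that[of "x+1"] assms 1 by auto
  next
    case 2
    then show ?thesis using that[of l] assms by auto
  qed
qed

lemma has_derivative_edge_dom:
  assumes "edge_dom I" "x \<in> I" "\<And>R. R \<in> I \<Longrightarrow> 0 < R \<Longrightarrow> x \<le> R \<Longrightarrow> (f has_real_derivative D) (at x within {0..R})"
  shows "(f has_real_derivative D) (at x within I)"
  by (metis edge_dom_obtain assms)

lemma continuous_on_edge_dom:
  assumes "edge_dom I" "\<And>R. R \<in> I \<Longrightarrow> 0 < R \<Longrightarrow> continuous_on {0..R} f"
  shows "continuous_on I f"
  unfolding continuous_on_eq_continuous_within
proof
  fix x assume "x \<in> I"
  with assms(1) obtain R where R: "R \<in> I" "0 < R" "x \<le> R" "at x within {0..R} = at x within I"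
    by (rule edge_dom_obtain)
  have "continuous_on {0..R} f" "x \<in> {0..R}"
    using assms(2) R \<open>x \<in> I\<close> edge_dom_nonneg[OF assms(1)] by auto
  then have "continuous (at x within {0..R}) f" unfolding continuous_on_eq_continuous_within by blast
  then show "continuous (at x within I) f" unfolding R(4) .
qed

text \<open>Integrability of the square does not control the sign of \<open>f\<close>, so
  measurability of \<open>f\<close> itself is demanded separately. For functions in
  \<open>H1_edge\<close> it comes from continuity of the function and from local integrability of
  the derivative.\<close>

definition L2_on :: "real set \<Rightarrow> (real \<Rightarrow> real) \<Rightarrow> bool" where
  "L2_on I f \<longleftrightarrow> set_borel_measurable lborel I f \<and> set_integrable lborel I (\<lambda>x. (f x)\<^sup>2)"

lemma L2_on_iff:
  "L2_on I f \<longleftrightarrow> (\<lambda>x. indicator I x * f x) \<in> borel_measurable lborel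
     \<and> integrable lborel (\<lambda>x. (indicator I x * f x)\<^sup>2)"
proof -
  have "(\<lambda>x. indicator I x *\<^sub>R (f x)\<^sup>2) = (\<lambda>x. (indicator I x * f x)\<^sup>2)"
    by (auto simp: indicator_def)
  then show ?thesis unfolding L2_on_def set_borel_measurable_def set_integrable_def by simp
qed

lemma set_integrable_mult_L2:
  assumes "L2_on I f" "L2_on I g"
  shows "set_integrable lborel I (\<lambda>x. f x * g x)"
proof -
  have "integrable lborel (\<lambda>x. (indicator I x * f x) * (indicator I x * g x))"
    using assms unfolding L2_on_iff by (intro integrable_mult_of_squares) auto
  also have "(\<lambda>x. (indicator I x * f x) * (indicator I x * g x)) = (\<lambda>x. indicator I x *\<^sub>R (f x * g x))"
    by (auto simp: indicator_def)
  finally show ?thesis unfolding set_integrable_def .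
qed

lemma L2_on_cmult: "L2_on I f \<Longrightarrow> L2_on I (\<lambda>x. c * f x)"
  unfolding L2_on_def set_borel_measurable_def
  by (auto simp: power_mult_distrib mult.left_commute)

lemma L2_on_bound:
  assumes "L2_on I f" "set_borel_measurable lborel I g" "\<And>x. x \<in> I \<Longrightarrow> \<bar>g x\<bar> \<le> K * \<bar>f x\<bar>"
  shows "L2_on I g"
proof -
  have "(\<lambda>x. (indicator I x *\<^sub>R g x)\<^sup>2) \<in> borel_measurable lborel"
    using assms(2) unfolding set_borel_measurable_def by measurable
  also have "(\<lambda>x. (indicator I x *\<^sub>R g x)\<^sup>2) = (\<lambda>x. indicator I x *\<^sub>R (g x)\<^sup>2)"
    by (auto simp: indicator_def)
  finally have m: "set_borel_measurable lborel I (\<lambda>x. (g x)\<^sup>2)" unfolding set_borel_measurable_def .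
  have "(g x)\<^sup>2 \<le> (K * f x)\<^sup>2" if "x \<in> I" for x
  proof -
    have "\<bar>g x\<bar> \<le> \<bar>K * f x\<bar>"
      using assms(3)[OF that] mult_right_mono[OF abs_ge_self[of K] abs_ge_zero[of "f x"]]
      unfolding abs_mult by linarith
    then show ?thesis by (simp add: abs_le_square_iff)
  qed
  moreover have "set_integrable lborel I (\<lambda>x. (K * f x)\<^sup>2)"
    using L2_on_cmult[OF assms(1)] by (simp add: L2_on_def)
  ultimately have "set_integrable lborel I (\<lambda>x. (g x)\<^sup>2)"
    by (intro set_integrable_bound[OF _ m]) auto
  with assms(2) show ?thesis by (simp add: L2_on_def)
qed

lemma L2_on_continuous:
  assumes "continuous_on {a..b} f" shows "L2_on {a..b} f"
  unfolding L2_on_def set_borel_measurable_def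
  using borel_measurable_continuous_on_indicator[OF _ assms]
    borel_integrable_atLeastAtMost'[of a b "\<lambda>x. (f x)\<^sup>2"] assms
  by (auto intro!: continuous_intros)

section \<open>Continuity and square integrability of Sobolev functions; examples\<close>

lemma H1_edge_continuous_on_Icc:
  assumes "H1_edge I f g" "edge_dom I" "R \<in> I"
  shows "continuous_on {0..R} f"
proof -
  have g: "set_integrable lborel {0..R} g" and fR: "\<And>x. x \<in> I \<Longrightarrow> f x = f 0 + (LINT t:{0..x}|lborel. g t)"
    using assms unfolding H1_edge_def by auto
  have "continuous_on {0..R} (\<lambda>x. f 0 + integral {0..x} g)"
    by (intro continuous_intros indefinite_integral_continuous_1 set_borel_integral_eq_integral(1)[OF g])
  then show ?thesis
  proof (rule continuous_on_eq)
    show "f 0 + integral {0..x} g = f x" if "x \<in> {0..R}" for x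
    proof -
      have "x \<in> I" using edge_dom_subset[OF assms(2,3)] that by auto
      moreover have "set_integrable lborel {0..x} g"
        using that by (intro set_integrable_subset[OF g]) auto
      ultimately show ?thesis using fR set_borel_integral_eq_integral(2) by metis
    qed
  qed
qed

lemma H1_edge_continuous_on: "H1_edge I f g \<Longrightarrow> edge_dom I \<Longrightarrow> continuous_on I f"
  by (rule continuous_on_edge_dom) (auto intro: H1_edge_continuous_on_Icc)

lemma set_borel_measurable_edge_dom:
  fixes g :: "real \<Rightarrow> real"
  assumes "edge_dom I" "\<And>R. R \<in> I \<Longrightarrow> set_borel_measurable lborel {0..R} g"
  shows "set_borel_measurable lborel I g"
proof -
  from assms(1) consider "I = {0..}" | l where "l > 0" "I = {0..l}" by (auto simp: edge_dom_def)
  then show ?thesis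
  proof cases
    case 1
    have "(\<lambda>x. indicator I x *\<^sub>R g x) \<in> borel_measurable lborel"
    proof (rule borel_measurable_LIMSEQ_real)
      show "(\<lambda>x. indicator {0..real n} x *\<^sub>R g x) \<in> borel_measurable lborel" for n
        using assms(2)[of "real n"] 1 unfolding set_borel_measurable_def by simp
      show "(\<lambda>n. indicator {0..real n} x *\<^sub>R g x) \<longlonglongrightarrow> indicator I x *\<^sub>R g x" for x
      proof (rule tendsto_eventually)
        obtain N where N: "x \<le> real N" using real_arch_simple by blast
        show "\<forall>\<^sub>F n in sequentially. indicator {0..real n} x *\<^sub>R g x = indicator I x *\<^sub>R g x"
          using eventually_ge_at_top[of N]
        proof eventually_elim
          case (elim n)
          then have "x \<le> real n" using N by linarith
          then show ?case by (simp add: 1 indicator_def)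
        qed
      qed
    qed
    then show ?thesis unfolding set_borel_measurable_def .
  next
    case 2
    then show ?thesis using assms(2)[of l] by simp
  qed
qed

lemma H1_edge_L2:
  assumes "H1_edge I f g" "edge_dom I"
  shows "L2_on I f" "L2_on I g"
proof -
  have "set_borel_measurable lborel I f"
    unfolding set_borel_measurable_def
    using borel_measurable_continuous_on_indicator[OF _ H1_edge_continuous_on[OF assms]] assms(2)
    by (simp add: edge_dom_borel)
  then show "L2_on I f" using assms(1) by (simp add: L2_on_def H1_edge_def)
  have "set_borel_measurable lborel I g"
  proof (rule set_borel_measurable_edge_dom[OF assms(2)])
    fix R assume "R \<in> I"
    then have "set_integrable lborel {0..R} g" using assms(1) by (simp add: H1_edge_def)
    then show "set_borel_measurable lborel {0..R} g"
      unfolding set_integrable_def set_borel_measurable_def by auto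
  qed
  then show "L2_on I g" using assms(1) by (simp add: L2_on_def H1_edge_def)
qed

lemma H1_edge_C1:
  assumes "0 < l" "\<And>x. x \<in> {0..l} \<Longrightarrow> (f has_real_derivative g x) (at x within {0..l})"
    "continuous_on {0..l} g"
  shows "H1_edge {0..l} f g"
proof -
  have f: "continuous_on {0..l} f" using assms(2) by (rule DERIV_continuous_on)
  have "set_integrable lborel {0..x} g \<and> f x = f 0 + (LINT t:{0..x}|lborel. g t)" if x: "x \<in> {0..l}" for x
  proof -
    have g: "continuous_on {0..x} g" using assms(3) by (rule continuous_on_subset) (use x in auto)
    have "(LINT t:{0..x}|lborel. g t) = f x - f 0"
      by (rule set_integral_FTC[OF _ _ g]) (use x in \<open>auto intro!: DERIV_subset[OF assms(2)]\<close>)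
    with borel_integrable_atLeastAtMost'[OF g] show ?thesis by simp
  qed
  with L2_on_continuous[OF f] L2_on_continuous[OF assms(3)] show ?thesis
    unfolding H1_edge_def L2_on_def by blast
qed

lemma H1_edge_zero: "H1_edge I (\<lambda>_. 0) (\<lambda>_. 0)"
  by (simp add: H1_edge_def set_integrable_def)

text \<open>All test functions with compact support in a half-line will be of the following piecewise
  linear form.\<close>
lemma H1_edge_min:
  assumes I: "edge_dom I" and y: "0 \<le> y" "0 \<le> R"
    and vanish: "\<And>x. x \<in> I \<Longrightarrow> R < x \<Longrightarrow> c + a * min x y + b * min x R = 0"
  shows "H1_edge I (\<lambda>x. c + a * min x y + b * min x R)
    (\<lambda>x. a * indicator {0..y} x + b * indicator {0..R} x)" (is "H1_edge I ?f ?g")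
proof -
  have ind: "(\<lambda>t. indicator {0..x} t *\<^sub>R indicator {0..y} t) = (indicator {0..min x y} :: real \<Rightarrow> real)" for x y :: real
    by (auto simp: indicator_def)
  have int: "set_integrable lborel {0..x} (indicator {0..y} :: real \<Rightarrow> real)" for x y :: real
    unfolding set_integrable_def ind by (rule integrable_real_indicator) (simp_all add: emeasure_lborel_Icc_eq)
  have val: "(LINT t:{0..x}|lborel. indicator {0..y} t) = min x y" if "0 \<le> x" "0 \<le> y" for x y :: real
    unfolding set_lebesgue_integral_def ind using that by simp
  have gi: "set_integrable lborel {0..x} ?g" for x
    by (intro set_integral_add(1) set_integrable_mult_right int)
  have "?f x = ?f 0 + (LINT t:{0..x}|lborel. ?g t)" if "x \<in> I" for x
  proof -
    have "(LINT t:{0..x}|lborel. ?g t)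
      = (LINT t:{0..x}|lborel. a * indicator {0..y} t) + (LINT t:{0..x}|lborel. b * indicator {0..R} t)"
      by (intro set_integral_add(2) set_integrable_mult_right int)
    also have "\<dots> = a * min x y + b * min x R"
      using edge_dom_nonneg[OF I that] y by (simp add: val)
    finally show ?thesis using y by (simp add: min_def)
  qed
  moreover have "set_integrable lborel I (\<lambda>x. (?f x)\<^sup>2)"
  proof -
    have "set_integrable lborel {0..R} (\<lambda>x. (?f x)\<^sup>2)"
      by (intro borel_integrable_atLeastAtMost' continuous_intros)
    then have "integrable lborel (\<lambda>x. indicator I x *\<^sub>R (indicator {0..R} x *\<^sub>R (?f x)\<^sup>2))"
      unfolding set_integrable_def
      by (rule integrable_mult_indicator[rotated]) (simp add: I edge_dom_borel)
    also have "(\<lambda>x. indicator I x *\<^sub>R (indicator {0..R} x *\<^sub>R (?f x)\<^sup>2)) = (\<lambda>x. indicator I x *\<^sub>R (?f x)\<^sup>2)"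
      using vanish edge_dom_nonneg[OF I] by (fastforce simp: indicator_def)
    finally show ?thesis unfolding set_integrable_def .
  qed
  moreover have "set_integrable lborel I (\<lambda>x. (?g x)\<^sup>2)"
  proof -
    have "(\<lambda>x. indicator I x *\<^sub>R (?g x)\<^sup>2)
      = (\<lambda>x. a\<^sup>2 * indicator (I \<inter> {0..y}) x + b\<^sup>2 * indicator (I \<inter> {0..R}) x
          + (2 * a * b) * indicator (I \<inter> {0..min y R}) x)"
      by (auto simp: indicator_def power2_sum)
    moreover have "integrable lborel (indicator (I \<inter> {0..z}) :: real \<Rightarrow> real)" for z
    proof -
      have "emeasure lborel (I \<inter> {0..z}) \<le> emeasure lborel {0..z}"
        by (rule emeasure_mono) auto
      also have "\<dots> < \<infinity>" by (simp add: emeasure_lborel_Icc_eq)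
      finally show ?thesis by (intro integrable_real_indicator) (simp_all add: I edge_dom_borel)
    qed
    ultimately show ?thesis unfolding set_integrable_def
      by (auto intro!: Bochner_Integration.integrable_add integrable_mult_right)
  qed
  ultimately show ?thesis using gi unfolding H1_edge_def by blast
qed

text \<open>The function min x y is the Green kernel of -d^2/dx^2 on [0, R] with value 0 at 0 and
  slope 0 at R, so the pairing integrates F twice. Explicitly, with W and Q the first and second
  antiderivatives of F, x W - Q is an antiderivative of x F on [0, y], and beyond y the weight is
  constant.\<close>

lemma set_integral_mult_min:
  fixes F :: "real \<Rightarrow> real"
  assumes F: "continuous_on {0..R} F" and y: "0 \<le> y" "y \<le> R"
  shows "(LINT x:{0..R}|lborel. F x * min x y)
    = y * integral {0..R} F - integral {0..y} (\<lambda>x. integral {0..x} F)"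
proof -
  define W where "W x = integral {0..x} F" for x
  define Q where "Q x = integral {0..x} W" for x
  have dW: "(W has_real_derivative F t) (at t within {0..R})" if "t \<in> {0..R}" for t
    unfolding W_def by (rule integral_has_real_derivative[OF F that])
  then have cW: "continuous_on {0..R} W" by (rule DERIV_continuous_on)
  have dQ: "(Q has_real_derivative W t) (at t within {0..R})" if "t \<in> {0..R}" for t
    unfolding Q_def by (rule integral_has_real_derivative[OF cW that])
  have 1: "(LINT x:{0..y}|lborel. F x * x) = (y * W y - Q y) - (0 * W 0 - Q 0)"
  proof (rule set_integral_FTC[OF y(1)])
    fix t assume t: "t \<in> {0..y}"
    have "(W has_real_derivative F t) (at t within {0..y})" "(Q has_real_derivative W t) (at t within {0..y})"
      using t y by (auto intro: DERIV_subset[OF dW] DERIV_subset[OF dQ])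
    from DERIV_diff[OF DERIV_mult[OF DERIV_ident this(1)] this(2)]
    show "((\<lambda>t. t * W t - Q t) has_real_derivative F t * t) (at t within {0..y})"
      by (rule DERIV_cong) simp
  next
    show "continuous_on {0..y} (\<lambda>x. F x * x)"
      by (intro continuous_intros continuous_on_subset[OF F]) (use y in auto)
  qed
  have 2: "(LINT x:{y..R}|lborel. F x * y) = W R * y - W y * y"
  proof (rule set_integral_FTC[OF y(2)])
    fix t assume t: "t \<in> {y..R}"
    have "(W has_real_derivative F t) (at t within {y..R})"
      using t y by (auto intro: DERIV_subset[OF dW])
    from DERIV_mult[OF this DERIV_const[of y]]
    show "((\<lambda>t. W t * y) has_real_derivative F t * y) (at t within {y..R})"
      by (rule DERIV_cong) simp
  next
    show "continuous_on {y..R} (\<lambda>x. F x * y)"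
      by (intro continuous_intros continuous_on_subset[OF F]) (use y in auto)
  qed
  have c: "continuous_on {0..R} (\<lambda>x. F x * min x y)" by (intro continuous_intros F)
  have "(LINT x:{0..R}|lborel. F x * min x y) = integral {0..R} (\<lambda>x. F x * min x y)"
    by (rule set_borel_integral_eq_integral(2)[OF borel_integrable_atLeastAtMost'[OF c]])
  also have "\<dots> = integral {0..y} (\<lambda>x. F x * min x y) + integral {y..R} (\<lambda>x. F x * min x y)"
    by (rule Henstock_Kurzweil_Integration.integral_combine[symmetric, OF y integrable_continuous_real[OF c]])
  also have "integral {0..y} (\<lambda>x. F x * min x y) = (LINT x:{0..y}|lborel. F x * min x y)"
    by (rule set_borel_integral_eq_integral(2)[symmetric, OF borel_integrable_atLeastAtMost'[OF continuous_on_subset[OF c]]])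
      (use y in auto)
  also have "\<dots> = (LINT x:{0..y}|lborel. F x * x)"
    by (intro set_lebesgue_integral_cong) auto
  also have "integral {y..R} (\<lambda>x. F x * min x y) = (LINT x:{y..R}|lborel. F x * min x y)"
    by (rule set_borel_integral_eq_integral(2)[symmetric, OF borel_integrable_atLeastAtMost'[OF continuous_on_subset[OF c]]])
      (use y in auto)
  also have "\<dots> = (LINT x:{y..R}|lborel. F x * y)"
    by (intro set_lebesgue_integral_cong) auto
  finally have "(LINT x:{0..R}|lborel. F x * min x y) = (y * W y - Q y) - (0 * W 0 - Q 0) + (W R * y - W y * y)"
    unfolding 1 2 .
  moreover have "Q 0 = 0" by (simp add: Q_def)
  ultimately have "(LINT x:{0..R}|lborel. F x * min x y) = y * W R - Q y" by (simp add: algebra_simps)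
  then show ?thesis unfolding Q_def W_def .
qed

section \<open>Regularity\<close>

text \<open>The test function is the tent on $[0,R]$ with peak at $y$; it shows that u - Q interpolates
  linearly between its values at 0 and R.\<close>
lemma weak_edge_tent:
  assumes p: "2 < p" and I: "edge_dom I" and u: "H1_edge I u u'"
    and weak: "\<And>\<eta> \<eta>'. H1_edge I \<eta> \<eta>' \<Longrightarrow> \<eta> 0 = 0 \<Longrightarrow> (\<And>l. I = {0..l} \<Longrightarrow> \<eta> l = 0) \<Longrightarrow>
      (LINT x:I|lborel. u' x * \<eta>' x + u x * \<eta> x - nl p (u x) * \<eta> x) = 0"
    and y: "0 < y" "y < R" and R: "R \<in> I"
  defines "Q \<equiv> \<lambda>x. integral {0..x} (\<lambda>x. integral {0..x} (\<lambda>x. u x - nl p (u x)))"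
  shows "R * (u y - Q y) = y * (u R - Q R) + (R - y) * u 0"
proof -
  define F where "F x = u x - nl p (u x)" for x
  \<comment> \<open>The tent has height 1: it rises with slope a on [0, y] and falls with slope -b
    on [y, R]. In terms of truncated identities this is (a + b) min x y - b min x R.\<close>
  define a where "a = 1 / y"
  define b where "b = 1 / (R - y)"
  let ?\<eta> = "\<lambda>x. 0 + (a + b) * min x y + (- b) * min x R"
  let ?\<eta>' = "\<lambda>x. (a + b) * indicator {0..y} x + (- b) * indicator {0..R} x :: real"
  have ab: "(a + b) * y = b * R" unfolding a_def b_def using y by (simp add: field_simps)
  have sub: "{0..R} \<subseteq> I" using edge_dom_subset[OF I R] .
  have uc: "continuous_on {0..R} u" by (rule H1_edge_continuous_on_Icc[OF u I R])
  have Fc: "continuous_on {0..R} F" unfolding F_def by (intro continuous_intros continuous_on_nl p uc)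
  have u': "set_integrable lborel {0..z} u'" "u z = u 0 + (LINT t:{0..z}|lborel. u' t)" if "z \<in> I" for z
    using u that unfolding H1_edge_def by blast+
  have yI: "y \<in> I" using sub y by auto
  have H1: "H1_edge I ?\<eta> ?\<eta>'"
    by (rule H1_edge_min[OF I]) (use y ab in auto)
  have "(LINT x:I|lborel. u' x * ?\<eta>' x + u x * ?\<eta> x - nl p (u x) * ?\<eta> x) = 0"
  proof (rule weak[OF H1])
    show "?\<eta> 0 = 0" using y by simp
    fix l assume l: "I = {0..l}"
    then have "R \<le> l" using R by auto
    then show "?\<eta> l = 0" using y ab by simp
  qed
  also have "(LINT x:I|lborel. u' x * ?\<eta>' x + u x * ?\<eta> x - nl p (u x) * ?\<eta> x)
    = (LINT x:{0..R}|lborel. u' x * ?\<eta>' x + u x * ?\<eta> x - nl p (u x) * ?\<eta> x)"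
    unfolding set_lebesgue_integral_def
  proof (rule Bochner_Integration.integral_cong[OF refl])
    fix x
    show "indicator I x *\<^sub>R (u' x * ?\<eta>' x + u x * ?\<eta> x - nl p (u x) * ?\<eta> x)
      = indicator {0..R} x *\<^sub>R (u' x * ?\<eta>' x + u x * ?\<eta> x - nl p (u x) * ?\<eta> x)"
    proof (cases "x \<in> I \<and> R < x")
      case True
      then have "?\<eta>' x = 0" "?\<eta> x = 0" using y ab by (auto simp: indicator_def)
      then show ?thesis by simp
    next
      case False
      then have "x \<in> I \<longleftrightarrow> x \<in> {0..R}" using sub edge_dom_nonneg[OF I] by auto
      then show ?thesis by (simp add: indicator_def)
    qed
  qed
  also have "\<dots> = (LINT x:{0..R}|lborel. ((a + b) * (indicator {0..y} x * u' x) - b * u' x)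
      + ((a + b) * (F x * min x y) - b * (F x * min x R)))"
    by (intro set_lebesgue_integral_cong) (auto simp: F_def algebra_simps)
  also have "\<dots> = ((a + b) * (LINT x:{0..R}|lborel. indicator {0..y} x * u' x) - b * (LINT x:{0..R}|lborel. u' x))
      + ((a + b) * (LINT x:{0..R}|lborel. F x * min x y) - b * (LINT x:{0..R}|lborel. F x * min x R))"
  proof -
    have i1: "set_integrable lborel {0..R} (\<lambda>x. indicator {0..y} x * u' x)"
    proof -
      have "(\<lambda>x. indicator {0..y} x *\<^sub>R u' x) = (\<lambda>x. indicator {0..R} x *\<^sub>R (indicator {0..y} x * u' x))"
        using y by (auto simp: indicator_def)
      then show ?thesis using u'(1)[OF yI] unfolding set_integrable_def by simp
    qed
    have i2: "set_integrable lborel {0..R} (\<lambda>x. F x * min x z)" for z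
      by (intro borel_integrable_atLeastAtMost' continuous_intros Fc)
    show ?thesis
      using i1 i2[of y] i2[of R] u'(1)[OF R] by (simp add: set_integral_add set_integral_diff)
  qed
  also have "(LINT x:{0..R}|lborel. indicator {0..y} x * u' x) = u y - u 0"
  proof -
    have "(LINT x:{0..R}|lborel. indicator {0..y} x * u' x) = (LINT x:{0..y}|lborel. u' x)"
      unfolding set_lebesgue_integral_def
      by (rule Bochner_Integration.integral_cong) (use y in \<open>auto simp: indicator_def\<close>)
    then show ?thesis using u'(2)[OF yI] by simp
  qed
  also have "(LINT x:{0..R}|lborel. u' x) = u R - u 0" using u'(2)[OF R] by simp
  also have "(LINT x:{0..R}|lborel. F x * min x y) = y * integral {0..R} F - Q y"
    unfolding Q_def F_def[symmetric] using y by (intro set_integral_mult_min Fc) auto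
  also have "(LINT x:{0..R}|lborel. F x * min x R) = R * integral {0..R} F - Q R"
    unfolding Q_def F_def[symmetric] using y by (intro set_integral_mult_min Fc) auto
  finally have "(a + b) * (u y - u 0) - b * (u R - u 0)
      + ((a + b) * (y * integral {0..R} F - Q y) - b * (R * integral {0..R} F - Q R)) = 0" .
  \<comment> \<open>The integral of F over [0, R] drops out because (a + b) y = b R, which is the
    condition that the tent vanishes at R.\<close>
  then have "(a + b) * (u y - Q y) - (a + b) * u 0 - b * (u R - Q R) + b * u 0
      + ((a + b) * y - b * R) * integral {0..R} F = 0"
    by (simp add: algebra_simps)
  then have eq: "(a + b) * (u y - Q y) = b * (u R - Q R) + a * u 0"
    unfolding ab by (simp add: algebra_simps)
  have m: "a * (y * (R - y)) = R - y" "b * (y * (R - y)) = y" using y by (simp_all add: a_def b_def)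
  from eq have "((a + b) * (u y - Q y)) * (y * (R - y)) = (b * (u R - Q R) + a * u 0) * (y * (R - y))"
    by simp
  then have "(a * (y * (R - y)) + b * (y * (R - y))) * (u y - Q y)
      = (b * (y * (R - y))) * (u R - Q R) + (a * (y * (R - y))) * u 0"
    by (simp add: algebra_simps)
  then show ?thesis unfolding m by simp
qed

text \<open>A du Bois-Reymond argument: with Q a second antiderivative of u - f(u), the difference u
  - Q is affine, so u inherits two classical derivatives from Q.\<close>

lemma weak_edge_regular:
  assumes p: "2 < p" and I: "edge_dom I" and u: "H1_edge I u u'"
    and weak: "\<And>\<eta> \<eta>'. H1_edge I \<eta> \<eta>' \<Longrightarrow> \<eta> 0 = 0 \<Longrightarrow> (\<And>l. I = {0..l} \<Longrightarrow> \<eta> l = 0) \<Longrightarrow>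
      (LINT x:I|lborel. u' x * \<eta>' x + u x * \<eta> x - nl p (u x) * \<eta> x) = 0"
  shows "\<exists>w. edge_sol p I u w"
proof -
  define F where "F x = u x - nl p (u x)" for x
  define W where "W x = integral {0..x} F" for x
  define Q where "Q x = integral {0..x} W" for x
  have Q0: "Q 0 = 0" by (simp add: Q_def)
  \<comment> \<open>Any positive point of the edge serves as reference; c is the slope of u - Q
    between 0 and r.\<close>
  obtain r where r: "0 < r" "r \<in> I" using I
    unfolding edge_dom_def by (metis atLeastAtMost_iff atLeast_iff less_eq_real_def zero_less_one)
  define c where "c = (u r - Q r - u 0) / r"
  have Q_eq: "Q = (\<lambda>x. integral {0..x} (\<lambda>x. integral {0..x} (\<lambda>x. u x - nl p (u x))))"
    unfolding Q_def[abs_def] W_def[abs_def] F_def[abs_def] ..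
  have tent: "R * (u y - Q y) = y * (u R - Q R) + (R - y) * u 0" if "0 < y" "y < R" "R \<in> I" for y R
    unfolding Q_eq by (rule weak_edge_tent[OF p I u _ that]) (rule weak)
  \<comment> \<open>To the left of r the tent on [0, r] with peak x is used, to the right of r the
    tent on [0, x] with peak r.\<close>
  have affine: "u x = u 0 + Q x + c * x" if x: "x \<in> I" for x
  proof -
    have "0 \<le> x" using edge_dom_nonneg[OF I x] .
    then consider "x = 0" | "x = r" | "0 < x" "x < r" | "r < x" by linarith
    then show ?thesis
    proof cases
      case 3
      have "r * (u x - Q x - u 0) = x * (u r - Q r - u 0)"
        using tent[OF 3 r(2)] by (simp add: algebra_simps)
      then show ?thesis unfolding c_def using r by (simp add: field_simps)
    next
      case 4
      have "x * (u r - Q r - u 0) = r * (u x - Q x - u 0)"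
        using tent[OF r(1) 4 x] by (simp add: algebra_simps)
      then show ?thesis unfolding c_def using r by (simp add: field_simps)
    qed (use r in \<open>auto simp: Q0 c_def\<close>)
  qed
  have Fc: "continuous_on {0..R} F" if "R \<in> I" for R
    unfolding F_def by (intro continuous_intros continuous_on_nl p H1_edge_continuous_on_Icc[OF u I that])
  have dW: "(W has_real_derivative F t) (at t within {0..R})" if "R \<in> I" "t \<in> {0..R}" for R t
    unfolding W_def by (rule integral_has_real_derivative[OF Fc that(2)]) (rule that)
  have cW: "continuous_on {0..R} W" if "R \<in> I" for R
    using dW[OF that] by (rule DERIV_continuous_on)
  have dQ: "(Q has_real_derivative W t) (at t within {0..R})" if "R \<in> I" "t \<in> {0..R}" for R t
    unfolding Q_def by (rule integral_has_real_derivative[OF cW that(2)]) (rule that)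
  have "edge_sol p I u (\<lambda>x. W x + c)"
    unfolding edge_sol_def
  proof (intro ballI conjI)
    fix x assume x: "x \<in> I"
    have x0: "0 \<le> x" using edge_dom_nonneg[OF I x] .
    have Wd: "(W has_real_derivative F x) (at x within I)"
      by (rule has_derivative_edge_dom[OF I x]) (use dW x0 in auto)
    have Qd: "(Q has_real_derivative W x) (at x within I)"
      by (rule has_derivative_edge_dom[OF I x]) (use dQ x0 in auto)
    have "((\<lambda>x. u 0 + Q x + c * x) has_real_derivative W x + c) (at x within I)"
      using Qd by (auto intro!: derivative_eq_intros)
    then show "(u has_real_derivative W x + c) (at x within I)"
      by (rule has_field_derivative_transform_within[where d=1]) (use x affine in auto)
    show "((\<lambda>x. W x + c) has_real_derivative u x - nl p (u x)) (at x within I)"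
      using Wd unfolding F_def by (auto intro!: derivative_eq_intros)
  qed
  then show ?thesis by blast
qed

section \<open>Uniqueness of the weak derivative\<close>

lemma AE_eq_of_indefinite_integrals:
  fixes f g h :: "real \<Rightarrow> real"
  assumes I: "edge_dom I"
    and g: "\<And>x. x \<in> I \<Longrightarrow> set_integrable lborel {0..x} g \<and> f x = f 0 + (LINT t:{0..x}|lborel. g t)"
    and h: "\<And>x. x \<in> I \<Longrightarrow> set_integrable lborel {0..x} h \<and> f x = f 0 + (LINT t:{0..x}|lborel. h t)"
  shows "AE x in lborel. x \<in> I \<longrightarrow> g x = h x"
proof -
  have *: "AE x in lborel. x \<in> {0..R} \<longrightarrow> g x - h x = 0" if R: "R \<in> I" for R
  proof (rule AE_eq_0_of_indefinite_integral)
    show "set_integrable lborel {0..R} (\<lambda>x. g x - h x)" using g[OF R] h[OF R] by auto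
    fix x assume "x \<in> {0..R}"
    then have "x \<in> I" using edge_dom_subset[OF I R] by auto
    from g[OF this] h[OF this] show "(LINT t:{0..x}|lborel. g t - h t) = 0"
      by (simp add: set_integral_diff)
  qed
  from I consider "I = {0..}" | l where "l > 0" "I = {0..l}" by (auto simp: edge_dom_def)
  then show ?thesis
  proof cases
    case 1
    have "AE x in lborel. \<forall>n::nat. x \<in> {0..real n} \<longrightarrow> g x - h x = 0"
      by (subst AE_all_countable) (use * 1 in auto)
    then show ?thesis
    proof eventually_elim
      case (elim x)
      obtain n where "x \<le> real n" using real_arch_simple by blast
      with elim show ?case by (auto simp: 1)
    qed
  next
    case 2
    with *[of l] show ?thesis by (auto elim: eventually_mono)
  qed
qed

lemma edge_sol_indefinite_integral:
  assumes "edge_sol p I u w" "edge_dom I" "x \<in> I"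
  shows "set_integrable lborel {0..x} w \<and> u x = u 0 + (LINT t:{0..x}|lborel. w t)"
proof -
  have s: "edge_sol p {0..x} u w" by (rule edge_sol_subset[OF assms(1) edge_dom_subset[OF assms(2,3)]])
  have "(LINT t:{0..x}|lborel. w t) = u x - u 0"
    using edge_dom_nonneg[OF assms(2,3)] s
    by (intro set_integral_FTC edge_sol_continuous[OF s]) (auto simp: edge_sol_def)
  with borel_integrable_atLeastAtMost'[OF edge_sol_continuous(2)[OF s]] show ?thesis by simp
qed

lemma L2_on_cong_AE:
  assumes "L2_on I f" "set_borel_measurable lborel I g" "AE x in lborel. x \<in> I \<longrightarrow> f x = g x"
  shows "L2_on I g"
proof -
  have g: "(\<lambda>x. indicator I x * g x) \<in> borel_measurable lborel"
    using assms(2) by (simp add: set_borel_measurable_def)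
  have f: "(\<lambda>x. indicator I x * f x) \<in> borel_measurable lborel" "integrable lborel (\<lambda>x. (indicator I x * f x)\<^sup>2)"
    using assms(1) by (auto simp: L2_on_iff)
  have "AE x in lborel. (indicator I x * f x)\<^sup>2 = (indicator I x * g x)\<^sup>2"
    using assms(3) by eventually_elim (auto simp: indicator_def)
  then have "integrable lborel (\<lambda>x. (indicator I x * g x)\<^sup>2)"
    by (rule integrable_cong_AE_imp[OF f(2), rotated]) (use g in measurable)
  with g show ?thesis by (simp add: L2_on_iff)
qed

text \<open>A weak derivative is fixed only almost everywhere. This exchanges it for the continuous
  representative \<open>w\<close>, whose value at the vertex is meaningful.\<close>

lemma H1_edge_edge_sol:
  assumes u: "H1_edge I u u'" and I: "edge_dom I" and s: "edge_sol p I u w"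
  shows "H1_edge I u w" "AE x in lborel. x \<in> I \<longrightarrow> u' x = w x"
proof -
  show ae: "AE x in lborel. x \<in> I \<longrightarrow> u' x = w x"
    using u edge_sol_indefinite_integral[OF s I] unfolding H1_edge_def
    by (intro AE_eq_of_indefinite_integrals[OF I, where f=u]) blast+
  have "L2_on I w"
    by (rule L2_on_cong_AE[OF H1_edge_L2(2)[OF u I] _ ae])
      (use borel_measurable_continuous_on_indicator[OF _ edge_sol_continuous(2)[OF s]] I
        in \<open>simp add: set_borel_measurable_def edge_dom_borel\<close>)
  then show "H1_edge I u w"
    using u edge_sol_indefinite_integral[OF s I] unfolding H1_edge_def L2_on_def by blast
qed

section \<open>Bound states on the graph\<close>

locale single_knot =
  fixes H :: nat and lp ll :: "real list" and p :: real
  assumes p: "2 < p" and H: "1 \<le> H"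
    and lp_pos: "\<And>i. i < length lp \<Longrightarrow> 0 < lp ! i"
    and ll_pos: "\<And>i. i < length ll \<Longrightarrow> 0 < ll ! i"
begin

abbreviation E :: "edge set" where "E \<equiv> edges H lp ll"
abbreviation D :: "edge \<Rightarrow> real set" where "D \<equiv> edom lp ll"

definition Hf :: "edge set" where "Hf = Half ` {..<H}"
definition Bd :: "edge set" where "Bd = Pend ` {..<length lp} \<union> Loop ` {..<length ll}"

text \<open>The default 0 on half-lines makes {0..len e} the vertex alone, so an estimate over
  {0..len e} can also be used there to control the vertex value.\<close>

fun len :: "edge \<Rightarrow> real" where
  "len (Half i) = 0"
| "len (Pend i) = lp ! i"
| "len (Loop i) = ll ! i"

lemma E_eq: "E = Hf \<union> Bd" and Hf_Bd: "Hf \<inter> Bd = {}"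
  by (auto simp: edges_def Hf_def Bd_def)

lemma finite_Hf [simp]: "finite Hf" and finite_Bd [simp]: "finite Bd" and finite_E [simp]: "finite E"
  by (auto simp: edges_def Hf_def Bd_def)

lemma Half_0: "Half 0 \<in> Hf" "Half 0 \<in> E"
  using H by (auto simp: E_eq Hf_def)

lemma D_Hf: "e \<in> Hf \<Longrightarrow> D e = {0..}"
  by (auto simp: Hf_def)

lemma D_Bd: "e \<in> Bd \<Longrightarrow> D e = {0..len e}" and len_pos: "e \<in> Bd \<Longrightarrow> 0 < len e"
  using lp_pos ll_pos by (auto simp: Bd_def)

lemma edge_dom_D: "e \<in> E \<Longrightarrow> edge_dom (D e)"
  using D_Hf D_Bd len_pos unfolding E_eq edge_dom_def by blast

lemma zero_in_D: "e \<in> E \<Longrightarrow> 0 \<in> D e"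
  by (rule edge_dom_0[OF edge_dom_D])

lemma sum_E: "sum f E = sum f Hf + sum f Bd" for f :: "edge \<Rightarrow> real"
  unfolding E_eq by (rule sum.union_disjoint) (auto simp: Hf_Bd)

abbreviation H1 :: "(edge \<Rightarrow> real \<Rightarrow> real) \<Rightarrow> (edge \<Rightarrow> real \<Rightarrow> real) \<Rightarrow> bool" where
  "H1 \<equiv> H1_graph H lp ll"

section \<open>The weak equation, its localization to one edge, and regular solutions\<close>

definition weak_form :: "(edge \<Rightarrow> real \<Rightarrow> real) \<Rightarrow> (edge \<Rightarrow> real \<Rightarrow> real)
    \<Rightarrow> (edge \<Rightarrow> real \<Rightarrow> real) \<Rightarrow> (edge \<Rightarrow> real \<Rightarrow> real) \<Rightarrow> edge \<Rightarrow> real" where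
  "weak_form u u' \<eta> \<eta>' e =
     (LINT x:D e|lborel. u' e x * \<eta>' e x + u e x * \<eta> e x - nl p (u e x) * \<eta> e x)"

definition weak_sol :: "(edge \<Rightarrow> real \<Rightarrow> real) \<Rightarrow> (edge \<Rightarrow> real \<Rightarrow> real) \<Rightarrow> bool" where
  "weak_sol u u' \<longleftrightarrow> H1 u u' \<and> (\<forall>\<eta> \<eta>'. H1 \<eta> \<eta>' \<longrightarrow> (\<Sum>e\<in>E. weak_form u u' \<eta> \<eta>' e) = 0)"

lemma weak_solD: "weak_sol u u' \<Longrightarrow> H1 \<eta> \<eta>' \<Longrightarrow> (\<Sum>e\<in>E. weak_form u u' \<eta> \<eta>' e) = 0"
  by (simp add: weak_sol_def)

definition nontrivial :: "(edge \<Rightarrow> real \<Rightarrow> real) \<Rightarrow> bool" where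
  "nontrivial u \<longleftrightarrow> (\<exists>e\<in>E. \<exists>x\<in>D e. u e x \<noteq> 0)"

lemma bound_state_iff: "bound_state H lp ll p u \<longleftrightarrow> nontrivial u \<and> (\<exists>u'. weak_sol u u')"
  unfolding bound_state_def weak_sol_def weak_form_def nontrivial_def graph_int_def nl_def by auto

lemma H1_edge: "H1 u u' \<Longrightarrow> e \<in> E \<Longrightarrow> H1_edge (D e) (u e) (u' e)"
  by (simp add: H1_graph_def)

lemma H1_vertex: "H1 u u' \<Longrightarrow> e \<in> E \<Longrightarrow> e' \<in> E \<Longrightarrow> u e 0 = u e' 0"
  unfolding H1_graph_def by blast

lemma H1_L2: "H1 u u' \<Longrightarrow> e \<in> E \<Longrightarrow> L2_on (D e) (u e) \<and> L2_on (D e) (u' e)"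
  using H1_edge_L2[OF H1_edge edge_dom_D] by blast

lemma H1_continuous_on: "H1 u u' \<Longrightarrow> e \<in> E \<Longrightarrow> continuous_on (D e) (u e)"
  by (rule H1_edge_continuous_on[OF H1_edge edge_dom_D])

lemma weak_form_cong_AE:
  assumes "e \<in> E" "L2_on (D e) (u e)" "L2_on (D e) (u' e)" "L2_on (D e) (w e)"
    "L2_on (D e) (\<eta> e)" "L2_on (D e) (\<eta>' e)"
    and ae: "AE x in lborel. x \<in> D e \<longrightarrow> u' e x = w e x"
  shows "weak_form u u' \<eta> \<eta>' e = weak_form u w \<eta> \<eta>' e"
proof -
  have meas: "(\<lambda>x. indicator (D e) x *\<^sub>R (f x * \<eta>' e x + u e x * \<eta> e x - nl p (u e x) * \<eta> e x))
      \<in> borel_measurable lborel" if "L2_on (D e) f" for f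
  proof -
    let ?i = "\<lambda>f x. indicator (D e) x * f x :: real"
    have [measurable]: "?i f \<in> borel_measurable borel" "?i (u e) \<in> borel_measurable borel"
      "?i (\<eta> e) \<in> borel_measurable borel" "?i (\<eta>' e) \<in> borel_measurable borel"
      using assms(2,5,6) that by (simp_all add: L2_on_iff)
    have "(\<lambda>x. ?i f x * ?i (\<eta>' e) x + ?i (u e) x * ?i (\<eta> e) x - nl p (?i (u e) x) * ?i (\<eta> e) x)
      \<in> borel_measurable lborel" by measurable
    also have "(\<lambda>x. ?i f x * ?i (\<eta>' e) x + ?i (u e) x * ?i (\<eta> e) x - nl p (?i (u e) x) * ?i (\<eta> e) x)
      = (\<lambda>x. indicator (D e) x *\<^sub>R (f x * \<eta>' e x + u e x * \<eta> e x - nl p (u e x) * \<eta> e x))"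
      by (auto simp: indicator_def)
    finally show ?thesis .
  qed
  show ?thesis unfolding weak_form_def set_lebesgue_integral_def
  proof (rule integral_cong_AE[OF meas meas])
    show "AE x in lborel. indicator (D e) x *\<^sub>R (u' e x * \<eta>' e x + u e x * \<eta> e x - nl p (u e x) * \<eta> e x)
      = indicator (D e) x *\<^sub>R (w e x * \<eta>' e x + u e x * \<eta> e x - nl p (u e x) * \<eta> e x)"
      using ae by eventually_elim (auto simp: indicator_def)
  qed (use assms in auto)
qed

definition regular_sol :: "(edge \<Rightarrow> real \<Rightarrow> real) \<Rightarrow> (edge \<Rightarrow> real \<Rightarrow> real) \<Rightarrow> bool" where
  "regular_sol u w \<longleftrightarrow> weak_sol u w \<and> (\<forall>e\<in>E. edge_sol p (D e) (u e) (w e))"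

text \<open>Vanishing at the ends permits extension by zero to the whole graph; testing with such
  functions localizes the equation to one edge.\<close>

lemma H1_extend_edge:
  assumes e: "e \<in> E" and h: "H1_edge (D e) \<eta> \<eta>'" "\<eta> 0 = 0" "\<And>l. D e = {0..l} \<Longrightarrow> \<eta> l = 0"
  shows "H1 ((\<lambda>_ _. 0)(e := \<eta>)) ((\<lambda>_ _. 0)(e := \<eta>'))"
proof -
  have "((\<lambda>_ _. 0)(e := \<eta>)) (Loop i) (ll ! i) = ((\<lambda>_ _. 0)(e := \<eta>)) (Loop i) 0" for i
    using h(2,3) by (cases "e = Loop i") auto
  then show ?thesis using e h(1,2) by (auto simp: H1_graph_def H1_edge_zero)
qed

lemma weak_sol_regular:
  assumes u: "weak_sol u u'"
  shows "\<exists>w. regular_sol u w \<and> (\<forall>e\<in>E. AE x in lborel. x \<in> D e \<longrightarrow> u' e x = w e x)"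
proof -
  have H1: "H1 u u'" using u by (simp add: weak_sol_def)
  have "\<exists>w. edge_sol p (D e) (u e) w" if e: "e \<in> E" for e
  proof (rule weak_edge_regular[OF p edge_dom_D[OF e] H1_edge[OF H1 e]])
    fix \<eta> \<eta>' assume h: "H1_edge (D e) \<eta> \<eta>'" "\<eta> 0 = 0" "\<And>l. D e = {0..l} \<Longrightarrow> \<eta> l = 0"
    have "(\<Sum>e'\<in>E. weak_form u u' ((\<lambda>_ _. 0)(e := \<eta>)) ((\<lambda>_ _. 0)(e := \<eta>')) e') = 0"
      by (rule weak_solD[OF u H1_extend_edge[OF e h]])
    also have "(\<Sum>e'\<in>E. weak_form u u' ((\<lambda>_ _. 0)(e := \<eta>)) ((\<lambda>_ _. 0)(e := \<eta>')) e')
      = (\<Sum>e'\<in>{e}. weak_form u u' ((\<lambda>_ _. 0)(e := \<eta>)) ((\<lambda>_ _. 0)(e := \<eta>')) e')"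
      by (rule sum.mono_neutral_right) (use e in \<open>auto simp: weak_form_def\<close>)
    finally show "(LINT x:D e|lborel. u' e x * \<eta>' x + u e x * \<eta> x - nl p (u e x) * \<eta> x) = 0"
      by (simp add: weak_form_def)
  qed
  then have "\<exists>w. \<forall>e\<in>E. edge_sol p (D e) (u e) (w e)" by (intro bchoice ballI)
  then obtain w where w: "\<forall>e\<in>E. edge_sol p (D e) (u e) (w e)" ..
  have H1w: "H1_edge (D e) (u e) (w e)" and ae: "AE x in lborel. x \<in> D e \<longrightarrow> u' e x = w e x"
    if e: "e \<in> E" for e
    by (rule H1_edge_edge_sol[OF H1_edge[OF H1 e] edge_dom_D[OF e] w[rule_format, OF e]])+
  have H1': "H1 u w" using H1 H1w unfolding H1_graph_def by blast
  have "weak_sol u w" unfolding weak_sol_def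
  proof (intro conjI H1' allI impI)
    fix \<eta> \<eta>' assume h: "H1 \<eta> \<eta>'"
    have "(\<Sum>e\<in>E. weak_form u w \<eta> \<eta>' e) = (\<Sum>e\<in>E. weak_form u u' \<eta> \<eta>' e)"
      by (intro sum.cong refl weak_form_cong_AE[symmetric] ae)
        (use H1_L2[OF H1] H1_L2[OF H1'] H1_L2[OF h] in auto)
    then show "(\<Sum>e\<in>E. weak_form u w \<eta> \<eta>' e) = 0" using weak_solD[OF u h] by simp
  qed
  then show ?thesis using w ae unfolding regular_sol_def by blast
qed

text \<open>This bound does not depend on the solution. Since there is at least one half-line, it
  controls the vertex value, and thereby the starting value on every bounded edge.\<close>

definition M0 :: real where "M0 = (p / 2) powr (1 / (p - 2))"

lemma regular_solD:
  assumes "regular_sol u w"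
  shows "H1 u w" "weak_sol u w" "e \<in> E \<Longrightarrow> edge_sol p (D e) (u e) (w e)"
  using assms by (auto simp: regular_sol_def weak_sol_def)

lemma half_line_bounds:
  assumes u: "regular_sol u w" and e: "e \<in> Hf" and x: "0 \<le> x"
  shows "(w e x)\<^sup>2 = (u e x)\<^sup>2 - 2 / p * \<bar>u e x\<bar> powr p" "\<bar>w e x\<bar> \<le> \<bar>u e x\<bar>" "\<bar>u e x\<bar> \<le> M0"
proof -
  have eE: "e \<in> E" using e by (simp add: E_eq)
  have s: "edge_sol p {0..} (u e) (w e)" using regular_solD(3)[OF u eE] D_Hf[OF e] by simp
  have l: "L2_on {0..} (u e)" "L2_on {0..} (w e)"
    using H1_L2[OF regular_solD(1)[OF u] eE] D_Hf[OF e] by auto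
  show en: "(w e x)\<^sup>2 = (u e x)\<^sup>2 - 2 / p * \<bar>u e x\<bar> powr p"
    by (rule half_line_energy[OF p s _ _ x]) (use l in \<open>auto simp: L2_on_def\<close>)
  have "0 \<le> 2 / p * \<bar>u e x\<bar> powr p" using p by simp
  then have "(w e x)\<^sup>2 \<le> (u e x)\<^sup>2" using en by linarith
  then show "\<bar>w e x\<bar> \<le> \<bar>u e x\<bar>" by (simp add: abs_le_square_iff)
  have "0 \<le> (w e x)\<^sup>2" by simp
  then show "\<bar>u e x\<bar> \<le> M0" unfolding M0_def using en by (intro abs_le_of_energy p) linarith
qed

lemma regular_sol_bounded:
  assumes u: "regular_sol u w" and e: "e \<in> E"
  shows "\<exists>K. \<forall>x\<in>D e. \<bar>u e x\<bar> \<le> K"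
proof (cases "e \<in> Hf")
  case True
  then show ?thesis using half_line_bounds(3)[OF u True] D_Hf[OF True] by auto
next
  case False
  then have "compact (D e)" using e D_Bd by (auto simp: E_eq)
  then have "bounded (u e ` D e)"
    by (intro compact_imp_bounded compact_continuous_image H1_continuous_on[OF regular_solD(1)[OF u] e])
  then show ?thesis unfolding bounded_iff by auto
qed

lemma L2_nl:
  assumes e: "e \<in> E" and f: "L2_on (D e) f" and K: "\<And>x. x \<in> D e \<Longrightarrow> \<bar>f x\<bar> \<le> K"
  shows "L2_on (D e) (\<lambda>x. nl p (f x))"
proof (rule L2_on_bound[OF f])
  have "(\<lambda>x. indicator (D e) x * f x) \<in> borel_measurable lborel"
    using f by (simp add: L2_on_iff)
  then have "(\<lambda>x. nl p (indicator (D e) x * f x)) \<in> borel_measurable lborel"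
    by (rule measurable_compose) simp
  also have "(\<lambda>x. nl p (indicator (D e) x * f x)) = (\<lambda>x. indicator (D e) x *\<^sub>R nl p (f x))"
    by (auto simp: indicator_def)
  finally show "set_borel_measurable lborel (D e) (\<lambda>x. nl p (f x))" unfolding set_borel_measurable_def .
  show "\<bar>nl p (f x)\<bar> \<le> K powr (p - 2) * \<bar>f x\<bar>" if "x \<in> D e" for x
    by (rule abs_nl_le[OF p K[OF that]])
qed

lemma L2_regular_sol:
  assumes u: "regular_sol u w" and e: "e \<in> E"
  shows "L2_on (D e) (u e)" "L2_on (D e) (w e)" "L2_on (D e) (\<lambda>x. nl p (u e x))"
proof -
  show l: "L2_on (D e) (u e)" "L2_on (D e) (w e)" using H1_L2[OF regular_solD(1)[OF u] e] by auto
  obtain K where "\<forall>x\<in>D e. \<bar>u e x\<bar> \<le> K" using regular_sol_bounded[OF u e] ..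
  then show "L2_on (D e) (\<lambda>x. nl p (u e x))" by (intro L2_nl[OF e l(1)]) auto
qed

section \<open>Energy (the squared H^1 norm) and action of a solution\<close>

definition energy :: "(edge \<Rightarrow> real \<Rightarrow> real) \<Rightarrow> (edge \<Rightarrow> real \<Rightarrow> real) \<Rightarrow> edge \<Rightarrow> real" where
  "energy u w e = (LINT x:D e|lborel. (w e x)\<^sup>2 + (u e x)\<^sup>2)"

definition total_energy :: "(edge \<Rightarrow> real \<Rightarrow> real) \<Rightarrow> (edge \<Rightarrow> real \<Rightarrow> real) \<Rightarrow> real" where
  "total_energy u w = (\<Sum>e\<in>E. energy u w e)"

lemma energy_nonneg: "0 \<le> energy u w e"
  unfolding energy_def set_lebesgue_integral_def by (intro integral_nonneg_AE AE_I2) simp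

lemma energy_le_total: "e \<in> E \<Longrightarrow> energy u w e \<le> total_energy u w"
  unfolding total_energy_def by (intro member_le_sum energy_nonneg) auto

lemma weak_form_split:
  assumes "L2_on (D e) (u e)" "L2_on (D e) (w e)" "L2_on (D e) (\<lambda>x. nl p (u e x))"
    "L2_on (D e) (\<eta> e)" "L2_on (D e) (\<eta>' e)"
  shows "weak_form u w \<eta> \<eta>' e = (LINT x:D e|lborel. w e x * \<eta>' e x)
    + (LINT x:D e|lborel. u e x * \<eta> e x) - (LINT x:D e|lborel. nl p (u e x) * \<eta> e x)"
  unfolding weak_form_def
  by (simp add: set_integral_add set_integral_diff set_integrable_mult_L2 assms)

lemma weak_form_self:
  assumes u: "regular_sol u w" and e: "e \<in> E"
  shows "weak_form u w u w e = energy u w e - (LINT x:D e|lborel. \<bar>u e x\<bar> powr p)"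
proof -
  note l = L2_regular_sol[OF u e]
  have "weak_form u w u w e = (LINT x:D e|lborel. w e x * w e x)
    + (LINT x:D e|lborel. u e x * u e x) - (LINT x:D e|lborel. nl p (u e x) * u e x)"
    by (rule weak_form_split) (use l in auto)
  also have "(LINT x:D e|lborel. w e x * w e x) + (LINT x:D e|lborel. u e x * u e x) = energy u w e"
    unfolding energy_def power2_eq_square
    by (rule set_integral_add(2)[symmetric]) (use l in \<open>auto intro: set_integrable_mult_L2\<close>)
  finally show ?thesis by (simp add: nl_mult_self)
qed

text \<open>Testing the equation with the solution itself equates the integral of |u|^p with the
  squared H^1 norm (the Nehari identity). Minimizing the action thus becomes minimizing
  \<open>total_energy\<close>, which is nonnegative and lower semicontinuous under weak
  convergence.\<close>

lemma action_regular_sol: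
  assumes u: "regular_sol u w"
  shows "action H lp ll p u w = (1 / 2 - 1 / p) * total_energy u w"
proof -
  have "(\<Sum>e\<in>E. energy u w e - (LINT x:D e|lborel. \<bar>u e x\<bar> powr p)) = 0"
    using weak_solD[OF regular_solD(2)[OF u] regular_solD(1)[OF u]] by (simp add: weak_form_self[OF u])
  then have "(\<Sum>e\<in>E. LINT x:D e|lborel. \<bar>u e x\<bar> powr p) = total_energy u w"
    by (simp add: sum_subtractf total_energy_def)
  then show ?thesis
    by (simp add: action_def graph_int_def total_energy_def[unfolded energy_def, symmetric] left_diff_distrib)
qed

lemma energy_cong_AE:
  assumes H1: "H1 u u'" "H1 u w" and e: "e \<in> E" and ae: "AE x in lborel. x \<in> D e \<longrightarrow> u' e x = w e x"
  shows "energy u u' e = energy u w e"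
proof -
  have meas: "(\<lambda>x. indicator (D e) x *\<^sub>R ((f x)\<^sup>2 + (u e x)\<^sup>2)) \<in> borel_measurable lborel"
    if "L2_on (D e) f" for f
  proof -
    have "set_integrable lborel (D e) (\<lambda>x. (f x)\<^sup>2 + (u e x)\<^sup>2)"
      using that H1_L2[OF H1(1) e] unfolding L2_on_def by (intro set_integral_add(1)) auto
    then show ?thesis unfolding set_integrable_def by auto
  qed
  show ?thesis unfolding energy_def set_lebesgue_integral_def
  proof (rule integral_cong_AE[OF meas meas])
    show "AE x in lborel. indicator (D e) x *\<^sub>R ((u' e x)\<^sup>2 + (u e x)\<^sup>2)
      = indicator (D e) x *\<^sub>R ((w e x)\<^sup>2 + (u e x)\<^sup>2)"
      using ae by eventually_elim (auto simp: indicator_def)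
  qed (use H1_L2[OF H1(1) e] H1_L2[OF H1(2) e] in auto)
qed

lemma action_eq_energy:
  "action H lp ll p u w = 1 / 2 * total_energy u w - 1 / p * (\<Sum>e\<in>E. LINT x:D e|lborel. \<bar>u e x\<bar> powr p)"
  by (simp add: action_def graph_int_def total_energy_def energy_def)

text \<open>The derivative that witnesses \<open>bound_state\<close> need not be \<open>v'\<close>.
  Both agree almost everywhere with the classical derivative \<open>w\<close>, so the action is
  insensitive to the choice.\<close>

lemma action_bound_state:
  assumes "bound_state H lp ll p v" and H1: "H1 v v'"
  shows "\<exists>w. regular_sol v w \<and> action H lp ll p v v' = (1 / 2 - 1 / p) * total_energy v w"
proof -
  obtain u' where "weak_sol v u'" using assms(1) by (auto simp: bound_state_iff)
  then obtain w where w: "regular_sol v w" using weak_sol_regular by blast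
  have "AE x in lborel. x \<in> D e \<longrightarrow> v' e x = w e x" if e: "e \<in> E" for e
    by (rule H1_edge_edge_sol(2)[OF H1_edge[OF H1 e] edge_dom_D[OF e] regular_solD(3)[OF w e]])
  then have "energy v v' e = energy v w e" if "e \<in> E" for e
    using that by (intro energy_cong_AE[OF H1 regular_solD(1)[OF w]])
  then have "action H lp ll p v v' = action H lp ll p v w"
    by (simp add: action_eq_energy total_energy_def)
  then show ?thesis using w action_regular_sol[OF w] by auto
qed

end

section \<open>Bound states do not become small near the vertex\<close>

text \<open>From 1 - k <= t^2 <= |t| <= 1 each t lies within k of its sign, and m counts the
  negative ones. It will be applied to the ratios of outgoing slope to vertex value on the
  half-lines.\<close>

lemma sum_near_integer:
  fixes t :: "'a \<Rightarrow> real"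
  assumes S: "finite S" and t: "\<And>e. e \<in> S \<Longrightarrow> (t e)\<^sup>2 \<le> 1" "\<And>e. e \<in> S \<Longrightarrow> 1 - k \<le> (t e)\<^sup>2"
  shows "\<exists>m\<le>card S. \<bar>(\<Sum>e\<in>S. t e) - (real (card S) - 2 * real m)\<bar> \<le> real (card S) * k"
proof (intro exI conjI)
  let ?N = "{e \<in> S. t e < 0}"
  let ?s = "\<lambda>e. if t e < 0 then -1 else 1 :: real"
  show "card ?N \<le> card S" using S by (intro card_mono) auto
  have sq: "(if a < 0 then -1 else 1 :: real) = 1 - 2 * (if a < 0 then 1 else 0)" for a :: real by simp
  have "(\<Sum>e\<in>S. ?s e) = real (card S) - 2 * (\<Sum>e\<in>S. if t e < 0 then 1 else 0)"
    unfolding sq by (simp add: sum_subtractf sum_distrib_left[symmetric])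
  also have "(\<Sum>e\<in>S. if t e < 0 then 1 else 0 :: real) = (\<Sum>e\<in>?N. 1)"
    by (rule sum.inter_filter[symmetric, OF S])
  finally have s: "(\<Sum>e\<in>S. ?s e) = real (card S) - 2 * real (card ?N)" by simp
  have "\<bar>t e - ?s e\<bar> \<le> k" if e: "e \<in> S" for e
  proof -
    have le1: "\<bar>t e\<bar> \<le> 1" using t(1)[OF e] by (simp add: abs_square_le_1)
    then have "\<bar>t e\<bar> * \<bar>t e\<bar> \<le> 1 * \<bar>t e\<bar>" by (intro mult_right_mono) auto
    then have "1 - k \<le> \<bar>t e\<bar>" using t(2)[OF e] by (simp add: power2_eq_square abs_mult_self_eq)
    then show ?thesis using le1 by auto
  qed
  then have "(\<Sum>e\<in>S. \<bar>t e - ?s e\<bar>) \<le> real (card S) * k"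
    by (rule sum_bounded_above)
  then have "\<bar>\<Sum>e\<in>S. t e - ?s e\<bar> \<le> real (card S) * k"
    by (rule order_trans[OF sum_abs])
  then show "\<bar>(\<Sum>e\<in>S. t e) - (real (card S) - 2 * real (card ?N))\<bar> \<le> real (card S) * k"
    by (simp only: sum_subtractf s)
qed

context single_knot
begin

text \<open>A linear cutoff with value c at the vertex and support in [0, 1]. It extends any test
  function on the bounded edges to the half-lines.\<close>

definition hat :: "real \<Rightarrow> real \<Rightarrow> real" where "hat c x = c * (1 - min x 1)"
definition hat' :: "real \<Rightarrow> real \<Rightarrow> real" where "hat' c x = - c * indicator {0..1} x"

lemma H1_edge_hat: "H1_edge {0..} (hat c) (hat' c)"
proof -
  have "H1_edge {0..} (\<lambda>x. c + (- c) * min x 1 + 0 * min x 1)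
      (\<lambda>x. (- c) * indicator {0..1} x + 0 * indicator {0..1} x)"
    by (rule H1_edge_min) (auto simp: edge_dom_def)
  then show ?thesis by (simp add: hat_def[abs_def] hat'_def[abs_def] right_diff_distrib)
qed

abbreviation with_hat :: "real \<Rightarrow> (edge \<Rightarrow> real \<Rightarrow> real) \<Rightarrow> edge \<Rightarrow> real \<Rightarrow> real" where
  "with_hat c f \<equiv> \<lambda>e. if e \<in> Hf then hat c else f e"
abbreviation with_hat' :: "real \<Rightarrow> (edge \<Rightarrow> real \<Rightarrow> real) \<Rightarrow> edge \<Rightarrow> real \<Rightarrow> real" where
  "with_hat' c f \<equiv> \<lambda>e. if e \<in> Hf then hat' c else f e"

lemma H1_with_hat:
  assumes "\<And>e. e \<in> Bd \<Longrightarrow> H1_edge {0..len e} (f e) (f' e)" "\<And>e. e \<in> Bd \<Longrightarrow> f e 0 = c"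
    "\<And>i. i < length ll \<Longrightarrow> f (Loop i) (ll ! i) = c"
  shows "H1 (with_hat c f) (with_hat' c f')"
proof -
  have 1: "H1_edge (D e) (with_hat c f e) (with_hat' c f' e)" if "e \<in> E" for e
  proof (cases "e \<in> Hf")
    case True
    then show ?thesis using H1_edge_hat D_Hf[OF True] by simp
  next
    case False
    then have "e \<in> Bd" using that by (simp add: E_eq)
    then show ?thesis using False assms(1) D_Bd by simp
  qed
  have 2: "with_hat c f e 0 = c" if "e \<in> E" for e
    using that assms(2) by (auto simp: E_eq hat_def)
  have 3: "with_hat c f (Loop i) (ll ! i) = with_hat c f (Loop i) 0" if i: "i < length ll" for i
  proof -
    have "Loop i \<notin> Hf" "Loop i \<in> Bd" using i by (auto simp: Hf_def Bd_def)
    then show ?thesis using assms(2,3) i by simp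
  qed
  show ?thesis unfolding H1_graph_def using 1 2 3 by simp
qed

text \<open>Because w' = u - f(u), the integrand on [0, 1] is the derivative of w times the cutoff.
  The boundary term at 1 vanishes, which leaves the outgoing slope at the vertex.\<close>

lemma weak_form_hat:
  assumes u: "regular_sol u w" and e: "e \<in> Hf"
  shows "weak_form u w (with_hat c f) (with_hat' c f') e = - c * w e 0"
proof -
  have s: "edge_sol p {0..1} (u e) (w e)"
    using edge_sol_subset[OF regular_solD(3)[OF u]] e D_Hf[OF e] by (auto simp: E_eq)
  have "weak_form u w (with_hat c f) (with_hat' c f') e
    = (LINT x:{0..}|lborel. w e x * hat' c x + u e x * hat c x - nl p (u e x) * hat c x)"
    unfolding weak_form_def using e D_Hf[OF e] by simp
  also have "\<dots> = (LINT x:{0..1}|lborel. (u e x - nl p (u e x)) * (c * (1 - x)) + - c * w e x)"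
    unfolding set_lebesgue_integral_def
    by (intro Bochner_Integration.integral_cong refl)
      (auto simp: indicator_def hat_def hat'_def algebra_simps)
  also have "\<dots> = w e 1 * (c * (1 - 1)) - w e 0 * (c * (1 - 0))"
  proof (rule set_integral_FTC)
    fix x :: real assume "x \<in> {0..1}"
    then have "(w e has_real_derivative u e x - nl p (u e x)) (at x within {0..1})"
      using s by (simp add: edge_sol_def)
    moreover have "((\<lambda>x. c * (1 - x)) has_real_derivative - c) (at x within {0..1})"
      by (auto intro!: derivative_eq_intros)
    ultimately show "((\<lambda>x. w e x * (c * (1 - x))) has_real_derivative
        (u e x - nl p (u e x)) * (c * (1 - x)) + - c * w e x) (at x within {0..1})"
      by (rule DERIV_mult)
  next
    show "continuous_on {0..1} (\<lambda>x. (u e x - nl p (u e x)) * (c * (1 - x)) + - c * w e x)"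
      by (intro continuous_intros continuous_on_nl p edge_sol_continuous[OF s])
  qed simp
  finally show ?thesis by simp
qed

text \<open>This stands in for the Kirchhoff condition: the flux into the half-lines is expressed
  through the weak form on the bounded edges alone. It is used with \<open>u\<close> itself and with
  \<open>phi\<close> as test function.\<close>

lemma bounded_edges_identity:
  assumes u: "regular_sol u w"
    and f: "\<And>e. e \<in> Bd \<Longrightarrow> H1_edge {0..len e} (f e) (f' e)" "\<And>e. e \<in> Bd \<Longrightarrow> f e 0 = c"
    "\<And>i. i < length ll \<Longrightarrow> f (Loop i) (ll ! i) = c"
  shows "(\<Sum>e\<in>Bd. weak_form u w f f' e) = c * (\<Sum>e\<in>Hf. w e 0)"
proof -
  have "(\<Sum>e\<in>E. weak_form u w (with_hat c f) (with_hat' c f') e) = 0"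
    by (rule weak_solD[OF regular_solD(2)[OF u] H1_with_hat[OF f]])
  moreover have "weak_form u w (with_hat c f) (with_hat' c f') e = weak_form u w f f' e" if "e \<in> Bd" for e
    using that Hf_Bd by (auto simp: weak_form_def)
  ultimately show ?thesis
    by (simp add: sum_E weak_form_hat[OF u] sum_negf sum_distrib_left[symmetric])
qed

lemma vertex_value: "H1 u w \<Longrightarrow> e \<in> E \<Longrightarrow> u e 0 = u (Half 0) 0"
  by (rule H1_vertex) (simp_all add: Half_0)

lemma loop_value:
  assumes "H1 u w" "i < length ll" shows "u (Loop i) (ll ! i) = u (Half 0) 0"
proof -
  have "u (Loop i) (ll ! i) = u (Loop i) 0" using assms unfolding H1_graph_def by blast
  also have "\<dots> = u (Half 0) 0" by (rule vertex_value[OF assms(1)]) (use assms(2) in \<open>simp add: edges_def\<close>)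
  finally show ?thesis .
qed

text \<open>Both ends of a loop are the vertex, so cosh is centred at the midpoint and takes the
  value 1 at each end. The value on half-lines is a placeholder that the cutoff replaces.\<close>

fun phi :: "edge \<Rightarrow> real \<Rightarrow> real" where
  "phi (Half i) x = 0"
| "phi (Pend i) x = cosh (lp ! i - x) / cosh (lp ! i)"
| "phi (Loop i) x = cosh (x - ll ! i / 2) / cosh (ll ! i / 2)"

fun phi' :: "edge \<Rightarrow> real \<Rightarrow> real" where
  "phi' (Half i) x = 0"
| "phi' (Pend i) x = - sinh (lp ! i - x) / cosh (lp ! i)"
| "phi' (Loop i) x = sinh (x - ll ! i / 2) / cosh (ll ! i / 2)"

lemma phi_derivs:
  "(phi e has_real_derivative phi' e x) (at x within S)"
  "(phi' e has_real_derivative phi e x) (at x within S)"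
proof -
  have phi_eq: "phi (Half i) = (\<lambda>x. 0)" "phi (Pend i) = (\<lambda>x. cosh (lp ! i - x) / cosh (lp ! i))"
    "phi (Loop i) = (\<lambda>x. cosh (x - ll ! i / 2) / cosh (ll ! i / 2))"
    "phi' (Half i) = (\<lambda>x. 0)" "phi' (Pend i) = (\<lambda>x. - sinh (lp ! i - x) / cosh (lp ! i))"
    "phi' (Loop i) = (\<lambda>x. sinh (x - ll ! i / 2) / cosh (ll ! i / 2))" for i
    by (simp_all add: fun_eq_iff)
  show "(phi e has_real_derivative phi' e x) (at x within S)"
    by (cases e) (auto simp: phi_eq intro!: derivative_eq_intros)
  show "(phi' e has_real_derivative phi e x) (at x within S)"
    by (cases e) (auto simp: phi_eq intro!: derivative_eq_intros)
qed

lemma cosh_le_cosh_abs: "\<bar>x\<bar> \<le> \<bar>y\<bar> \<Longrightarrow> cosh x \<le> cosh (y::real)"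
  using cosh_real_nonneg_le_iff[of "\<bar>x\<bar>" "\<bar>y\<bar>"] by simp

lemma phi_bounds:
  assumes "e \<in> Bd" "x \<in> {0..len e}" shows "0 \<le> phi e x" "phi e x \<le> 1"
proof -
  show "0 \<le> phi e x" by (cases e) (simp_all add: less_imp_le)
  show "phi e x \<le> 1"
    using assms by (cases e) (auto intro!: cosh_le_cosh_abs simp: abs_if)
qed

text \<open>Minus the sum of the outgoing derivatives of \<open>phi\<close> at the vertex, a
  Dirichlet-to-Neumann value of the linear equation. A loop leaves the vertex twice, hence the
  factor 2.\<close>

fun tau :: "edge \<Rightarrow> real" where
  "tau (Half i) = 0"
| "tau (Pend i) = tanh (lp ! i)"
| "tau (Loop i) = 2 * tanh (ll ! i / 2)"

text \<open>At the free end of a pendant \<open>phi'\<close> vanishes, so the unknown value of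
  \<open>u\<close> there drops out; on a loop both boundary values of \<open>u\<close> are the
  vertex value.\<close>

lemma phi_boundary:
  assumes u: "H1 u w" and e: "e \<in> Bd"
  shows "u e (len e) * phi' e (len e) - u e 0 * phi' e 0 = u (Half 0) 0 * tau e"
proof -
  have u0: "u e 0 = u (Half 0) 0" by (rule vertex_value[OF u]) (use e in \<open>simp add: E_eq\<close>)
  show ?thesis
  proof (cases e)
    case (Loop i)
    then have "u e (len e) = u (Half 0) 0" using loop_value[OF u] e by (auto simp: Bd_def)
    then show ?thesis using u0 Loop by (simp add: tanh_def field_simps)
  qed (use u0 in \<open>simp_all add: tanh_def\<close>)
qed

text \<open>Since phi'' = phi, the linear part of the integrand is the derivative of u phi'. Only
  vertex data and a superlinear remainder survive.\<close>

lemma weak_form_phi: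
  assumes u: "regular_sol u w" and e: "e \<in> Bd"
  shows "weak_form u w phi phi' e
    = u (Half 0) 0 * tau e - (LINT x:{0..len e}|lborel. nl p (u e x) * phi e x)"
proof -
  have eE: "e \<in> E" using e by (simp add: E_eq)
  have s: "edge_sol p {0..len e} (u e) (w e)" using regular_solD(3)[OF u eE] D_Bd[OF e] by simp
  have cphi: "continuous_on {0..len e} (phi e)" "continuous_on {0..len e} (phi' e)"
    using phi_derivs by (blast intro: DERIV_continuous_on)+
  note c = edge_sol_continuous[OF s] cphi
  have "weak_form u w phi phi' e = (LINT x:{0..len e}|lborel. (w e x * phi' e x + phi e x * u e x)
      - nl p (u e x) * phi e x)"
    unfolding weak_form_def D_Bd[OF e] by (simp add: mult.commute)
  also have "\<dots> = (LINT x:{0..len e}|lborel. w e x * phi' e x + phi e x * u e x)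
      - (LINT x:{0..len e}|lborel. nl p (u e x) * phi e x)"
    by (intro set_integral_diff(2) borel_integrable_atLeastAtMost' continuous_intros continuous_on_nl p c)
  also have "(LINT x:{0..len e}|lborel. w e x * phi' e x + phi e x * u e x)
      = u e (len e) * phi' e (len e) - u e 0 * phi' e 0"
  proof (rule set_integral_FTC)
    show "0 \<le> len e" using len_pos[OF e] by simp
    show "continuous_on {0..len e} (\<lambda>x. w e x * phi' e x + phi e x * u e x)"
      by (intro continuous_intros c)
    fix x assume "x \<in> {0..len e}"
    then have "(u e has_real_derivative w e x) (at x within {0..len e})"
      using s by (simp add: edge_sol_def)
    from DERIV_mult[OF this phi_derivs(2)]
    show "((\<lambda>x. u e x * phi' e x) has_real_derivative w e x * phi' e x + phi e x * u e x)
      (at x within {0..len e})" .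
  qed
  finally show ?thesis using phi_boundary[OF regular_solD(1)[OF u] e] by simp
qed

lemma test_self:
  assumes u: "regular_sol u w"
  shows "(\<Sum>e\<in>Bd. energy u w e - (LINT x:{0..len e}|lborel. \<bar>u e x\<bar> powr p))
    = u (Half 0) 0 * (\<Sum>e\<in>Hf. w e 0)"
proof -
  note h = regular_solD(1)[OF u]
  have "(\<Sum>e\<in>Bd. weak_form u w u w e) = u (Half 0) 0 * (\<Sum>e\<in>Hf. w e 0)"
  proof (rule bounded_edges_identity[OF u])
    fix e assume e: "e \<in> Bd"
    then have eE: "e \<in> E" by (simp add: E_eq)
    show "H1_edge {0..len e} (u e) (w e)" using H1_edge[OF h eE] D_Bd[OF e] by simp
    show "u e 0 = u (Half 0) 0" by (rule vertex_value[OF h eE])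
  qed (rule loop_value[OF h])
  also have "(\<Sum>e\<in>Bd. weak_form u w u w e)
    = (\<Sum>e\<in>Bd. energy u w e - (LINT x:{0..len e}|lborel. \<bar>u e x\<bar> powr p))"
    using weak_form_self[OF u] D_Bd by (intro sum.cong) (simp_all add: E_eq)
  finally show ?thesis .
qed

lemma test_phi:
  assumes u: "regular_sol u w"
  shows "u (Half 0) 0 * (\<Sum>e\<in>Bd. tau e) - (\<Sum>e\<in>Bd. LINT x:{0..len e}|lborel. nl p (u e x) * phi e x)
    = (\<Sum>e\<in>Hf. w e 0)"
proof -
  have "(\<Sum>e\<in>Bd. weak_form u w phi phi' e) = 1 * (\<Sum>e\<in>Hf. w e 0)"
  proof (rule bounded_edges_identity[OF u])
    fix e assume e: "e \<in> Bd"
    have "continuous_on {0..len e} (phi' e)" using phi_derivs(2) by (blast intro: DERIV_continuous_on)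
    then show "H1_edge {0..len e} (phi e) (phi' e)"
      by (intro H1_edge_C1 len_pos[OF e] phi_derivs)
    show "phi e 0 = 1" using e by (cases e) (auto simp: Bd_def)
  qed simp
  then show ?thesis by (simp add: weak_form_phi[OF u] sum_subtractf sum_distrib_left)
qed

text \<open>The ratio of the nonlinear to the linear term is at most this number wherever |u| <=
  \<epsilon>.\<close>

definition kappa :: "real \<Rightarrow> real" where "kappa \<epsilon> = \<epsilon> powr (p - 2)"

lemma card_Hf: "card Hf = H"
  unfolding Hf_def by (simp add: card_image inj_on_def)

text \<open>In \<open>test_self\<close> the integral of |u|^p is absorbed into half the integral of
  u^2, and the right-hand side is at most H a^2 because each outgoing slope is bounded by |a|. The
  second estimate controls the remainder in \<open>test_phi\<close>. Its factor |a| allows |a||u| <=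
  (u^2 + a^2)/2, so everything is measured by a^2 and a = 0 is not excluded.\<close>

lemma small_solution:
  assumes u: "regular_sol u w" and k: "kappa \<epsilon> \<le> 1 / 2"
    and small: "\<And>e x. e \<in> Bd \<Longrightarrow> x \<in> {0..len e} \<Longrightarrow> \<bar>u e x\<bar> \<le> \<epsilon>"
  defines "a \<equiv> u (Half 0) 0"
  shows "(\<Sum>e\<in>Bd. LINT x:{0..len e}|lborel. (u e x)\<^sup>2) \<le> 2 * real H * a\<^sup>2"
    and "\<bar>a\<bar> * \<bar>a * (\<Sum>e\<in>Bd. tau e) - (\<Sum>e\<in>Hf. w e 0)\<bar>
      \<le> kappa \<epsilon> * (real H + (\<Sum>e\<in>Bd. len e) / 2) * a\<^sup>2"
proof -
  have k0: "0 \<le> kappa \<epsilon>" by (simp add: kappa_def)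
  have uc: "continuous_on {0..len e} (u e)" and wc: "continuous_on {0..len e} (w e)" if e: "e \<in> Bd" for e
  proof -
    have "edge_sol p {0..len e} (u e) (w e)"
      using regular_solD(3)[OF u, of e] D_Bd[OF e] e by (simp add: E_eq)
    then show "continuous_on {0..len e} (u e)" "continuous_on {0..len e} (w e)"
      by (rule edge_sol_continuous)+
  qed
  have u2i: "set_integrable lborel {0..len e} (\<lambda>x. (u e x)\<^sup>2)" if e: "e \<in> Bd" for e
    by (intro borel_integrable_atLeastAtMost' continuous_intros uc[OF e])
  have "(1 / 2) * (LINT x:{0..len e}|lborel. (u e x)\<^sup>2)
      \<le> energy u w e - (LINT x:{0..len e}|lborel. \<bar>u e x\<bar> powr p)" if e: "e \<in> Bd" for e
  proof -
    have "(LINT x:{0..len e}|lborel. (u e x)\<^sup>2) \<le> (LINT x:{0..len e}|lborel. (w e x)\<^sup>2 + (u e x)\<^sup>2)"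
      by (intro set_integral_mono u2i[OF e] borel_integrable_atLeastAtMost' continuous_intros uc[OF e] wc[OF e]) simp
    then have 1: "(LINT x:{0..len e}|lborel. (u e x)\<^sup>2) \<le> energy u w e"
      by (simp add: energy_def D_Bd[OF e])
    have "(LINT x:{0..len e}|lborel. nl p (u e x) * u e x) \<le> (LINT x:{0..len e}|lborel. (1 / 2) * (u e x)\<^sup>2)"
    proof (intro set_integral_mono)
      show "set_integrable lborel {0..len e} (\<lambda>x. nl p (u e x) * u e x)"
        by (intro borel_integrable_atLeastAtMost' continuous_intros continuous_on_nl p uc[OF e])
      show "set_integrable lborel {0..len e} (\<lambda>x. (1 / 2) * (u e x)\<^sup>2)"
        by (intro set_integrable_mult_right u2i[OF e])
      fix x assume x: "x \<in> {0..len e}"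
      have "nl p (u e x) * u e x \<le> kappa \<epsilon> * (u e x)\<^sup>2"
        unfolding nl_mult_self kappa_def by (rule abs_powr_le[OF p small[OF e x]])
      also have "\<dots> \<le> (1 / 2) * (u e x)\<^sup>2" by (intro mult_right_mono k) simp
      finally show "nl p (u e x) * u e x \<le> (1 / 2) * (u e x)\<^sup>2" .
    qed
    then show ?thesis using 1 by (simp add: nl_mult_self)
  qed
  then have "(\<Sum>e\<in>Bd. (1 / 2) * (LINT x:{0..len e}|lborel. (u e x)\<^sup>2))
    \<le> (\<Sum>e\<in>Bd. energy u w e - (LINT x:{0..len e}|lborel. \<bar>u e x\<bar> powr p))"
    by (rule sum_mono)
  also have "\<dots> = a * (\<Sum>e\<in>Hf. w e 0)" unfolding a_def by (rule test_self[OF u])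
  also have "\<dots> \<le> \<bar>a\<bar> * \<bar>\<Sum>e\<in>Hf. w e 0\<bar>" by (simp flip: abs_mult)
  also have "\<dots> \<le> \<bar>a\<bar> * (real H * \<bar>a\<bar>)"
  proof (rule mult_left_mono)
    have "\<bar>w e 0\<bar> \<le> \<bar>a\<bar>" if e: "e \<in> Hf" for e
    proof -
      have "u e 0 = a" unfolding a_def
        by (rule vertex_value[OF regular_solD(1)[OF u]]) (use e in \<open>simp add: E_eq\<close>)
      then show ?thesis using half_line_bounds(2)[OF u e, of 0] by simp
    qed
    then have "(\<Sum>e\<in>Hf. \<bar>w e 0\<bar>) \<le> real (card Hf) * \<bar>a\<bar>" by (rule sum_bounded_above)
    then show "\<bar>\<Sum>e\<in>Hf. w e 0\<bar> \<le> real H * \<bar>a\<bar>" unfolding card_Hf by (rule order_trans[OF sum_abs])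
  qed simp
  also have "\<dots> = real H * a\<^sup>2" by (simp add: power2_eq_square)
  finally show U: "(\<Sum>e\<in>Bd. LINT x:{0..len e}|lborel. (u e x)\<^sup>2) \<le> 2 * real H * a\<^sup>2"
    by (simp add: sum_divide_distrib[symmetric])
  have "\<bar>a\<bar> * \<bar>LINT x:{0..len e}|lborel. nl p (u e x) * phi e x\<bar>
      \<le> kappa \<epsilon> * ((LINT x:{0..len e}|lborel. (u e x)\<^sup>2) / 2 + len e * a\<^sup>2 / 2)" if e: "e \<in> Bd" for e
  proof -
    have cphi: "continuous_on {0..len e} (phi e)" using phi_derivs(1) by (blast intro: DERIV_continuous_on)
    have i: "set_integrable lborel {0..len e} (\<lambda>x. nl p (u e x) * phi e x)"
      by (intro borel_integrable_atLeastAtMost' continuous_intros continuous_on_nl p uc[OF e] cphi)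
    have const: "(LINT x:{0..len e}|lborel. c) = len e * c" for c :: real
      using len_pos[OF e] by (subst set_integral_const) auto
    have "\<bar>a\<bar> * \<bar>LINT x:{0..len e}|lborel. nl p (u e x) * phi e x\<bar>
        \<le> \<bar>a\<bar> * (LINT x:{0..len e}|lborel. \<bar>nl p (u e x) * phi e x\<bar>)"
      using integral_abs_bound[of lborel "\<lambda>x. indicator {0..len e} x *\<^sub>R (nl p (u e x) * phi e x)"]
      unfolding set_lebesgue_integral_def by (intro mult_left_mono) (simp_all add: abs_mult)
    also have "\<dots> = (LINT x:{0..len e}|lborel. \<bar>a\<bar> * \<bar>nl p (u e x) * phi e x\<bar>)" by simp
    also have "\<dots> \<le> (LINT x:{0..len e}|lborel. kappa \<epsilon> * ((u e x)\<^sup>2 / 2 + a\<^sup>2 / 2))"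
    proof (rule set_integral_mono)
      show "set_integrable lborel {0..len e} (\<lambda>x. \<bar>a\<bar> * \<bar>nl p (u e x) * phi e x\<bar>)"
        by (intro set_integrable_mult_right set_integrable_abs i)
      show "set_integrable lborel {0..len e} (\<lambda>x. kappa \<epsilon> * ((u e x)\<^sup>2 / 2 + a\<^sup>2 / 2))"
        by (intro borel_integrable_atLeastAtMost' continuous_intros uc[OF e]) simp_all
      fix x assume x: "x \<in> {0..len e}"
      have "\<bar>nl p (u e x)\<bar> * \<bar>phi e x\<bar> \<le> (kappa \<epsilon> * \<bar>u e x\<bar>) * 1"
        unfolding kappa_def
        by (intro mult_mono abs_nl_le p small[OF e x]) (use phi_bounds[OF e x] in auto)
      then have "\<bar>a\<bar> * \<bar>nl p (u e x) * phi e x\<bar> \<le> \<bar>a\<bar> * ((kappa \<epsilon> * \<bar>u e x\<bar>) * 1)"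
        unfolding abs_mult by (intro mult_left_mono) auto
      also have "\<dots> = kappa \<epsilon> * (\<bar>a\<bar> * \<bar>u e x\<bar>)" by simp
      also have "\<dots> \<le> kappa \<epsilon> * ((u e x)\<^sup>2 / 2 + a\<^sup>2 / 2)"
        using sum_squares_bound[of "\<bar>a\<bar>" "\<bar>u e x\<bar>"] by (intro mult_left_mono k0) simp
      finally show "\<bar>a\<bar> * \<bar>nl p (u e x) * phi e x\<bar> \<le> kappa \<epsilon> * ((u e x)\<^sup>2 / 2 + a\<^sup>2 / 2)" .
    qed
    also have "\<dots> = kappa \<epsilon> * (LINT x:{0..len e}|lborel. (u e x)\<^sup>2 / 2 + a\<^sup>2 / 2)" by simp
    also have "(LINT x:{0..len e}|lborel. (u e x)\<^sup>2 / 2 + a\<^sup>2 / 2)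
        = (LINT x:{0..len e}|lborel. (u e x)\<^sup>2 / 2) + (LINT x:{0..len e}|lborel. a\<^sup>2 / 2)"
      by (intro set_integral_add(2) borel_integrable_atLeastAtMost' continuous_intros uc[OF e]) simp_all
    also have "\<dots> = (LINT x:{0..len e}|lborel. (u e x)\<^sup>2) / 2 + len e * a\<^sup>2 / 2"
      by (simp add: const)
    finally show ?thesis .
  qed
  then have "(\<Sum>e\<in>Bd. \<bar>a\<bar> * \<bar>LINT x:{0..len e}|lborel. nl p (u e x) * phi e x\<bar>)
    \<le> (\<Sum>e\<in>Bd. kappa \<epsilon> * ((LINT x:{0..len e}|lborel. (u e x)\<^sup>2) / 2 + len e * a\<^sup>2 / 2))"
    by (rule sum_mono)
  also have "\<dots> = kappa \<epsilon> * ((\<Sum>e\<in>Bd. LINT x:{0..len e}|lborel. (u e x)\<^sup>2) / 2 + (\<Sum>e\<in>Bd. len e) * a\<^sup>2 / 2)"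
    by (simp add: sum_distrib_left[symmetric] sum.distrib sum_divide_distrib[symmetric] sum_distrib_right[symmetric])
  also have "\<dots> \<le> kappa \<epsilon> * (2 * real H * a\<^sup>2 / 2 + (\<Sum>e\<in>Bd. len e) * a\<^sup>2 / 2)"
    using U by (intro mult_left_mono k0) simp
  also have "\<dots> = kappa \<epsilon> * (real H + (\<Sum>e\<in>Bd. len e) / 2) * a\<^sup>2" by (simp add: algebra_simps)
  finally have N: "\<bar>a\<bar> * (\<Sum>e\<in>Bd. \<bar>LINT x:{0..len e}|lborel. nl p (u e x) * phi e x\<bar>)
      \<le> kappa \<epsilon> * (real H + (\<Sum>e\<in>Bd. len e) / 2) * a\<^sup>2"
    by (simp only: sum_distrib_left)
  have "a * (\<Sum>e\<in>Bd. tau e) - (\<Sum>e\<in>Hf. w e 0)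
      = (\<Sum>e\<in>Bd. LINT x:{0..len e}|lborel. nl p (u e x) * phi e x)"
    using test_phi[OF u] unfolding a_def by linarith
  then have "\<bar>a\<bar> * \<bar>a * (\<Sum>e\<in>Bd. tau e) - (\<Sum>e\<in>Hf. w e 0)\<bar>
      \<le> \<bar>a\<bar> * (\<Sum>e\<in>Bd. \<bar>LINT x:{0..len e}|lborel. nl p (u e x) * phi e x\<bar>)"
    by (auto intro!: mult_left_mono sum_abs)
  then show "\<bar>a\<bar> * \<bar>a * (\<Sum>e\<in>Bd. tau e) - (\<Sum>e\<in>Hf. w e 0)\<bar>
      \<le> kappa \<epsilon> * (real H + (\<Sum>e\<in>Bd. len e) / 2) * a\<^sup>2"
    using N by (rule order_trans)
qed


text \<open>On a half-line |w| <= |u|, so a zero vertex value makes both initial data vanish;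
  stability against the zero solution then kills u on the whole half-line.\<close>

lemma not_nontrivial_of_zero:
  assumes u: "regular_sol u w" and 0: "u (Half 0) 0 = 0"
    and Bd: "\<And>e x. e \<in> Bd \<Longrightarrow> x \<in> {0..len e} \<Longrightarrow> u e x = 0"
  shows "\<not> nontrivial u"
proof -
  have "u e x = 0" if e: "e \<in> E" and x: "x \<in> D e" for e x
  proof (cases "e \<in> Hf")
    case True
    have x0: "0 \<le> x" using x D_Hf[OF True] by simp
    have u0: "u e 0 = 0" using vertex_value[OF regular_solD(1)[OF u] e] 0 by simp
    then have w0: "w e 0 = 0" using half_line_bounds(2)[OF u True, of 0] by simp
    have s: "edge_sol p {0..x} (u e) (w e)"
      by (rule edge_sol_subset[OF regular_solD(3)[OF u e] edge_dom_subset[OF edge_dom_D[OF e] x]])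
    have "0 \<le> M0" by (simp add: M0_def)
    then have "(u e x - 0)\<^sup>2 + (w e x - 0)\<^sup>2
      \<le> exp ((2 + (p - 1) * M0 powr (p - 2)) * x) * ((u e 0 - 0)\<^sup>2 + (w e 0 - 0)\<^sup>2)"
      by (intro edge_sol_stable[OF p s edge_sol_zero]) (use half_line_bounds(3)[OF u True] x0 in auto)
    then show ?thesis by (simp add: u0 w0 sum_power2_le_zero_iff)
  next
    case False
    then have "e \<in> Bd" using e by (simp add: E_eq)
    then show ?thesis using Bd x D_Bd by simp
  qed
  then show ?thesis by (simp add: nontrivial_def)
qed

lemma zero_of_square_integral:
  fixes f :: "real \<Rightarrow> real"
  assumes "0 < l" "continuous_on {0..l} f" "(LINT x:{0..l}|lborel. (f x)\<^sup>2) \<le> 0" "x \<in> {0..l}"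
  shows "f x = 0"
proof -
  have c: "continuous_on {0..l} (\<lambda>x. (f x)\<^sup>2)" by (intro continuous_intros assms)
  have "(LINT x:{0..l}|lborel. (f x)\<^sup>2) = integral {0..l} (\<lambda>x. (f x)\<^sup>2)"
    by (rule set_borel_integral_eq_integral(2)[OF borel_integrable_atLeastAtMost'[OF c]])
  moreover have "0 \<le> integral {0..l} (\<lambda>x. (f x)\<^sup>2)"
    by (rule Henstock_Kurzweil_Integration.integral_nonneg[OF integrable_continuous_real[OF c]]) simp
  ultimately have "integral {0..l} (\<lambda>x. (f x)\<^sup>2) = 0" using assms(3) by simp
  then have "\<forall>x\<in>{0..l}. (f x)\<^sup>2 = 0"
    by (subst (asm) integral_eq_0_iff[OF c assms(1)]) simp_all
  then show ?thesis using assms(4) by simp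
qed

text \<open>For a small solution with vertex value a nonzero, the sum of the ratios
  \<open>w e 0 / a\<close> is close to some H - 2m by the energy identity and close to \<tau> by
  \<open>small_solution\<close>. The gap between these two numbers forbids both.\<close>

lemma nontrivial_lower_bound:
  assumes nonres: "\<And>m. m \<le> H \<Longrightarrow> (\<Sum>e\<in>Bd. tau e) \<noteq> real H - 2 * real m"
  shows "\<exists>\<epsilon>>0. \<forall>u w. regular_sol u w \<longrightarrow> \<bar>u (Half 0) 0\<bar> \<le> \<epsilon> \<longrightarrow>
    (\<forall>e\<in>Bd. \<forall>x\<in>{0..len e}. \<bar>u e x\<bar> \<le> \<epsilon>) \<longrightarrow> \<not> nontrivial u"
proof -
  define \<tau> where "\<tau> = (\<Sum>e\<in>Bd. tau e)"
  \<comment> \<open>The distance from \<tau> to the finite set of resonant values, positive by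
    assumption.\<close>
  define \<delta> where "\<delta> = Min ((\<lambda>m. \<bar>\<tau> - (real H - 2 * real m)\<bar>) ` {..H})"
  have \<delta>0: "0 < \<delta>" unfolding \<delta>_def \<tau>_def using nonres by (subst Min_gr_iff) auto
  have \<delta>_le: "\<delta> \<le> \<bar>\<tau> - (real H - 2 * real m)\<bar>" if "m \<le> H" for m
    unfolding \<delta>_def using that by (intro Min_le) auto
  define C where "C = real H + (\<Sum>e\<in>Bd. len e) / 2"
  have C0: "0 \<le> C" unfolding C_def using len_pos by (auto intro!: add_nonneg_nonneg sum_nonneg simp: less_imp_le)
  \<comment> \<open>The two errors are k C from testing with \<open>phi\<close> and H k from
    rounding the slopes; together they must stay below \<delta>. The bound 1/2 is what the
    absorption in \<open>small_solution\<close> needs.\<close>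
  define k where "k = min (1 / 2) (\<delta> / (2 * (C + real H + 1)))"
  have k0: "0 < k" unfolding k_def using \<delta>0 C0 by simp
  have k2: "k \<le> 1 / 2" unfolding k_def by (rule min.cobounded1)
  have kC: "k * (C + real H) < \<delta>"
  proof -
    have "k * (C + real H) \<le> \<delta> / (2 * (C + real H + 1)) * (C + real H)"
      using C0 by (intro mult_right_mono) (auto simp: k_def)
    also have "\<dots> < \<delta>"
    proof -
      have "\<delta> * (C + real H) < \<delta> * (2 * (C + real H + 1))"
        using \<delta>0 C0 by (intro mult_strict_left_mono) auto
      then show ?thesis using C0 by (simp add: divide_less_eq)
    qed
    finally show ?thesis .
  qed
  \<comment> \<open>The inverse of \<open>kappa\<close>, so that smallness \<epsilon> of the
    solution yields exactly the factor k.\<close>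
  define \<epsilon> where "\<epsilon> = k powr (1 / (p - 2))"
  have \<epsilon>0: "0 < \<epsilon>" using k0 by (simp add: \<epsilon>_def)
  have kap: "kappa \<epsilon> = k" unfolding kappa_def \<epsilon>_def using k0 p by (simp add: powr_powr)
  show ?thesis
  proof (intro exI[of _ \<epsilon>] conjI \<epsilon>0 allI impI)
    fix u w assume u: "regular_sol u w" and a: "\<bar>u (Half 0) 0\<bar> \<le> \<epsilon>"
      and small: "\<forall>e\<in>Bd. \<forall>x\<in>{0..len e}. \<bar>u e x\<bar> \<le> \<epsilon>"
    define a where "a = u (Half 0) 0"
    have U: "(\<Sum>e\<in>Bd. LINT x:{0..len e}|lborel. (u e x)\<^sup>2) \<le> 2 * real H * a\<^sup>2"
      and N: "\<bar>a\<bar> * \<bar>a * \<tau> - (\<Sum>e\<in>Hf. w e 0)\<bar> \<le> k * C * a\<^sup>2"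
      using small_solution[OF u, of \<epsilon>] small k2 unfolding a_def \<tau>_def C_def kap by simp_all
    show "\<not> nontrivial u"
    proof (cases "a = 0")
      \<comment> \<open>No ratio can be formed here, but the first estimate already makes u vanish
        on the bounded edges.\<close>
      case True
      show ?thesis
      proof (rule not_nontrivial_of_zero[OF u])
        show "u (Half 0) 0 = 0" using True a_def by simp
        fix e x assume e: "e \<in> Bd" and x: "x \<in> {0..len e}"
        have "(LINT x:{0..len e}|lborel. (u e x)\<^sup>2) \<le> (\<Sum>e\<in>Bd. LINT x:{0..len e}|lborel. (u e x)\<^sup>2)"
          using e by (intro member_le_sum) (auto simp: set_lebesgue_integral_def)
        then have "(LINT x:{0..len e}|lborel. (u e x)\<^sup>2) \<le> 0" using U True by simp
        moreover have "continuous_on {0..len e} (u e)"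
          using H1_continuous_on[OF regular_solD(1)[OF u], of e] e D_Bd[OF e] by (simp add: E_eq)
        ultimately show "u e x = 0" by (intro zero_of_square_integral[OF len_pos[OF e] _ _ x])
      qed
    next
      case False
      then have a2: "0 < a\<^sup>2" by simp
      \<comment> \<open>By the energy identity t^2 = 1 - (2/p)|a|^(p-2), and |a| <= \<epsilon> puts
        this between 1 - k and 1.\<close>
      define t where "t e = w e 0 / a" for e
      have t: "(t e)\<^sup>2 \<le> 1 \<and> 1 - k \<le> (t e)\<^sup>2" if e: "e \<in> Hf" for e
      proof -
        have "u e 0 = a" unfolding a_def
          by (rule vertex_value[OF regular_solD(1)[OF u]]) (use e in \<open>simp add: E_eq\<close>)
        then have w: "(w e 0)\<^sup>2 = a\<^sup>2 - 2 / p * \<bar>a\<bar> powr p"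
          using half_line_bounds(1)[OF u e, of 0] by simp
        have "2 / p * \<bar>a\<bar> powr p \<le> 1 * \<bar>a\<bar> powr p" using p by (intro mult_right_mono) auto
        also have "\<dots> \<le> k * a\<^sup>2" using abs_powr_le[OF p a] unfolding a_def kap[symmetric] kappa_def by simp
        finally have 1: "2 / p * \<bar>a\<bar> powr p \<le> k * a\<^sup>2" .
        have 2: "0 \<le> 2 / p * \<bar>a\<bar> powr p" using p by simp
        have t2: "(t e)\<^sup>2 * a\<^sup>2 = (w e 0)\<^sup>2" using False by (simp add: t_def power_divide)
        have "(t e)\<^sup>2 * a\<^sup>2 \<le> 1 * a\<^sup>2" using w 2 t2 by linarith
        moreover have "(1 - k) * a\<^sup>2 \<le> (t e)\<^sup>2 * a\<^sup>2" unfolding t2 w left_diff_distrib using 1 by simp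
        ultimately show ?thesis using a2 by (metis mult_right_le_imp_le)
      qed
      obtain m where m: "m \<le> H" "\<bar>(\<Sum>e\<in>Hf. t e) - (real H - 2 * real m)\<bar> \<le> real H * k"
        using sum_near_integer[of Hf t k] t by (auto simp: card_Hf)
      have "a * \<tau> - (\<Sum>e\<in>Hf. w e 0) = a * (\<tau> - (\<Sum>e\<in>Hf. t e))"
        using False by (simp add: t_def right_diff_distrib sum_divide_distrib[symmetric])
      then have "\<bar>\<tau> - (\<Sum>e\<in>Hf. t e)\<bar> * a\<^sup>2 \<le> k * C * a\<^sup>2"
        using N by (simp add: abs_mult power2_eq_square mult_ac)
      then have "\<bar>\<tau> - (\<Sum>e\<in>Hf. t e)\<bar> \<le> k * C" by (rule mult_right_le_imp_le[OF _ a2])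
      then have "\<bar>\<tau> - (real H - 2 * real m)\<bar> \<le> k * C + real H * k" using m(2) by linarith
      also have "\<dots> = k * (C + real H)" by (simp add: algebra_simps)
      also have "\<dots> < \<delta>" by (rule kC)
      finally show ?thesis using \<delta>_le[OF m(1)] by simp
    qed
  qed
qed

section \<open>Compactness of bounded families of bound states\<close>

text \<open>Compactness needs bounded initial data, including the slope. The vertex value is at most
  \<open>M0\<close>, the energy bounds the oscillation, the mean value theorem gives a point with
  controlled slope, and the equation transports this control back to the vertex.\<close>

lemma bounded_edge_bounds:
  assumes e: "e \<in> Bd"
  shows "\<exists>M. \<forall>u w. regular_sol u w \<longrightarrow> total_energy u w \<le> B \<longrightarrow>
    (\<forall>x\<in>D e. \<bar>u e x\<bar> \<le> M) \<and> \<bar>w e 0\<bar> \<le> M"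
proof -
  define l where "l = len e"
  have l: "0 < l" unfolding l_def by (rule len_pos[OF e])
  have D: "D e = {0..l}" unfolding l_def by (rule D_Bd[OF e])
  have eE: "e \<in> E" using e by (simp add: E_eq)
  \<comment> \<open>\<open>M1\<close> bounds |u|, because |w| <= 1/2 + (w^2 + u^2)/2 is integrated
    over an edge of length l with energy at most B. \<open>K\<close> bounds |u''|. The initial slope
    is at most the mean slope 2 M1 / l plus its variation K l.\<close>
  define M1 where "M1 = M0 + (l + B) / 2"
  define K where "K = M1 + M1 powr (p - 2) * M1"
  define M where "M = max M1 (2 * M1 / l + K * l)"
  have "(\<forall>x\<in>D e. \<bar>u e x\<bar> \<le> M) \<and> \<bar>w e 0\<bar> \<le> M" if u: "regular_sol u w" and B: "total_energy u w \<le> B" for u w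
  proof -
    have s: "edge_sol p {0..l} (u e) (w e)" using regular_solD(3)[OF u eE] D by simp
    note c = edge_sol_continuous[OF s]
    have a: "\<bar>u e 0\<bar> \<le> M0"
    proof -
      have "u e 0 = u (Half 0) 0" by (rule vertex_value[OF regular_solD(1)[OF u] eE])
      then show ?thesis using half_line_bounds(3)[OF u Half_0(1), of 0] by simp
    qed
    have ux: "\<bar>u e x\<bar> \<le> M1" if x: "x \<in> {0..l}" for x
    proof -
      have ux: "u e x = u e 0 + (LINT t:{0..x}|lborel. w e t)" and wi: "set_integrable lborel {0..x} (w e)"
        using H1_edge[OF regular_solD(1)[OF u] eE] x D unfolding H1_edge_def by blast+
      have i: "set_integrable lborel {0..l} (\<lambda>t. 1 / 2 + ((w e t)\<^sup>2 + (u e t)\<^sup>2) / 2)"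
        by (intro borel_integrable_atLeastAtMost' continuous_intros c) simp
      have "\<bar>LINT t:{0..x}|lborel. w e t\<bar> \<le> (LINT t|lborel. \<bar>indicator {0..x} t *\<^sub>R w e t\<bar>)"
        unfolding set_lebesgue_integral_def by (rule integral_abs_bound)
      also have "\<dots> \<le> (LINT t:{0..l}|lborel. 1 / 2 + ((w e t)\<^sup>2 + (u e t)\<^sup>2) / 2)"
        unfolding set_lebesgue_integral_def
      proof (rule integral_mono)
        show "integrable lborel (\<lambda>t. \<bar>indicator {0..x} t *\<^sub>R w e t\<bar>)"
          using wi unfolding set_integrable_def by (rule integrable_abs)
        show "integrable lborel (\<lambda>t. indicator {0..l} t *\<^sub>R (1 / 2 + ((w e t)\<^sup>2 + (u e t)\<^sup>2) / 2))"
          using i unfolding set_integrable_def .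
        fix t :: real
        have "\<bar>w e t\<bar> \<le> 1 / 2 + ((w e t)\<^sup>2 + (u e t)\<^sup>2) / 2"
        proof -
          have "2 * \<bar>w e t\<bar> \<le> (w e t)\<^sup>2 + 1" using sum_squares_bound[of "\<bar>w e t\<bar>" 1] by simp
          then have "2 * \<bar>w e t\<bar> \<le> (w e t)\<^sup>2 + 1 + (u e t)\<^sup>2"
            by (rule add_increasing2[OF zero_le_power2])
          then show ?thesis by (simp add: field_simps)
        qed
        moreover have "0 \<le> 1 / 2 + ((w e t)\<^sup>2 + (u e t)\<^sup>2) / 2" by simp
        ultimately show "\<bar>indicator {0..x} t *\<^sub>R w e t\<bar>
          \<le> indicator {0..l} t *\<^sub>R (1 / 2 + ((w e t)\<^sup>2 + (u e t)\<^sup>2) / 2)"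
          using x by (auto simp: indicator_def)
      qed
      also have "\<dots> = (LINT t:{0..l}|lborel. 1 / 2) + (LINT t:{0..l}|lborel. ((w e t)\<^sup>2 + (u e t)\<^sup>2) / 2)"
        by (intro set_integral_add(2) borel_integrable_atLeastAtMost' continuous_intros c) simp_all
      also have "(LINT t:{0..l}|lborel. 1 / 2) = l / 2"
        using l by (subst set_integral_const) auto
      also have "(LINT t:{0..l}|lborel. ((w e t)\<^sup>2 + (u e t)\<^sup>2) / 2) = energy u w e / 2"
        by (simp add: energy_def D)
      also have "energy u w e \<le> B" using energy_le_total[OF eE] B by (rule order_trans)
      finally have "\<bar>LINT t:{0..x}|lborel. w e t\<bar> \<le> (l + B) / 2" by simp
      then show ?thesis using ux a unfolding M1_def by linarith
    qed
    have M10: "0 \<le> M1" using ux[of 0] l by auto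
    have F: "\<bar>u e x - nl p (u e x)\<bar> \<le> K" if x: "x \<in> {0..l}" for x
    proof -
      have "\<bar>nl p (u e x)\<bar> \<le> M1 powr (p - 2) * \<bar>u e x\<bar>" by (rule abs_nl_le[OF p ux[OF x]])
      also have "\<dots> \<le> M1 powr (p - 2) * M1" using ux[OF x] by (intro mult_left_mono) auto
      finally show ?thesis using ux[OF x] unfolding K_def by linarith
    qed
    have K0: "0 \<le> K" using F[of 0] l by auto
    have "\<exists>\<xi>\<in>{0<..<l}. u e l - u e 0 = w e \<xi> * (l - 0)"
      by (rule mvt_simple[OF l]) (use s in \<open>auto simp: edge_sol_def has_field_derivative_def\<close>)
    then obtain \<xi> where \<xi>: "0 < \<xi>" "\<xi> < l" "u e l - u e 0 = w e \<xi> * l" by auto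
    have "\<bar>w e \<xi>\<bar> * l = \<bar>u e l - u e 0\<bar>" using \<xi>(3) l by (simp add: abs_mult)
    also have "\<dots> \<le> 2 * M1" using ux[of l] ux[of 0] l by auto
    finally have w\<xi>: "\<bar>w e \<xi>\<bar> \<le> 2 * M1 / l" using l by (simp add: field_simps)
    have "norm (w e \<xi> - w e 0) \<le> K * norm (\<xi> - 0)"
    proof (rule field_differentiable_bound[where S="{0..l}"])
      fix x assume x: "x \<in> {0..l}"
      show "(w e has_field_derivative u e x - nl p (u e x)) (at x within {0..l})"
        using s x by (simp add: edge_sol_def)
      show "norm (u e x - nl p (u e x)) \<le> K" using F[OF x] by simp
    qed (use \<xi> l in auto)
    also have "\<dots> \<le> K * l" using \<xi> K0 by (intro mult_left_mono) auto
    finally have "\<bar>w e 0\<bar> \<le> 2 * M1 / l + K * l" using w\<xi> by simp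
    then show ?thesis using ux unfolding D M_def by (auto intro: order_trans[OF _ max.cobounded1])
  qed
  then show ?thesis by blast
qed

lemma uniform_bounds:
  "\<exists>M. \<forall>u w. regular_sol u w \<longrightarrow> total_energy u w \<le> B \<longrightarrow>
    (\<forall>e\<in>E. (\<forall>x\<in>D e. \<bar>u e x\<bar> \<le> M) \<and> \<bar>w e 0\<bar> \<le> M)"
proof -
  have "\<forall>e\<in>E. \<exists>M. \<forall>u w. regular_sol u w \<longrightarrow> total_energy u w \<le> B \<longrightarrow>
    (\<forall>x\<in>D e. \<bar>u e x\<bar> \<le> M) \<and> \<bar>w e 0\<bar> \<le> M"
  proof
    fix e assume e: "e \<in> E"
    show "\<exists>M. \<forall>u w. regular_sol u w \<longrightarrow> total_energy u w \<le> B \<longrightarrow>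
      (\<forall>x\<in>D e. \<bar>u e x\<bar> \<le> M) \<and> \<bar>w e 0\<bar> \<le> M"
    proof (cases "e \<in> Hf")
      case True
      show ?thesis
      proof (intro exI[of _ M0] allI impI conjI ballI)
        fix u w assume u: "regular_sol u w"
        show "\<bar>u e x\<bar> \<le> M0" if "x \<in> D e" for x
          using half_line_bounds(3)[OF u True, of x] that D_Hf[OF True] by simp
        show "\<bar>w e 0\<bar> \<le> M0"
          using half_line_bounds(2,3)[OF u True, of 0] by linarith
      qed
    next
      case False
      then show ?thesis using bounded_edge_bounds e by (simp add: E_eq)
    qed
  qed
  then have "\<exists>M. \<forall>e\<in>E. \<forall>u w. regular_sol u w \<longrightarrow> total_energy u w \<le> B \<longrightarrow>
    (\<forall>x\<in>D e. \<bar>u e x\<bar> \<le> M e) \<and> \<bar>w e 0\<bar> \<le> M e" by (rule bchoice)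
  then obtain M where M: "\<forall>e\<in>E. \<forall>u w. regular_sol u w \<longrightarrow> total_energy u w \<le> B \<longrightarrow>
    (\<forall>x\<in>D e. \<bar>u e x\<bar> \<le> M e) \<and> \<bar>w e 0\<bar> \<le> M e" ..
  have le: "M e \<le> (\<Sum>e\<in>E. \<bar>M e\<bar>)" if "e \<in> E" for e
    using member_le_sum[of e E "\<lambda>e. \<bar>M e\<bar>"] that by simp
  show ?thesis
  proof (intro exI[of _ "\<Sum>e\<in>E. \<bar>M e\<bar>"] allI impI ballI)
    fix u w e assume "regular_sol u w" "total_energy u w \<le> B" and e: "e \<in> E"
    then have "(\<forall>x\<in>D e. \<bar>u e x\<bar> \<le> M e) \<and> \<bar>w e 0\<bar> \<le> M e" using M by simp
    then show "(\<forall>x\<in>D e. \<bar>u e x\<bar> \<le> (\<Sum>e\<in>E. \<bar>M e\<bar>)) \<and> \<bar>w e 0\<bar> \<le> (\<Sum>e\<in>E. \<bar>M e\<bar>)"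
      using order_trans[OF _ le[OF e]] by simp
  qed
qed

section \<open>The resonant values\<close>

lemma tau_nonneg: "e \<in> Bd \<Longrightarrow> 0 \<le> tau e"
  using lp_pos ll_pos by (auto simp: Bd_def less_imp_le)

lemma sum_tau:
  "(\<Sum>e\<in>Bd. tau e) = (\<Sum>i<length lp. tanh (lp ! i)) + 2 * (\<Sum>i<length ll. tanh (ll ! i / 2))"
proof -
  have "(\<Sum>e\<in>Bd. tau e) = (\<Sum>e\<in>Pend ` {..<length lp}. tau e) + (\<Sum>e\<in>Loop ` {..<length ll}. tau e)"
    unfolding Bd_def by (rule sum.union_disjoint) auto
  then show ?thesis by (simp add: sum.reindex inj_on_def sum_distrib_left)
qed

text \<open>The slopes may have any number m of negative signs, but beyond H/2 the value H - 2m is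
  negative and cannot equal a sum of nonnegative terms.\<close>

lemma nonresonant:
  assumes "\<And>n. n \<le> H div 2 \<Longrightarrow>
    (\<Sum>i<length lp. tanh (lp ! i)) + 2 * (\<Sum>i<length ll. tanh (ll ! i / 2)) \<noteq> real H - 2 * real n"
  shows "(\<Sum>e\<in>Bd. tau e) \<noteq> real H - 2 * real m"
proof (cases "m \<le> H div 2")
  case True
  then show ?thesis using assms by (simp add: sum_tau)
next
  case False
  then have "H < 2 * m" by linarith
  then have "real H - 2 * real m < 0" by linarith
  moreover have "0 \<le> (\<Sum>e\<in>Bd. tau e)" by (intro sum_nonneg tau_nonneg)
  ultimately show ?thesis by linarith
qed

end

lemma finite_convergent_subseq:
  fixes f :: "nat \<Rightarrow> 'a \<Rightarrow> real"
  assumes "finite S" "\<And>n e. e \<in> S \<Longrightarrow> \<bar>f n e\<bar> \<le> M"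
  shows "\<exists>r. strict_mono r \<and> (\<forall>e\<in>S. convergent (\<lambda>n. f (r n) e))"
  using assms
proof (induction S)
  case empty
  show ?case by (intro exI[of _ id]) (simp add: strict_mono_def)
next
  case (insert x S)
  then obtain r where r: "strict_mono r" "\<forall>e\<in>S. convergent (\<lambda>n. f (r n) e)" by auto
  have "bounded (range (\<lambda>n. f (r n) x))"
    unfolding bounded_iff using insert.prems[of x] by auto
  then obtain l s where s: "strict_mono s" "((\<lambda>n. f (r n) x) \<circ> s) \<longlonglongrightarrow> l"
    using bounded_imp_convergent_subsequence by blast
  show ?case
  proof (intro exI[of _ "r \<circ> s"] conjI ballI)
    show "strict_mono (r \<circ> s)" by (rule strict_mono_o[OF r(1) s(1)])
    fix e assume "e \<in> insert x S"
    then consider "e = x" | "e \<in> S" by blast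
    then show "convergent (\<lambda>n. f ((r \<circ> s) n) e)"
    proof cases
      case 1
      then show ?thesis using s(2) by (auto simp: convergent_def o_def)
    next
      case 2
      then show ?thesis using convergent_subseq_convergent[OF _ s(1)] r(2) by (force simp: o_def)
    qed
  qed
qed

text \<open>The form in which the stability estimate is applied: \<open>g\<close> and
  \<open>h\<close> are the values and slopes at the vertex, \<open>f\<close> the value or slope
  further along the edge.\<close>

lemma Cauchy_of_square_bound:
  fixes f g h :: "nat \<Rightarrow> real"
  assumes g: "Cauchy g" and h: "Cauchy h" and K: "0 \<le> K"
    and le: "\<And>m n. (f m - f n)\<^sup>2 \<le> K * ((g m - g n)\<^sup>2 + (h m - h n)\<^sup>2)"
  shows "Cauchy f"
proof (rule CauchyI)
  fix r :: real assume r: "0 < r"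
  \<comment> \<open>Then 2 K s^2 <= 2 (K + 1)^2 s^2 = r^2 / 2, strictly below r^2.\<close>
  define s where "s = r / (2 * (K + 1))"
  have s: "0 < s" unfolding s_def using r K by simp
  obtain N1 where N1: "\<And>m n. m \<ge> N1 \<Longrightarrow> n \<ge> N1 \<Longrightarrow> norm (g m - g n) < s"
    using CauchyD[OF g s] by auto
  obtain N2 where N2: "\<And>m n. m \<ge> N2 \<Longrightarrow> n \<ge> N2 \<Longrightarrow> norm (h m - h n) < s"
    using CauchyD[OF h s] by auto
  show "\<exists>N. \<forall>m\<ge>N. \<forall>n\<ge>N. norm (f m - f n) < r"
  proof (intro exI[of _ "max N1 N2"] allI impI)
    fix m n assume mn: "max N1 N2 \<le> m" "max N1 N2 \<le> n"
    have "(g m - g n)\<^sup>2 \<le> s\<^sup>2" "(h m - h n)\<^sup>2 \<le> s\<^sup>2"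
      using N1[of m n] N2[of m n] mn s by (simp_all add: abs_le_square_iff[symmetric])
    then have "(f m - f n)\<^sup>2 \<le> K * (s\<^sup>2 + s\<^sup>2)"
      by (intro order_trans[OF le] mult_left_mono add_mono K)
    also have "\<dots> \<le> (2 * (K + 1) * s)\<^sup>2 / 2"
    proof -
      have "K * 1 \<le> (K + 1) * (K + 1)" using K by (intro mult_mono) auto
      then have "K * (2 * s\<^sup>2) \<le> (K + 1) * (K + 1) * (2 * s\<^sup>2)" by (intro mult_right_mono) auto
      then show ?thesis by (simp add: power2_eq_square algebra_simps)
    qed
    also have "2 * (K + 1) * s = r" unfolding s_def using K by simp
    also have "r\<^sup>2 / 2 < r\<^sup>2" using r by simp
    finally have "\<bar>f m - f n\<bar> < \<bar>r\<bar>" by (simp add: abs_le_square_iff linorder_not_le[symmetric])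
    then show "norm (f m - f n) < r" using r by simp
  qed
qed

lemma weak_L2_convergence_on:
  assumes lim: "\<And>x. x \<in> I \<Longrightarrow> (\<lambda>n. G n x) \<longlonglongrightarrow> g x"
    and G: "\<And>n. L2_on I (G n)" and B: "\<And>n. (LINT x:I|lborel. (G n x)\<^sup>2) \<le> B"
  shows "L2_on I g" "L2_on I h \<Longrightarrow> (\<lambda>n. LINT x:I|lborel. G n x * h x) \<longlonglongrightarrow> (LINT x:I|lborel. g x * h x)"
proof -
  let ?i = "\<lambda>f x. indicator I x * f x :: real"
  have lim': "(\<lambda>n. ?i (G n) x) \<longlonglongrightarrow> ?i g x" for x
    using lim[of x] by (cases "x \<in> I") auto
  have Gm: "?i (G n) \<in> borel_measurable lborel" and Gi: "integrable lborel (\<lambda>x. (?i (G n) x)\<^sup>2)" for n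
    using G[of n] by (simp_all add: L2_on_iff)
  have sq: "(?i f x)\<^sup>2 = indicator I x *\<^sub>R (f x)\<^sup>2" for f and x :: real
    by (simp add: indicator_def)
  have GB: "(LINT x|lborel. (?i (G n) x)\<^sup>2) \<le> B" for n
    using B[of n] unfolding sq set_lebesgue_integral_def .
  note lims = lim' Gm Gi GB
  show "L2_on I g"
    unfolding L2_on_iff
    using integral_square_tendsto_bounded(1,2)[where G="\<lambda>n. ?i (G n)" and g="?i g", OF lims] by simp
  assume h: "L2_on I h"
  have prod: "?i f x * ?i h x = indicator I x *\<^sub>R (f x * h x)" for f and x :: real
    by (simp add: indicator_def)
  have "(\<lambda>n. LINT x|lborel. ?i (G n) x * ?i h x) \<longlonglongrightarrow> (LINT x|lborel. ?i g x * ?i h x)"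
    by (rule weak_L2_convergence[OF lims]) (use h in \<open>simp_all add: L2_on_iff\<close>)
  then show "(\<lambda>n. LINT x:I|lborel. G n x * h x) \<longlonglongrightarrow> (LINT x:I|lborel. g x * h x)"
    unfolding prod set_lebesgue_integral_def .
qed

context single_knot
begin

text \<open>The limit \<open>w\<close> of the derivatives is defined pointwise and only afterwards
  recognized as a weak derivative of the limit \<open>u\<close>. All passages to the limit under
  integrals are weak L^2 limits, so the unbounded half-lines are treated like the other
  edges.\<close>

lemma limit_solution:
  assumes U: "\<And>n. regular_sol (U n) (W n)" and B: "\<And>n. total_energy (U n) (W n) \<le> B"
    and nontriv: "\<And>n. nontrivial (U n)"
    and conv: "\<And>e. e \<in> E \<Longrightarrow> convergent (\<lambda>n. U n e 0)" "\<And>e. e \<in> E \<Longrightarrow> convergent (\<lambda>n. W n e 0)"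
    and lim: "(\<lambda>n. total_energy (U n) (W n)) \<longlonglongrightarrow> L"
    and nonres: "\<And>m. m \<le> H \<Longrightarrow> (\<Sum>e\<in>Bd. tau e) \<noteq> real H - 2 * real m"
  shows "\<exists>u w. weak_sol u w \<and> nontrivial u \<and> total_energy u w \<le> L"
proof -
  obtain M where M: "\<And>n e x. e \<in> E \<Longrightarrow> x \<in> D e \<Longrightarrow> \<bar>U n e x\<bar> \<le> M"
    using uniform_bounds[of B] U B by blast
  define C where "C = 2 + (p - 1) * M powr (p - 2)"
  have C0: "0 \<le> C" unfolding C_def using p by simp
  have stab: "(U m e x - U n e x)\<^sup>2 + (W m e x - W n e x)\<^sup>2
      \<le> exp (C * x) * ((U m e 0 - U n e 0)\<^sup>2 + (W m e 0 - W n e 0)\<^sup>2)" if e: "e \<in> E" and x: "x \<in> D e" for e x m n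
  proof -
    have sub: "{0..x} \<subseteq> D e" by (rule edge_dom_subset[OF edge_dom_D[OF e] x])
    have s: "edge_sol p {0..x} (U n e) (W n e)" for n
      by (rule edge_sol_subset[OF regular_solD(3)[OF U e] sub])
    have "0 \<le> x" by (rule edge_dom_nonneg[OF edge_dom_D[OF e] x])
    then show ?thesis unfolding C_def
      by (intro edge_sol_stable[OF p s s] M[OF e]) (use sub in auto)
  qed
  have "convergent (\<lambda>n. U n e x)" "convergent (\<lambda>n. W n e x)" if e: "e \<in> E" and x: "x \<in> D e" for e x
  proof -
    have c: "Cauchy (\<lambda>n. U n e 0)" "Cauchy (\<lambda>n. W n e 0)"
      using conv[OF e] by (auto intro: convergent_Cauchy)
    have "Cauchy (\<lambda>n. U n e x)"
      by (rule Cauchy_of_square_bound[OF c, of "exp (C * x)"])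
        (auto intro: order_trans[OF _ stab[OF e x]])
    then show "convergent (\<lambda>n. U n e x)" by (rule Cauchy_convergent)
    have "Cauchy (\<lambda>n. W n e x)"
      by (rule Cauchy_of_square_bound[OF c, of "exp (C * x)"])
        (auto intro: order_trans[OF _ stab[OF e x]])
    then show "convergent (\<lambda>n. W n e x)" by (rule Cauchy_convergent)
  qed
  note pointwise = this
  define u where "u e x = lim (\<lambda>n. U n e x)" for e x
  define w where "w e x = lim (\<lambda>n. W n e x)" for e x
  have ulim: "(\<lambda>n. U n e x) \<longlonglongrightarrow> u e x" and wlim: "(\<lambda>n. W n e x) \<longlonglongrightarrow> w e x"
    if e: "e \<in> E" and x: "x \<in> D e" for e x
    using pointwise[OF e x] unfolding u_def w_def by (simp_all add: convergent_LIMSEQ_iff)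
  have uM: "\<bar>u e x\<bar> \<le> M" if e: "e \<in> E" and x: "x \<in> D e" for e x
    by (rule LIMSEQ_le_const2[OF tendsto_rabs[OF ulim[OF e x]]]) (use M[OF e x] in auto)
  have L2: "L2_on (D e) (U n e)" "L2_on (D e) (W n e)" "L2_on (D e) (\<lambda>x. nl p (U n e x))"
    if e: "e \<in> E" for e n
    using L2_regular_sol[OF U e] by auto
  have sqi: "set_integrable lborel (D e) (\<lambda>x. (U n e x)\<^sup>2)" "set_integrable lborel (D e) (\<lambda>x. (W n e x)\<^sup>2)"
    if e: "e \<in> E" for e n
    using L2[OF e] by (auto simp: L2_on_def)
  have en: "energy (U n) (W n) e = (LINT x:D e|lborel. (W n e x)\<^sup>2) + (LINT x:D e|lborel. (U n e x)\<^sup>2)"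
    if e: "e \<in> E" for e n
    unfolding energy_def by (rule set_integral_add(2)[OF sqi(2)[OF e] sqi(1)[OF e]])
  have nn: "0 \<le> (LINT x:I|lborel. (f x)\<^sup>2)" for I :: "real set" and f :: "real \<Rightarrow> real"
    unfolding set_lebesgue_integral_def by (intro integral_nonneg_AE AE_I2) simp
  have UB: "(LINT x:D e|lborel. (U n e x)\<^sup>2) \<le> B" and WB: "(LINT x:D e|lborel. (W n e x)\<^sup>2) \<le> B"
    if e: "e \<in> E" for e n
    using energy_le_total[OF e, of "U n" "W n"] B[of n] en[OF e, of n] nn[of "D e" "U n e"] nn[of "D e" "W n e"]
    by linarith+
  \<comment> \<open>The nonlinear terms are bounded in L^2 and converge pointwise, so they too
    converge weakly.\<close>
  have NB: "(LINT x:D e|lborel. (nl p (U n e x))\<^sup>2) \<le> (M powr (p - 2))\<^sup>2 * B" if e: "e \<in> E" for e n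
  proof -
    have "(LINT x:D e|lborel. (nl p (U n e x))\<^sup>2) \<le> (LINT x:D e|lborel. (M powr (p - 2))\<^sup>2 * (U n e x)\<^sup>2)"
    proof (rule set_integral_mono)
      show "set_integrable lborel (D e) (\<lambda>x. (nl p (U n e x))\<^sup>2)"
        using L2(3)[OF e] by (simp add: L2_on_def)
      show "set_integrable lborel (D e) (\<lambda>x. (M powr (p - 2))\<^sup>2 * (U n e x)\<^sup>2)"
        by (intro set_integrable_mult_right sqi[OF e])
      fix x assume "x \<in> D e"
      then have "\<bar>nl p (U n e x)\<bar> \<le> M powr (p - 2) * \<bar>U n e x\<bar>" by (intro abs_nl_le p M[OF e])
      also have "\<dots> = \<bar>M powr (p - 2) * U n e x\<bar>" by (simp add: abs_mult)
      finally show "(nl p (U n e x))\<^sup>2 \<le> (M powr (p - 2))\<^sup>2 * (U n e x)\<^sup>2"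
        by (simp add: abs_le_square_iff power_mult_distrib)
    qed
    also have "\<dots> = (M powr (p - 2))\<^sup>2 * (LINT x:D e|lborel. (U n e x)\<^sup>2)" by simp
    also have "\<dots> \<le> (M powr (p - 2))\<^sup>2 * B" by (intro mult_left_mono UB[OF e]) simp
    finally show ?thesis .
  qed
  have nlim: "(\<lambda>n. nl p (U n e x)) \<longlonglongrightarrow> nl p (u e x)" if e: "e \<in> E" and x: "x \<in> D e" for e x
    by (rule isCont_tendsto_compose[OF DERIV_isCont[OF has_real_derivative_nl[OF p]] ulim[OF e x]])
  note uw = weak_L2_convergence_on[OF ulim L2(1) UB]
    and ww = weak_L2_convergence_on[OF wlim L2(2) WB]
    and nw = weak_L2_convergence_on[OF nlim L2(3) NB]
  have H1: "H1 u w" unfolding H1_graph_def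
  proof (intro conjI ballI allI impI)
    fix e assume e: "e \<in> E"
    have "set_integrable lborel {0..x} (w e) \<and> u e x = u e 0 + (LINT t:{0..x}|lborel. w e t)"
      if x: "x \<in> D e" for x
    proof -
      have sub: "{0..x} \<subseteq> D e" by (rule edge_dom_subset[OF edge_dom_D[OF e] x])
      have x0: "0 \<le> x" by (rule edge_dom_nonneg[OF edge_dom_D[OF e] x])
      \<comment> \<open>Testing \<open>W n\<close> against this indicator carries the integral
        representation of \<open>U n\<close> over to the limit.\<close>
      have chi: "L2_on (D e) (indicator {0..x})"
      proof -
        have eq: "indicator (D e) t * indicator {0..x} t = (indicator {0..x} t :: real)" for t
          using sub by (auto split: split_indicator)
        have sq: "(indicator {0..x} t)\<^sup>2 = (indicator {0..x} t :: real)" for t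
          by (auto split: split_indicator)
        show ?thesis unfolding L2_on_iff eq sq
          by (intro conjI integrable_real_indicator) (simp_all add: emeasure_lborel_Icc_eq)
      qed
      have restr: "indicator (D e) t *\<^sub>R (f t * indicator {0..x} t) = indicator {0..x} t *\<^sub>R f t" for f :: "real \<Rightarrow> real" and t
        using sub by (auto simp: indicator_def)
      have restr_int: "(LINT t:D e|lborel. f t * indicator {0..x} t) = (LINT t:{0..x}|lborel. f t)" for f :: "real \<Rightarrow> real"
        unfolding set_lebesgue_integral_def restr ..
      have "set_integrable lborel (D e) (\<lambda>t. w e t * indicator {0..x} t)"
        by (rule set_integrable_mult_L2[OF ww(1) chi]) (use e in auto)
      then have wi: "set_integrable lborel {0..x} (w e)" unfolding set_integrable_def restr .
      have "(\<lambda>n. LINT t:D e|lborel. W n e t * indicator {0..x} t) \<longlonglongrightarrow> (LINT t:D e|lborel. w e t * indicator {0..x} t)"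
        by (rule ww(2)[OF _ _ _ _ chi]) (use e in auto)
      then have "(\<lambda>n. U n e 0 + (LINT t:{0..x}|lborel. W n e t)) \<longlonglongrightarrow> u e 0 + (LINT t:{0..x}|lborel. w e t)"
        unfolding restr_int by (intro tendsto_add ulim[OF e zero_in_D[OF e]])
      moreover have "U n e 0 + (LINT t:{0..x}|lborel. W n e t) = U n e x" for n
        using H1_edge[OF regular_solD(1)[OF U[of n]] e] x unfolding H1_edge_def by force
      ultimately have "u e x = u e 0 + (LINT t:{0..x}|lborel. w e t)"
        using LIMSEQ_unique ulim[OF e x] by simp
      with wi show ?thesis by blast
    qed
    moreover have "L2_on (D e) (u e)" by (rule uw(1)) (use e in auto)
    moreover have "L2_on (D e) (w e)" by (rule ww(1)) (use e in auto)
    ultimately show "H1_edge (D e) (u e) (w e)" unfolding H1_edge_def L2_on_def by blast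
  next
    fix e1 e2 assume "e1 \<in> E" "e2 \<in> E"
    then have "U n e1 0 = U n e2 0" for n by (rule H1_vertex[OF regular_solD(1)[OF U]])
    then show "u e1 0 = u e2 0" by (simp add: u_def)
  next
    fix i assume "i < length ll"
    then have "U n (Loop i) (ll ! i) = U n (Loop i) 0" for n
      using regular_solD(1)[OF U[of n]] unfolding H1_graph_def by blast
    then show "u (Loop i) (ll ! i) = u (Loop i) 0" by (simp add: u_def)
  qed
  have L2u: "L2_on (D e) (u e)" "L2_on (D e) (w e)" "L2_on (D e) (\<lambda>x. nl p (u e x))"
    if e: "e \<in> E" for e
    by (rule uw(1) ww(1) nw(1); use e in simp)+
  have weak: "weak_sol u w" unfolding weak_sol_def
  proof (intro conjI H1 allI impI)
    fix \<eta> \<eta>' assume h: "H1 \<eta> \<eta>'"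
    have "(\<lambda>n. weak_form (U n) (W n) \<eta> \<eta>' e) \<longlonglongrightarrow> weak_form u w \<eta> \<eta>' e" if e: "e \<in> E" for e
    proof -
      have \<eta>: "L2_on (D e) (\<eta> e)" "L2_on (D e) (\<eta>' e)" using H1_L2[OF h e] by auto
      show ?thesis
        unfolding weak_form_split[of e "U _" "W _" \<eta> \<eta>', OF L2[OF e] \<eta>]
          weak_form_split[of e u w \<eta> \<eta>', OF L2u[OF e] \<eta>]
        by (intro tendsto_add tendsto_diff uw(2) ww(2) nw(2) \<eta> e) simp_all
    qed
    then have "(\<lambda>n. \<Sum>e\<in>E. weak_form (U n) (W n) \<eta> \<eta>' e) \<longlonglongrightarrow> (\<Sum>e\<in>E. weak_form u w \<eta> \<eta>' e)"
      by (rule tendsto_sum)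
    moreover have "(\<Sum>e\<in>E. weak_form (U n) (W n) \<eta> \<eta>' e) = 0" for n
      by (rule weak_solD[OF regular_solD(2)[OF U] h])
    ultimately show "(\<Sum>e\<in>E. weak_form u w \<eta> \<eta>' e) = 0" by (simp add: LIMSEQ_const_iff)
  qed
  have le: "total_energy u w \<le> L"
  proof -
    have en_u: "energy u w e = (LINT x:D e|lborel. w e x * w e x) + (LINT x:D e|lborel. u e x * u e x)"
      if e: "e \<in> E" for e
      unfolding energy_def power2_eq_square
      by (rule set_integral_add(2)) (use L2u[OF e] in \<open>auto intro: set_integrable_mult_L2\<close>)
    \<comment> \<open>Lower semicontinuity of the norm: the inner product of the n-th solution with
      the limit tends to the energy of the limit and is at most the mean of the two
      energies.\<close>
    let ?c = "\<lambda>n e. (LINT x:D e|lborel. W n e x * w e x) + (LINT x:D e|lborel. U n e x * u e x)"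
    have "(\<lambda>n. ?c n e) \<longlonglongrightarrow> energy u w e" if e: "e \<in> E" for e
      unfolding en_u[OF e] by (intro tendsto_add uw(2) ww(2) L2u e) simp_all
    then have c: "(\<lambda>n. \<Sum>e\<in>E. ?c n e) \<longlonglongrightarrow> total_energy u w"
      unfolding total_energy_def by (rule tendsto_sum)
    have "?c n e \<le> (energy (U n) (W n) e + energy u w e) / 2" if e: "e \<in> E" for n e
    proof -
      have prods: "set_integrable lborel (D e) (\<lambda>x. W n e x * w e x)" "set_integrable lborel (D e) (\<lambda>x. U n e x * u e x)"
        using L2[OF e] L2u[OF e] by (auto intro: set_integrable_mult_L2)
      have i1: "set_integrable lborel (D e) (\<lambda>x. (W n e x)\<^sup>2 + (U n e x)\<^sup>2)"
        by (intro set_integral_add(1) sqi[OF e])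
      have i2: "set_integrable lborel (D e) (\<lambda>x. (w e x)\<^sup>2 + (u e x)\<^sup>2)"
        using L2u[OF e] by (intro set_integral_add(1)) (auto simp: L2_on_def)
      have "?c n e = (LINT x:D e|lborel. W n e x * w e x + U n e x * u e x)"
        by (rule set_integral_add(2)[symmetric, OF prods])
      also have "\<dots> \<le> (LINT x:D e|lborel. (((W n e x)\<^sup>2 + (U n e x)\<^sup>2) + ((w e x)\<^sup>2 + (u e x)\<^sup>2)) / 2)"
      proof (rule set_integral_mono)
        show "set_integrable lborel (D e) (\<lambda>x. W n e x * w e x + U n e x * u e x)"
          by (intro set_integral_add(1) prods)
        show "set_integrable lborel (D e) (\<lambda>x. (((W n e x)\<^sup>2 + (U n e x)\<^sup>2) + ((w e x)\<^sup>2 + (u e x)\<^sup>2)) / 2)"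
          by (intro set_integrable_divide set_integral_add(1) i1 i2)
        show "W n e x * w e x + U n e x * u e x
          \<le> (((W n e x)\<^sup>2 + (U n e x)\<^sup>2) + ((w e x)\<^sup>2 + (u e x)\<^sup>2)) / 2" for x
          using sum_squares_bound[of "W n e x" "w e x"] sum_squares_bound[of "U n e x" "u e x"] by simp
      qed
      also have "\<dots> = (energy (U n) (W n) e + energy u w e) / 2"
        unfolding energy_def by (simp add: set_integral_add(2)[OF i1 i2])
      finally show ?thesis .
    qed
    then have "(\<Sum>e\<in>E. ?c n e) \<le> (\<Sum>e\<in>E. (energy (U n) (W n) e + energy u w e) / 2)" for n
      by (intro sum_mono) blast
    then have "(\<Sum>e\<in>E. ?c n e) \<le> (total_energy (U n) (W n) + total_energy u w) / 2" for n
      by (simp add: total_energy_def sum.distrib sum_divide_distrib[symmetric])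
    moreover have "(\<lambda>n. (total_energy (U n) (W n) + total_energy u w) / 2) \<longlonglongrightarrow> (L + total_energy u w) / 2"
      by (intro tendsto_intros lim) simp
    ultimately have "total_energy u w \<le> (L + total_energy u w) / 2"
      using LIMSEQ_le[OF c] by blast
    then show ?thesis by simp
  qed
  have "nontrivial u"
  proof (rule ccontr)
    assume "\<not> nontrivial u"
    then have u0: "u e x = 0" if "e \<in> E" "x \<in> D e" for e x using that by (auto simp: nontrivial_def)
    obtain \<epsilon> where \<epsilon>: "0 < \<epsilon>" and small: "\<And>u w. regular_sol u w \<Longrightarrow> \<bar>u (Half 0) 0\<bar> \<le> \<epsilon> \<Longrightarrow>
      (\<And>e x. e \<in> Bd \<Longrightarrow> x \<in> {0..len e} \<Longrightarrow> \<bar>u e x\<bar> \<le> \<epsilon>) \<Longrightarrow> \<not> nontrivial u"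
      using nontrivial_lower_bound[OF nonres] by blast
    \<comment> \<open>Sending the second index of the stability estimate to infinity gives a rate in
      terms of the initial data. The factor exp(C x) is bounded on a compact interval, so
      convergence is uniform there.\<close>
    have sq: "(U n e x - u e x)\<^sup>2 \<le> exp (C * x) * ((U n e 0 - u e 0)\<^sup>2 + (W n e 0 - w e 0)\<^sup>2)"
      if e: "e \<in> E" and x: "x \<in> D e" for n e x
    proof (rule LIMSEQ_le)
      show "(\<lambda>m. (U n e x - U m e x)\<^sup>2) \<longlonglongrightarrow> (U n e x - u e x)\<^sup>2"
        by (intro tendsto_intros ulim e x)
      show "(\<lambda>m. exp (C * x) * ((U n e 0 - U m e 0)\<^sup>2 + (W n e 0 - W m e 0)\<^sup>2))
        \<longlonglongrightarrow> exp (C * x) * ((U n e 0 - u e 0)\<^sup>2 + (W n e 0 - w e 0)\<^sup>2)"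
        by (intro tendsto_intros ulim wlim e zero_in_D)
      show "\<exists>N. \<forall>m\<ge>N. (U n e x - U m e x)\<^sup>2 \<le> exp (C * x) * ((U n e 0 - U m e 0)\<^sup>2 + (W n e 0 - W m e 0)\<^sup>2)"
      proof (intro exI allI impI)
        show "(U n e x - U m e x)\<^sup>2 \<le> exp (C * x) * ((U n e 0 - U m e 0)\<^sup>2 + (W n e 0 - W m e 0)\<^sup>2)" for m
          by (rule order_trans[OF _ stab[OF e x]]) simp
      qed
    qed
    have ev: "\<forall>\<^sub>F n in sequentially. \<forall>x\<in>{0..len e}. \<bar>U n e x\<bar> \<le> \<epsilon>" if e: "e \<in> E" and sub: "{0..len e} \<subseteq> D e" for e
    proof -
      let ?b = "\<lambda>n. exp (C * len e) * ((U n e 0 - u e 0)\<^sup>2 + (W n e 0 - w e 0)\<^sup>2)"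
      have "?b \<longlonglongrightarrow> exp (C * len e) * ((u e 0 - u e 0)\<^sup>2 + (w e 0 - w e 0)\<^sup>2)"
        by (intro tendsto_intros ulim wlim e zero_in_D)
      then have "\<forall>\<^sub>F n in sequentially. ?b n < \<epsilon>\<^sup>2"
        by (rule order_tendstoD(2)) (use \<epsilon> in simp)
      then show ?thesis
      proof (eventually_elim, intro ballI)
        fix n x assume b: "?b n < \<epsilon>\<^sup>2" and x: "x \<in> {0..len e}"
        have xD: "x \<in> D e" using sub x by blast
        have "(U n e x)\<^sup>2 \<le> exp (C * x) * ((U n e 0 - u e 0)\<^sup>2 + (W n e 0 - w e 0)\<^sup>2)"
          using sq[OF e xD, of n] u0[OF e xD] by simp
        also have "\<dots> \<le> ?b n" using x C0 by (intro mult_right_mono) (auto intro!: mult_left_mono)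
        finally have "(U n e x)\<^sup>2 \<le> \<epsilon>\<^sup>2" using b by simp
        then show "\<bar>U n e x\<bar> \<le> \<epsilon>" using \<epsilon> by (simp add: abs_le_square_iff[symmetric])
      qed
    qed
    have "\<forall>\<^sub>F n in sequentially. \<forall>e\<in>Bd. \<forall>x\<in>{0..len e}. \<bar>U n e x\<bar> \<le> \<epsilon>"
      by (intro eventually_ball_finite finite_Bd ballI ev) (auto simp: E_eq D_Bd)
    \<comment> \<open>Since \<open>len (Half 0)\<close> is 0, this is smallness of the vertex
      value.\<close>
    moreover have "\<forall>\<^sub>F n in sequentially. \<forall>x\<in>{0..len (Half 0)}. \<bar>U n (Half 0) x\<bar> \<le> \<epsilon>"
      by (rule ev[OF Half_0(2)]) simp
    ultimately have "\<forall>\<^sub>F n in sequentially. False"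
    proof eventually_elim
      case (elim n)
      have "\<not> nontrivial (U n)"
        by (rule small[OF U]) (use elim in auto)
      then show False using nontriv by blast
    qed
    then show False by simp
  qed
  with weak le show ?thesis by blast
qed

section \<open>Existence of a minimizer\<close>

lemma minimal_energy_attained:
  assumes ex: "regular_sol u0 w0" "nontrivial u0"
    and nonres: "\<And>m. m \<le> H \<Longrightarrow> (\<Sum>e\<in>Bd. tau e) \<noteq> real H - 2 * real m"
  shows "\<exists>u w. regular_sol u w \<and> nontrivial u \<and>
    (\<forall>v v'. regular_sol v v' \<longrightarrow> nontrivial v \<longrightarrow> total_energy u w \<le> total_energy v v')"
proof -
  define S where "S = {total_energy u w | u w. regular_sol u w \<and> nontrivial u}"
  define L where "L = Inf S"
  have S: "S \<noteq> {}" using ex by (auto simp: S_def)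
  have bdd: "bdd_below S"
    by (rule bdd_belowI[of _ 0]) (auto simp: S_def total_energy_def intro!: sum_nonneg energy_nonneg)
  have L_le: "L \<le> total_energy v v'" if "regular_sol v v'" "nontrivial v" for v v'
    unfolding L_def by (rule cInf_lower[OF _ bdd]) (use that in \<open>auto simp: S_def\<close>)
  have "\<forall>n::nat. \<exists>uw. regular_sol (fst uw) (snd uw) \<and> nontrivial (fst uw)
      \<and> total_energy (fst uw) (snd uw) < L + 1 / real (Suc n)"
  proof
    fix n :: nat
    have "Inf S < L + 1 / real (Suc n)" by (simp add: L_def)
    then obtain y where "y \<in> S" "y < L + 1 / real (Suc n)"
      using cInf_lessD[OF S] by blast
    then show "\<exists>uw. regular_sol (fst uw) (snd uw) \<and> nontrivial (fst uw)
      \<and> total_energy (fst uw) (snd uw) < L + 1 / real (Suc n)" by (auto simp: S_def)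
  qed
  then have "\<exists>UW. \<forall>n::nat. regular_sol (fst (UW n)) (snd (UW n)) \<and> nontrivial (fst (UW n))
      \<and> total_energy (fst (UW n)) (snd (UW n)) < L + 1 / real (Suc n)" by (rule choice)
  then obtain UW where UW: "\<forall>n::nat. regular_sol (fst (UW n)) (snd (UW n)) \<and> nontrivial (fst (UW n))
      \<and> total_energy (fst (UW n)) (snd (UW n)) < L + 1 / real (Suc n)" ..
  define U where "U n = fst (UW n)" for n
  define W where "W n = snd (UW n)" for n
  have U: "regular_sol (U n) (W n)" "nontrivial (U n)"
    and less: "total_energy (U n) (W n) < L + 1 / real (Suc n)" for n
    using UW by (auto simp: U_def W_def)
  have B: "total_energy (U n) (W n) \<le> L + 1" for n
  proof -
    have "1 / real (Suc n) \<le> 1" by simp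
    then show ?thesis using less[of n] by linarith
  qed
  have lim: "(\<lambda>n. total_energy (U n) (W n)) \<longlonglongrightarrow> L"
  proof (rule tendsto_sandwich)
    show "\<forall>\<^sub>F n in sequentially. L \<le> total_energy (U n) (W n)" using L_le U by simp
    show "\<forall>\<^sub>F n in sequentially. total_energy (U n) (W n) \<le> L + 1 / real (Suc n)"
      using less by (simp add: less_imp_le)
    show "(\<lambda>n. L + 1 / real (Suc n)) \<longlonglongrightarrow> L"
      using tendsto_add[OF tendsto_const LIMSEQ_inverse_real_of_nat, of L] by (simp add: inverse_eq_divide)
  qed simp
  obtain M where M: "\<And>n e x. e \<in> E \<Longrightarrow> x \<in> D e \<Longrightarrow> \<bar>U n e x\<bar> \<le> M" "\<And>n e. e \<in> E \<Longrightarrow> \<bar>W n e 0\<bar> \<le> M"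
    using uniform_bounds[of "L + 1"] U B by blast
  have M': "\<bar>U n e 0\<bar> \<le> M" if "e \<in> E" for n e
    by (rule M(1)[OF that zero_in_D[OF that]])
  \<comment> \<open>Values and slopes on all edges are indexed by one finite set, the Boolean
    telling them apart, so a single subsequence serves for all.\<close>
  have "\<exists>r. strict_mono r \<and> (\<forall>eb\<in>E \<times> UNIV. convergent (\<lambda>n. (\<lambda>n (e, b). if b then U n e 0 else W n e 0) (r n) eb))"
    by (rule finite_convergent_subseq) (use M' M(2) in auto)
  then obtain r where r: "strict_mono r"
    and conv: "\<forall>eb\<in>E \<times> UNIV. convergent (\<lambda>n. (\<lambda>n (e, b). if b then U n e 0 else W n e 0) (r n) eb)"
    by auto
  have "\<exists>u w. weak_sol u w \<and> nontrivial u \<and> total_energy u w \<le> L"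
  proof (rule limit_solution[OF _ _ _ _ _ _ nonres])
    show "regular_sol (U (r n)) (W (r n))" "nontrivial (U (r n))" "total_energy (U (r n)) (W (r n)) \<le> L + 1" for n
      using U B by auto
    show "convergent (\<lambda>n. U (r n) e 0)" if "e \<in> E" for e
      using bspec[OF conv, of "(e, True)"] that by simp
    show "convergent (\<lambda>n. W (r n) e 0)" if "e \<in> E" for e
      using bspec[OF conv, of "(e, False)"] that by simp
    show "(\<lambda>n. total_energy (U (r n)) (W (r n))) \<longlonglongrightarrow> L"
      using LIMSEQ_subseq_LIMSEQ[OF lim r] by (simp add: o_def)
  qed
  then obtain u w' where u: "weak_sol u w'" "nontrivial u" "total_energy u w' \<le> L" by auto
  \<comment> \<open>The limit is so far only a weak solution; replacing its derivative by the
    classical one leaves the energy unchanged.\<close>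
  obtain w where w: "regular_sol u w" and ae: "\<forall>e\<in>E. AE x in lborel. x \<in> D e \<longrightarrow> w' e x = w e x"
    using weak_sol_regular[OF u(1)] by auto
  have "H1 u w'" using u(1) by (simp add: weak_sol_def)
  then have "energy u w' e = energy u w e" if "e \<in> E" for e
    using ae that by (intro energy_cong_AE[OF _ regular_solD(1)[OF w]]) auto
  then have "total_energy u w = total_energy u w'" by (simp add: total_energy_def)
  then show ?thesis using w u L_le by (metis order_trans)
qed

end

theorem theorem1p2:
  fixes H :: nat and lp ll :: "real list" and p :: real
  assumes "p > 2"
    and "H \<ge> 1"
    and "\<forall>i<length lp. lp ! i > 0"
    and "\<forall>i<length ll. ll ! i > 0"
    and "\<exists>u. bound_state H lp ll p u"
    and "\<forall>n::nat. n \<le> H div 2 \<longrightarrow>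
           (\<Sum>i<length lp. tanh (lp ! i)) + 2 * (\<Sum>i<length ll. tanh (ll ! i / 2))
             \<noteq> real H - 2 * real n"
  shows "\<exists>u. action_ground_state H lp ll p u"
proof -
  interpret single_knot H lp ll p using assms(1-4) by unfold_locales auto
  obtain v where "bound_state H lp ll p v" using assms(5) ..
  then obtain v' where "nontrivial v" "weak_sol v v'" by (auto simp: bound_state_iff)
  then obtain v'' where "regular_sol v v''" "nontrivial v" using weak_sol_regular by blast
  then obtain u w where u: "regular_sol u w" "nontrivial u"
    and min: "\<forall>v v'. regular_sol v v' \<longrightarrow> nontrivial v \<longrightarrow> total_energy u w \<le> total_energy v v'"
    using minimal_energy_attained nonresonant assms(6) by metis
  have c: "0 \<le> 1 / 2 - 1 / p" using assms(1) by (simp add: field_simps)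
  have "action_ground_state H lp ll p u"
    unfolding action_ground_state_def
  proof (intro conjI exI[of _ w] allI impI)
    show "bound_state H lp ll p u" using u regular_solD(2) by (auto simp: bound_state_iff)
    show "H1 u w" by (rule regular_solD(1)[OF u(1)])
    fix z z' assume z: "bound_state H lp ll p z \<and> H1 z z'"
    then obtain y where y: "regular_sol z y" "action H lp ll p z z' = (1 / 2 - 1 / p) * total_energy z y"
      using action_bound_state by blast
    have "nontrivial z" using z by (simp add: bound_state_iff)
    then have "total_energy u w \<le> total_energy z y" using min y(1) by blast
    then show "action H lp ll p u w \<le> action H lp ll p z z'"
      unfolding y(2) action_regular_sol[OF u(1)] by (rule mult_left_mono[OF _ c])
  qed
  then show ?thesis by (rule exI[of _ u])
qed

end
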